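(* For every integer $m\ge 2$ and every $\epsilon>0$ there exists a (non-empty) open, bounded, and connected set $\Omega_{\epsilon}\subset\mathbb{R}^m$ such that $$\|v_{\Omega_{\epsilon}}\|_{L^{\infty}(\Omega_{\epsilon})}\,\lambda(\Omega_{\epsilon})<1+\epsilon .$$
   Context: For a non-empty bounded open set $\Omega\subset\mathbb{R}^m$, the torsion function $v_\Omega$ is the unique (weak) solution of $-\Delta v=1$ in $\Omega$, $v\in H_0^1(\Omega)$. The quantity $$\lambda(\Omega)=\inf_{\varphi\in H_0^1(\Omega)\setminus\{0\}}\frac{\int_\Omega|D\varphi|^2}{\int_\Omega\varphi^2}$$ is the bottom of the spectrum of the Dirichlet Laplacian acting in $L^2(\Omega)$. *)

theory Defs
  imports "HOL-Analysis.Analysis" "HOL-Probability.Essential_Supremum"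
begin

section \<open>Test functions\<close>

definition partial_deriv :: "('a::euclidean_space \<Rightarrow> real) \<Rightarrow> 'a \<Rightarrow> 'a \<Rightarrow> real" where
  "partial_deriv f b x = frechet_derivative f (at x) b"

definition grad :: "('a::euclidean_space \<Rightarrow> real) \<Rightarrow> 'a \<Rightarrow> 'a" where
  "grad f x = (\<Sum>b\<in>Basis. partial_deriv f b x *\<^sub>R b)"

text \<open>The function is of class \<open>C^k\<close> on the whole space.  Differentiability has to be required
  explicitly, because \<^const>\<open>frechet_derivative\<close> is an arbitrary choice where it fails.\<close>

primrec Ck :: "nat \<Rightarrow> ('a::euclidean_space \<Rightarrow> real) \<Rightarrow> bool" where
  "Ck 0 f \<longleftrightarrow> continuous_on UNIV f"
| "Ck (Suc k) f \<longleftrightarrow> (\<forall>x. f differentiable (at x)) \<and> (\<forall>b\<in>Basis. Ck k (partial_deriv f b))"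

text \<open>\<open>C_c^\<infinity>(\<Omega>)\<close>, each function being extended by zero to the whole space.\<close>

definition test_functions :: "'a::euclidean_space set \<Rightarrow> ('a \<Rightarrow> real) set" where
  "test_functions \<Omega> =
     {\<phi>. (\<forall>k. Ck k \<phi>) \<and> compact (closure {x. \<phi> x \<noteq> 0}) \<and> closure {x. \<phi> x \<noteq> 0} \<subseteq> \<Omega>}"

section \<open>Sobolev spaces\<close>

text \<open>Elements of \<open>L^2(\<Omega>)\<close>, \<open>H^1(\<Omega>)\<close> and \<open>H_0^1(\<Omega>)\<close> are represented by functions on the whole
  space; only their values almost everywhere in \<open>\<Omega>\<close> matter.\<close>

definition L2_on :: "'a::euclidean_space set \<Rightarrow> ('a \<Rightarrow> 'b::euclidean_space) set" where
  "L2_on \<Omega> = {f. f \<in> borel_measurable (lebesgue_on \<Omega>) \<and>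
                   integrable (lebesgue_on \<Omega>) (\<lambda>x. (norm (f x))\<^sup>2)}"

text \<open>\<open>u \<in> H^1(\<Omega>)\<close> with distributional gradient \<open>G\<close>, which \<open>u\<close> determines almost everywhere
  in \<open>\<Omega>\<close> if \<open>\<Omega>\<close> is open.\<close>

definition has_weak_gradient ::
    "'a::euclidean_space set \<Rightarrow> ('a \<Rightarrow> real) \<Rightarrow> ('a \<Rightarrow> 'a) \<Rightarrow> bool" where
  "has_weak_gradient \<Omega> u G \<longleftrightarrow>
     u \<in> L2_on \<Omega> \<and> G \<in> L2_on \<Omega> \<and>
     (\<forall>\<phi>\<in>test_functions \<Omega>.
        (\<integral>x. u x *\<^sub>R grad \<phi> x \<partial>lebesgue_on \<Omega>) = - (\<integral>x. \<phi> x *\<^sub>R G x \<partial>lebesgue_on \<Omega>))"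

text \<open>\<open>H_0^1(\<Omega>)\<close>: the closure of \<open>C_c^\<infinity>(\<Omega>)\<close> in \<open>H^1(\<Omega>)\<close>.\<close>

definition H01 :: "'a::euclidean_space set \<Rightarrow> ('a \<Rightarrow> real) set" where
  "H01 \<Omega> = {u. \<exists>G. has_weak_gradient \<Omega> u G \<and>
     (\<exists>\<phi>. (\<forall>n::nat. \<phi> n \<in> test_functions \<Omega>) \<and>
       (\<lambda>n. (\<integral>x. (\<phi> n x - u x)\<^sup>2 \<partial>lebesgue_on \<Omega>) +
             (\<integral>x. (norm (grad (\<phi> n) x - G x))\<^sup>2 \<partial>lebesgue_on \<Omega>)) \<longlonglongrightarrow> 0)}"

section \<open>Torsion function and bottom of the Dirichlet spectrum\<close>

text \<open>\<open>v\<close> is a weak solution of \<open>-\<Delta>v = 1\<close> in \<open>\<Omega>\<close>, \<open>v \<in> H_0^1(\<Omega>)\<close>.\<close>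

definition is_torsion_function :: "'a::euclidean_space set \<Rightarrow> ('a \<Rightarrow> real) \<Rightarrow> bool" where
  "is_torsion_function \<Omega> v \<longleftrightarrow>
     v \<in> H01 \<Omega> \<and>
     (\<exists>G. has_weak_gradient \<Omega> v G \<and>
       (\<forall>\<phi>\<in>test_functions \<Omega>.
          (\<integral>x. G x \<bullet> grad \<phi> x \<partial>lebesgue_on \<Omega>) = (\<integral>x. \<phi> x \<partial>lebesgue_on \<Omega>)))"

text \<open>For a bounded open set the torsion function exists and is unique as an element of
  \<open>H_0^1(\<Omega>)\<close>; the choice is only that of a representative modulo null sets.\<close>

definition torsion_function :: "'a::euclidean_space set \<Rightarrow> 'a \<Rightarrow> real" where
  "torsion_function \<Omega> = (SOME v. is_torsion_function \<Omega> v)"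

definition Linf_norm :: "'a::euclidean_space set \<Rightarrow> ('a \<Rightarrow> real) \<Rightarrow> ereal" where
  "Linf_norm \<Omega> f = esssup (lebesgue_on \<Omega>) (\<lambda>x. ereal \<bar>f x\<bar>)"

definition dirichlet_bottom :: "'a::euclidean_space set \<Rightarrow> real" where
  "dirichlet_bottom \<Omega> =
     Inf {(\<integral>x. (norm (G x))\<^sup>2 \<partial>lebesgue_on \<Omega>) / (\<integral>x. (\<phi> x)\<^sup>2 \<partial>lebesgue_on \<Omega>) | \<phi> G.
            \<phi> \<in> H01 \<Omega> \<and> has_weak_gradient \<Omega> \<phi> G \<and> \<not> (AE x in lebesgue_on \<Omega>. \<phi> x = 0)}"

end

theory Submission
  imports Defs
begin

text \<open>The domain is a large cube perforated along a periodic array of thin tubes around the points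
  \<open>x\<^sub>1 \<in> 2\<int>\<close>, \<open>x\<^sub>2 \<in> \<int>\<close> (crushed ice).  Up to normalisation it is the set where
  \<open>u = \<Sum>\<^sub>n ln (cosh (\<pi> (x\<^sub>2 - n)) - cos (\<pi> x\<^sub>1) + a) - \<pi> x\<^sub>2\<^sup>2 + const\<close> is positive.  For \<open>a = 0\<close> each
  logarithm is harmonic off its poles, so \<open>-\<Delta>u = 2\<pi>\<close> there; a tiny \<open>a > 0\<close> makes \<open>u\<close> smooth on the
  whole space and changes this only slightly where \<open>u > 0\<close>.  The sum of the logarithms
  behaves like \<open>\<Sum>\<^sub>n \<pi> \<bar>x\<^sub>2 - n\<bar>\<close>, that is like \<open>\<pi> x\<^sub>2\<^sup>2\<close> plus a constant, hence with a large
  constant \<open>u\<close> is nearly constant outside thin slabs.  By comparison \<open>u\<close>, suitably normalised, bounds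
  the torsion function.  The test function \<open>\<eta> F(u)\<close>, with a slowly varying cutoff \<open>\<eta>\<close> and a smooth
  convex \<open>F\<close> vanishing on the negative axis, satisfies \<open>\<integral>\<bar>D(\<eta> F(u))\<bar>\<^sup>2 = \<integral>\<bar>D\<eta>\<bar>\<^sup>2 F(u)\<^sup>2 - \<integral>\<eta>\<^sup>2 F(u) \<Delta>F(u)\<close>, so its
  Rayleigh quotient is close to \<open>1 / max u\<close> for the normalised \<open>u\<close>.\<close>

section \<open>Smooth functions\<close>

text \<open>The errors made in replacing the sum over rows by its continuous counterpart, and the
  loss \<open>ln (\<delta> / 2)\<close> per row off the slabs, are all proportional to the number
  \<open>2 M\<close> of rows. The additive constant therefore has the form \<open>B M\<close>: in
  the cube \<open>u\<close> is at most \<open>(B + 8) M\<close>, off the slabs at least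
  \<open>(B - C) M\<close>, with \<open>C\<close> fixed by the width of the slabs, and a large
  \<open>B\<close> brings the ratio near 1. This linear growth is still harmless for the cutoff: on
  a ball of radius \<open>N = M / 2\<close> it costs about \<open>1 / N^2\<close>, against a
  quotient \<open>1 / max u\<close> of order \<open>1 / N\<close>. The set depends on
  \<open>a\<close>, so the effect of \<open>a\<close> must be controlled uniformly over it.
  Positivity of \<open>u\<close>, with the upper bounds for the other logarithms, bounds each single
  logarithm from below independently of \<open>a\<close>; hence \<open>a\<close> can be chosen last.
  No regularity of the boundary enters. Comparison uses only \<open>W \<ge> 0\<close> and
  \<open>laplacian W \<le> -1\<close> inside the set, so \<open>u\<close> may be positive on the
  sides of the cube, and the test function is cut off before reaching them.\<close>

definition smooth :: "('a::euclidean_space \<Rightarrow> real) \<Rightarrow> bool" where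
  "smooth f \<longleftrightarrow> (\<forall>k. Ck k f)"

definition laplacian :: "('a::euclidean_space \<Rightarrow> real) \<Rightarrow> 'a \<Rightarrow> real" where
  "laplacian f x = (\<Sum>b\<in>Basis. partial_deriv (partial_deriv f b) b x)"

lemma partial_derivI: "(f has_derivative f') (at x) \<Longrightarrow> partial_deriv f b x = f' b"
  unfolding partial_deriv_def by (metis frechet_derivative_at)

lemma partial_deriv_GDERIV: "GDERIV f x :> D \<Longrightarrow> partial_deriv f b x = D \<bullet> b"
  unfolding gderiv_def by (drule partial_derivI[where b=b]) (simp add: inner_commute)

lemma grad_inner: "b \<in> Basis \<Longrightarrow> grad f x \<bullet> b = partial_deriv f b x"
  unfolding grad_def by (simp add: inner_sum_left inner_Basis if_distrib cong: if_cong)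

lemma grad_GDERIV: "GDERIV f x :> D \<Longrightarrow> grad f x = D"
  by (rule euclidean_eqI) (simp add: grad_inner partial_deriv_GDERIV)

lemma GDERIV_grad:
  assumes "f differentiable (at x)"
  shows "GDERIV f x :> grad f x"
proof -
  obtain f' where f': "(f has_derivative f') (at x)"
    using assms unfolding differentiable_def by blast
  then have lin: "linear f'" by (rule has_derivative_linear)
  have "f' h = h \<bullet> grad f x" for h
  proof -
    have "f' h = f' (\<Sum>b\<in>Basis. (h \<bullet> b) *\<^sub>R b)" by (simp add: euclidean_representation)
    also have "\<dots> = (\<Sum>b\<in>Basis. (h \<bullet> b) * f' b)"
      by (simp add: linear_sum[OF lin] linear_cmul[OF lin])
    also have "\<dots> = h \<bullet> grad f x"
      unfolding grad_def by (simp add: inner_sum_right partial_derivI[OF f'] mult.commute)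
    finally show ?thesis .
  qed
  then have "f' = (\<lambda>h. h \<bullet> grad f x)" by auto
  with f' show ?thesis unfolding gderiv_def by simp
qed

lemma GDERIV_differentiable: "GDERIV f x :> D \<Longrightarrow> f differentiable (at x)"
  unfolding gderiv_def differentiable_def by blast

lemma grad_norm_sq: "(norm (grad f x))\<^sup>2 = (\<Sum>b\<in>Basis. (partial_deriv f b x)\<^sup>2)"
  by (subst power2_norm_eq_inner, subst euclidean_inner) (simp add: grad_inner power2_eq_square)

lemma grad_dot: "grad f x \<bullet> grad g x = (\<Sum>b\<in>Basis. partial_deriv f b x * partial_deriv g b x)"
  by (subst euclidean_inner) (simp add: grad_inner)

lemma Ck_differentiable: "Ck (Suc k) f \<Longrightarrow> f differentiable (at x)"
  by simp

lemma Ck_SucD: "Ck (Suc k) f \<Longrightarrow> Ck k f"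
proof (induction k arbitrary: f)
  case 0
  then show ?case
    by (auto intro!: continuous_at_imp_continuous_on differentiable_imp_continuous_within)
next
  case (Suc k)
  then show ?case by simp
qed

lemma Ck_const: "Ck k (\<lambda>x. c)"
proof (induction k arbitrary: c)
  case (Suc k)
  have "partial_deriv (\<lambda>x::'a. c) b = (\<lambda>x. 0)" for b
    by (rule ext) (rule partial_derivI, rule derivative_intros)
  with Suc show ?case by simp
qed simp

lemma partial_deriv_add:
  "f differentiable (at x) \<Longrightarrow> g differentiable (at x) \<Longrightarrow>
    partial_deriv (\<lambda>x. f x + g x) b x = partial_deriv f b x + partial_deriv g b x"
  by (subst partial_deriv_GDERIV[OF GDERIV_add[OF GDERIV_grad GDERIV_grad]])
     (auto simp: inner_add_left partial_deriv_GDERIV[OF GDERIV_grad])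

lemma partial_deriv_mult:
  "f differentiable (at x) \<Longrightarrow> g differentiable (at x) \<Longrightarrow>
    partial_deriv (\<lambda>x. f x * g x) b x = f x * partial_deriv g b x + g x * partial_deriv f b x"
  by (subst partial_deriv_GDERIV[OF GDERIV_mult[OF GDERIV_grad GDERIV_grad]])
     (auto simp: inner_add_left partial_deriv_GDERIV[OF GDERIV_grad])

lemma partial_deriv_compose:
  "f differentiable (at x) \<Longrightarrow> (g has_real_derivative g') (at (f x)) \<Longrightarrow>
    partial_deriv (\<lambda>x. g (f x)) b x = g' * partial_deriv f b x"
  by (subst partial_deriv_GDERIV[OF GDERIV_DERIV_compose[OF GDERIV_grad]])
     (auto simp: inner_add_left partial_deriv_GDERIV[OF GDERIV_grad])

lemma Ck_add: "Ck k f \<Longrightarrow> Ck k g \<Longrightarrow> Ck k (\<lambda>x. f x + g x)"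
proof (induction k arbitrary: f g)
  case 0
  then show ?case by (auto intro: continuous_intros)
next
  case (Suc k)
  have "partial_deriv (\<lambda>x. f x + g x) b = (\<lambda>x. partial_deriv f b x + partial_deriv g b x)" for b
    using Suc.prems by (intro ext partial_deriv_add) auto
  with Suc show ?case by simp
qed

lemma Ck_mult: "Ck k f \<Longrightarrow> Ck k g \<Longrightarrow> Ck k (\<lambda>x. f x * g x)"
proof (induction k arbitrary: f g)
  case 0
  then show ?case by (auto intro: continuous_intros)
next
  case (Suc k)
  have "partial_deriv (\<lambda>x. f x * g x) b = (\<lambda>x. f x * partial_deriv g b x + g x * partial_deriv f b x)" for b
    using Suc.prems by (intro ext partial_deriv_mult) auto
  moreover have "Ck k f" "Ck k g" using Suc.prems by (auto intro: Ck_SucD)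
  ultimately show ?case using Suc by (auto intro!: Ck_add)
qed

text \<open>Agreement with \<open>h\<close> on an open set passes to partial derivatives, so the
  induction on \<open>k\<close> keeps the same open set. It serves functions glued from a formula on
  an open set and zero elsewhere.\<close>

lemma Ck_local:
  assumes "\<And>x. \<exists>S h. open S \<and> x \<in> S \<and> Ck k h \<and> (\<forall>y\<in>S. f y = h y)"
  shows "Ck k f"
  using assms
proof (induction k arbitrary: f)
  case 0
  have "isCont f x" for x
  proof -
    obtain S h where S: "open S" "x \<in> S" "continuous_on UNIV h" "\<And>y. y \<in> S \<Longrightarrow> f y = h y"
      using 0[of x] by auto
    have "continuous_on S h" using S(3) by (rule continuous_on_subset) simp
    then have "continuous_on S f" using S(4) by (simp cong: continuous_on_cong)
    then show ?thesis using S(1,2) continuous_on_eq_continuous_at by blast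
  qed
  then show ?case by (simp add: continuous_on_eq_continuous_at)
next
  case (Suc k)
  have der: "GDERIV f y :> grad h y" if "open S" "y \<in> S" "Ck (Suc k) h" "\<forall>y\<in>S. f y = h y" for S h y
    using GDERIV_grad[of h y] that unfolding gderiv_def
    by (auto intro: has_derivative_transform_within_open[where s=S])
  have "f differentiable (at x)" for x
    using Suc.prems[of x] der by (blast intro: GDERIV_differentiable)
  moreover have "Ck k (partial_deriv f b)" if b: "b \<in> Basis" for b
  proof (rule Suc.IH)
    fix x
    obtain S h where S: "open S" "x \<in> S" "Ck (Suc k) h" "\<forall>y\<in>S. f y = h y"
      using Suc.prems by blast
    have "\<forall>y\<in>S. partial_deriv f b y = partial_deriv h b y"
      using partial_deriv_GDERIV[OF der[OF S(1) _ S(3,4)]] b by (simp add: grad_inner)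
    with S b show "\<exists>S h. open S \<and> x \<in> S \<and> Ck k h \<and> (\<forall>y\<in>S. partial_deriv f b y = h y)"
      by (intro exI[of _ S] exI[of _ "partial_deriv h b"]) simp
  qed
  ultimately show ?case by simp
qed

lemma smooth_differentiable [simp]: "smooth f \<Longrightarrow> f differentiable (at x)"
  unfolding smooth_def by (metis Ck_differentiable)

lemma smooth_GDERIV: "smooth f \<Longrightarrow> GDERIV f x :> grad f x"
  by (simp add: GDERIV_grad)

lemma smooth_partial [intro]: "smooth f \<Longrightarrow> b \<in> Basis \<Longrightarrow> smooth (partial_deriv f b)"
  unfolding smooth_def by (metis Ck.simps(2))

lemma smooth_continuous: "smooth f \<Longrightarrow> continuous_on S f"
  unfolding smooth_def by (meson Ck.simps(1) continuous_on_subset subset_UNIV)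

lemma smooth_const [intro]: "smooth (\<lambda>x. c)"
  and smooth_add [intro]: "smooth f \<Longrightarrow> smooth g \<Longrightarrow> smooth (\<lambda>x. f x + g x)"
  and smooth_mult [intro]: "smooth f \<Longrightarrow> smooth g \<Longrightarrow> smooth (\<lambda>x. f x * g x)"
  unfolding smooth_def by (auto intro: Ck_const Ck_add Ck_mult)

lemma smooth_minus [intro]: "smooth f \<Longrightarrow> smooth (\<lambda>x. - f x)"
  using smooth_mult[OF smooth_const[of "-1"], of f] by simp

lemma smooth_diff [intro]: "smooth f \<Longrightarrow> smooth g \<Longrightarrow> smooth (\<lambda>x. f x - g x)"
  using smooth_add[OF _ smooth_minus, of f g] by simp

lemma smooth_power [intro]: "smooth f \<Longrightarrow> smooth (\<lambda>x. f x ^ n)"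
  by (induction n) auto

lemma smooth_sum [intro]: "(\<And>i. i \<in> I \<Longrightarrow> smooth (f i)) \<Longrightarrow> smooth (\<lambda>x. \<Sum>i\<in>I. f i x)"
  by (induction I rule: infinite_finite_induct) auto

lemma smooth_local:
  assumes "\<And>x. \<exists>S h. open S \<and> x \<in> S \<and> smooth h \<and> (\<forall>y\<in>S. f y = h y)"
  shows "smooth f"
  unfolding smooth_def
proof
  fix k show "Ck k f"
  proof (rule Ck_local)
    fix x
    show "\<exists>S h. open S \<and> x \<in> S \<and> Ck k h \<and> (\<forall>y\<in>S. f y = h y)"
      using assms[of x] unfolding smooth_def by blast
  qed
qed

lemma GDERIV_inner: "GDERIV (\<lambda>x. x \<bullet> e) x :> e"
  unfolding gderiv_def by (auto intro!: derivative_eq_intros)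

lemma smooth_inner [intro]: "smooth (\<lambda>x. x \<bullet> e)"
  unfolding smooth_def
proof
  fix k
  have "partial_deriv (\<lambda>x. x \<bullet> e) b = (\<lambda>x. e \<bullet> b)" for b
    by (rule ext) (rule partial_deriv_GDERIV[OF GDERIV_inner])
  then show "Ck k (\<lambda>x. x \<bullet> e)"
    by (cases k) (auto intro!: Ck_const continuous_intros GDERIV_differentiable[OF GDERIV_inner])
qed

text \<open>The outer function comes with the whole sequence of its derivatives: each
  differentiation replaces \<open>g n\<close> by \<open>g (Suc n)\<close> and multiplies by a
  partial derivative of \<open>f\<close>, and \<open>Ck_mult\<close> closes the induction.\<close>

lemma smooth_compose:
  fixes g :: "nat \<Rightarrow> real \<Rightarrow> real"
  assumes g: "\<And>n t. t \<in> U \<Longrightarrow> (g n has_real_derivative g (Suc n) t) (at t)"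
    and f: "smooth f" and U: "\<And>x. f x \<in> U"
  shows "smooth (\<lambda>x. g n (f x))"
proof -
  have "Ck k (\<lambda>x. g n (f x))" for k
  proof (induction k arbitrary: n)
    case 0
    have "isCont (\<lambda>x. g n (f x)) x" for x
      by (rule isCont_o2[OF differentiable_imp_continuous_within[OF smooth_differentiable[OF f]]
            DERIV_isCont[OF g[OF U]]])
    then show ?case by (simp add: continuous_on_eq_continuous_at)
  next
    case (Suc k)
    have "partial_deriv (\<lambda>x. g n (f x)) b = (\<lambda>x. g (Suc n) (f x) * partial_deriv f b x)" for b
      using f by (intro ext partial_deriv_compose g U) auto
    moreover have "(\<lambda>x. g n (f x)) differentiable (at x)" for x
      using GDERIV_DERIV_compose[OF smooth_GDERIV[OF f] g[OF U]] by (blast intro: GDERIV_differentiable)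
    moreover have "b \<in> Basis \<Longrightarrow> Ck k (partial_deriv f b)" for b
      using f smooth_partial unfolding smooth_def by blast
    ultimately show ?case using Suc.IH by (auto intro: Ck_mult)
  qed
  then show ?thesis by (simp add: smooth_def)
qed

lemma smooth_exp [intro]: "smooth f \<Longrightarrow> smooth (\<lambda>x. exp (f x))"
  by (rule smooth_compose[where U=UNIV and g="\<lambda>n. exp"]) (auto intro: DERIV_exp)

lemma smooth_cosh [intro]: 
  assumes "smooth f" shows "smooth (\<lambda>x. cosh (f x) :: real)"
proof -
  have "smooth (\<lambda>x. (1/2) * (exp (f x) + exp (- f x)))"
    by (intro smooth_mult smooth_const smooth_add smooth_exp smooth_minus assms)
  then show ?thesis by (simp add: cosh_def)
qed

lemma smooth_cos [intro]: 
  assumes "smooth f" shows "smooth (\<lambda>x. cos (f x))"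
proof -
  \<comment> \<open>Differentiating \<open>cos\<close> shifts its argument by \<open>pi/2\<close>,
    so one formula gives all derivatives.\<close>
  have "smooth (\<lambda>x. (\<lambda>n t. cos (t + real n * (pi/2))) 0 (f x))"
  proof (rule smooth_compose[where U=UNIV, OF _ assms])
    fix n :: nat and t :: real
    have "((\<lambda>t. cos (t + real n * (pi/2))) has_real_derivative - sin (t + real n * (pi/2))) (at t)"
      by (auto intro!: derivative_eq_intros)
    moreover have "cos (t + real (Suc n) * (pi/2)) = - sin (t + real n * (pi/2))"
    proof -
      have "t + real (Suc n) * (pi/2) = (t + real n * (pi/2)) + pi/2" by (simp add: field_simps)
      then show ?thesis by (simp only: cos_add) simp
    qed
    ultimately show "((\<lambda>t. cos (t + real n * (pi/2))) has_real_derivative cos (t + real (Suc n) * (pi/2))) (at t)"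
      by simp
  qed simp
  then show ?thesis by simp
qed

lemma smooth_ln:
  assumes "smooth f" "\<And>x. f x > 0"
  shows "smooth (\<lambda>x. ln (f x))"
proof -
  define g :: "nat \<Rightarrow> real \<Rightarrow> real" where
    "g n t = (case n of 0 \<Rightarrow> ln t | Suc k \<Rightarrow> (-1)^k * fact k * inverse t ^ Suc k)" for n t
  have "smooth (\<lambda>x. g 0 (f x))"
  proof (rule smooth_compose[where U="{0<..}", OF _ assms(1)])
    fix n and t :: real assume t: "t \<in> {0<..}"
    show "(g n has_real_derivative g (Suc n) t) (at t)"
    proof (cases n)
      case 0
      then show ?thesis using t unfolding g_def
        by (auto intro!: derivative_eq_intros simp: divide_simps)
    next
      case (Suc k)
      have "((\<lambda>t. (-1)^k * fact k * inverse t ^ Suc k) has_real_derivative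
          (-1)^k * fact k * (real (Suc k) * inverse t ^ k * - (inverse t ^ 2))) (at t)"
        using t DERIV_cmult[OF DERIV_power[OF DERIV_inverse[of t]], of "(-1)^k * fact k" "Suc k"]
        by (simp add: power2_eq_square mult_ac)
      then show ?thesis
        using Suc unfolding g_def by (simp add: power2_eq_square mult_ac)
    qed
  qed (use assms in auto)
  then show ?thesis by (simp add: g_def)
qed

text \<open>A family closed under differentiation and smooth across \<open>t = 0\<close> for
  \<open>c > 0\<close>. It supplies \<open>exp (-1/t)\<close> as \<open>flat 1 1\<close>, its
  derivatives, the radial cutoff and the smoothed positive parts below.\<close>

definition flat :: "real poly \<Rightarrow> real \<Rightarrow> real \<Rightarrow> real" where
  "flat p c t = (if t > 0 then poly p (1/t) * exp (- c / t) else 0)"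

text \<open>The extra power \<open>s ^ k\<close> carries the induction on \<open>p\<close>:
  \<open>pCons a p\<close> stands for \<open>a + s * p\<close>, and the second term raises
  \<open>k\<close> by one.\<close>

lemma poly_exp_decay:
  assumes "c > (0::real)"
  shows "((\<lambda>s. s ^ k * poly p s * exp (- (c * s))) \<longlongrightarrow> 0) at_top"
proof (induction p arbitrary: k)
  case (pCons a p)
  have "((\<lambda>s. (c * s) ^ k / exp (c * s)) \<longlongrightarrow> 0) at_top"
    using assms by (intro filterlim_compose[OF tendsto_power_div_exp_0]) 
      (auto intro!: filterlim_tendsto_pos_mult_at_top filterlim_ident)
  from tendsto_mult_left[OF this, of "a / c^k"]
  have "((\<lambda>s. a * s ^ k * exp (- (c * s))) \<longlongrightarrow> 0) at_top"
    using assms by (simp add: exp_minus field_simps power_mult_distrib)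
  from tendsto_add[OF this pCons.IH[of "Suc k"]] show ?case
    by (simp add: algebra_simps)
qed simp

text \<open>With \<open>s = 1/t\<close> one has \<open>ds/dt = - s^2\<close>, which gives the
  polynomial \<open>s^2 (c p - p')\<close>. At 0 the right difference quotient is
  \<open>s p(s) exp (- c s)\<close> with \<open>s\<close> tending to infinity.\<close>

lemma flat_deriv:
  assumes "c > 0"
  shows "(flat p c has_real_derivative flat ([:0,0,1:] * (smult c p - pderiv p)) c t) (at t)"
proof -
  consider "t > 0" | "t < 0" | "t = 0" by linarith
  then show ?thesis
  proof cases
    case 1
    have "((\<lambda>t. poly p (1/t) * exp (- c / t)) has_real_derivative
        flat ([:0,0,1:] * (smult c p - pderiv p)) c t) (at t)"
      using 1 unfolding flat_def 
      by (auto intro!: derivative_eq_intros simp: power2_eq_square field_simps)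
    then show ?thesis
      by (rule has_field_derivative_transform_within_open[where S="{0<..}"]) (use 1 in \<open>auto simp: flat_def\<close>)
  next
    case 2
    have "((\<lambda>t. 0) has_real_derivative flat ([:0,0,1:] * (smult c p - pderiv p)) c t) (at t)"
      using 2 by (simp add: flat_def)
    then show ?thesis
      by (rule has_field_derivative_transform_within_open[where S="{..<0}"]) (use 2 in \<open>auto simp: flat_def\<close>)
  next
    case 3
    have "((\<lambda>h. flat p c h / h) \<longlongrightarrow> 0) (at_right 0)"
    proof -
      have "((\<lambda>h. inverse h ^ 1 * poly p (inverse h) * exp (- (c * inverse h))) \<longlongrightarrow> 0) (at_right 0)"
        by (rule filterlim_compose[OF poly_exp_decay[OF assms] filterlim_inverse_at_top_right])
      then show ?thesis
        by (rule Lim_transform_eventually)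
           (auto simp: flat_def eventually_at_filter field_simps)
    qed
    moreover have "((\<lambda>h. flat p c h / h) \<longlongrightarrow> 0) (at_left 0)"
      by (rule Lim_transform_eventually[OF tendsto_const])
         (auto simp: flat_def eventually_at_filter)
    ultimately have "((\<lambda>h. flat p c h / h) \<longlongrightarrow> 0) (at 0)"
      by (simp add: filterlim_at_split)
    then show ?thesis using 3 by (simp add: has_field_derivative_iff flat_def)
  qed
qed

lemma smooth_flat [intro]:
  assumes "c > 0" "smooth f"
  shows "smooth (\<lambda>x. flat p c (f x))"
proof -
  define P where "P n = ((\<lambda>p. [:0,0,1:] * (smult c p - pderiv p)) ^^ n) p" for n
  have "smooth (\<lambda>x. flat (P 0) c (f x))"
    by (rule smooth_compose[where U=UNIV and g="\<lambda>n. flat (P n) c"])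
       (use assms flat_deriv[OF assms(1)] in \<open>auto simp: P_def\<close>)
  then show ?thesis by (simp add: P_def)
qed

section \<open>Chain rule and linearity for the Laplacian\<close>

lemma laplacian_compose:
  assumes f: "smooth f"
    and g: "\<And>y. (g has_real_derivative g' (f y)) (at (f y))"
    and g': "(g' has_real_derivative g'') (at (f x))"
  shows "laplacian (\<lambda>x. g (f x)) x = g'' * (norm (grad f x))\<^sup>2 + g' (f x) * laplacian f x"
proof -
  have 1: "partial_deriv (\<lambda>x. g (f x)) b = (\<lambda>x. g' (f x) * partial_deriv f b x)" for b
    by (rule ext, rule partial_deriv_compose) (simp_all add: f g)
  have "partial_deriv (partial_deriv (\<lambda>x. g (f x)) b) b x =
      g' (f x) * partial_deriv (partial_deriv f b) b x + partial_deriv f b x * (g'' * partial_deriv f b x)"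
    if "b \<in> Basis" for b
  proof -
    have "(\<lambda>x. g' (f x)) differentiable at x"
      using GDERIV_DERIV_compose[OF smooth_GDERIV[OF f] g'] by (rule GDERIV_differentiable)
    then show ?thesis unfolding 1
      using f that by (subst partial_deriv_mult) (auto simp: smooth_partial partial_deriv_compose[where g=g' and f=f, OF _ g'])
  qed
  then show ?thesis
    unfolding laplacian_def grad_norm_sq
    by (simp add: sum.distrib sum_distrib_left power2_eq_square algebra_simps)
qed

lemma laplacian_add:
  assumes "smooth f" "smooth g"
  shows "laplacian (\<lambda>x. f x + g x) x = laplacian f x + laplacian g x"
proof -
  have "partial_deriv (\<lambda>x. f x + g x) b = (\<lambda>x. partial_deriv f b x + partial_deriv g b x)" for b
    using assms by (intro ext partial_deriv_add) auto
  then show ?thesis using assms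
    unfolding laplacian_def sum.distrib[symmetric]
    by (intro sum.cong refl) (simp add: partial_deriv_add smooth_partial)
qed

lemma smooth_laplacian [intro]: "smooth f \<Longrightarrow> smooth (laplacian f)"
  using smooth_sum[of Basis "\<lambda>b. partial_deriv (partial_deriv f b) b"]
  by (simp add: laplacian_def[abs_def] smooth_partial)

lemma laplacian_const: "laplacian (\<lambda>x. c) x = 0"
proof -
  have "partial_deriv (\<lambda>x::'a. c) b = (\<lambda>x. 0)" for b and c :: real
    by (rule ext) (rule partial_derivI, rule derivative_intros)
  then show ?thesis by (simp add: laplacian_def)
qed

lemma laplacian_cmult: 
  assumes "smooth f" shows "laplacian (\<lambda>x. c * f x) x = c * laplacian f x"
  by (subst laplacian_compose[OF assms, where g'="\<lambda>_. c" and g''=0])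
     (auto intro!: derivative_eq_intros)

lemma laplacian_sum:
  "(\<And>i. i \<in> I \<Longrightarrow> smooth (f i)) \<Longrightarrow> laplacian (\<lambda>x. \<Sum>i\<in>I. f i x) x = (\<Sum>i\<in>I. laplacian (f i) x)"
proof (induction I rule: infinite_finite_induct)
  case (insert i I)
  then show ?case by (simp add: laplacian_add smooth_sum)
qed (simp_all add: laplacian_const)

lemma laplacian_inner: "laplacian (\<lambda>x. x \<bullet> e) x = 0"
proof -
  have "partial_deriv (\<lambda>x. x \<bullet> e) b = (\<lambda>x. e \<bullet> b)" for b
    by (rule ext) (rule partial_deriv_GDERIV[OF GDERIV_inner])
  moreover have "partial_deriv (\<lambda>x::'a. c) b x = 0" for c :: real and b x
    by (rule partial_derivI, rule derivative_intros)
  ultimately show ?thesis by (simp add: laplacian_def)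
qed

section \<open>Integration by parts and square-integrable functions\<close>

definition supp :: "('a::euclidean_space \<Rightarrow> 'b::euclidean_space) \<Rightarrow> 'a set" where
  "supp f = closure {x. f x \<noteq> 0}"

lemma supp_zero: "x \<notin> supp f \<Longrightarrow> f x = 0"
  unfolding supp_def using closure_subset[of "{x. f x \<noteq> 0}"] by blast

lemma closed_supp: "closed (supp f)"
  by (simp add: supp_def)

lemma supp_minimal: "closed S \<Longrightarrow> (\<And>x. x \<notin> S \<Longrightarrow> f x = 0) \<Longrightarrow> supp f \<subseteq> S"
  unfolding supp_def by (rule closure_minimal) auto

lemma bounded_supp: "bounded (supp f) \<longleftrightarrow> bounded {x. f x \<noteq> 0}"
  unfolding supp_def by (metis bounded_closure bounded_subset closure_subset)

lemma integrable_bounded_support: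
  fixes f :: "'a::euclidean_space \<Rightarrow> 'b::euclidean_space"
  assumes "continuous_on UNIV f" "bounded {x. f x \<noteq> 0}"
  shows "integrable lborel f"
proof -
  have "compact (supp f)" using assms(2) by (simp add: supp_def)
  then have "integrable lborel (\<lambda>x. indicator (supp f) x *\<^sub>R f x)"
    by (rule borel_integrable_compact) (use assms(1) continuous_on_subset in blast)
  moreover have "indicator (supp f) x *\<^sub>R f x = f x" for x
    by (auto simp: indicator_def supp_zero)
  ultimately show ?thesis by simp
qed

lemma lebesgue_on_lborel:
  fixes f :: "'a::euclidean_space \<Rightarrow> 'b::euclidean_space"
  assumes "continuous_on UNIV f" "open \<Omega>" "\<And>x. x \<notin> \<Omega> \<Longrightarrow> f x = 0"
  shows "integral\<^sup>L (lebesgue_on \<Omega>) f = integral\<^sup>L lborel f"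
    and "integrable (lebesgue_on \<Omega>) f \<longleftrightarrow> integrable lborel f"
proof -
  have meas: "f \<in> borel_measurable lborel"
    using assms(1) by (simp add: borel_measurable_continuous_onI)
  have O: "\<Omega> \<inter> space lebesgue \<in> sets lebesgue" using assms(2) by simp
  have eq: "(\<lambda>x. indicator \<Omega> x *\<^sub>R f x) = f" using assms(3) by (auto simp: indicator_def)
  show "integral\<^sup>L (lebesgue_on \<Omega>) f = integral\<^sup>L lborel f"
    by (simp add: integral_restrict_space[OF O] eq integral_completion[OF meas])
  show "integrable (lebesgue_on \<Omega>) f \<longleftrightarrow> integrable lborel f"
    by (simp add: integrable_restrict_space[OF O] eq integrable_completion[OF meas])
qed

lemma partial_deriv_zero:
  assumes "x \<notin> supp f" shows "partial_deriv f b x = 0"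
proof (rule partial_derivI[where f'="\<lambda>_. 0", simplified])
  have "((\<lambda>x. 0) has_derivative (\<lambda>_. 0)) (at x)" by simp
  then show "(f has_derivative (\<lambda>_. 0)) (at x)"
  proof (rule has_derivative_transform_within_open[where s="- supp f"])
    show "0 = f y" if "y \<in> - supp f" for y
      using that by (simp add: supp_zero)
  qed (use assms closed_supp in auto)
qed

text \<open>Difference quotients along \<open>b\<close> have integral zero by translation
  invariance. They converge to the partial derivative and are dominated by the mean value
  theorem.\<close>

lemma integral_partial_deriv:
  fixes f :: "'a::euclidean_space \<Rightarrow> real"
  assumes f: "smooth f" "bounded {x. f x \<noteq> 0}" and b: "b \<in> Basis"
  shows "integral\<^sup>L lborel (partial_deriv f b) = 0"
proof -
  let ?h = "\<lambda>n. inverse (real (Suc n))"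
  define D where "D n x = (f (x + ?h n *\<^sub>R b) - f x) / ?h n" for n x
  have cont: "continuous_on UNIV f" "continuous_on UNIV (partial_deriv f b)"
    using f b by (auto intro: smooth_continuous)
  have meas [measurable]: "f \<in> borel_measurable borel" "partial_deriv f b \<in> borel_measurable borel"
    using cont by (simp_all add: borel_measurable_continuous_onI)
  obtain R where R: "\<And>x. f x \<noteq> 0 \<Longrightarrow> norm x \<le> R"
    using f(2) by (auto simp: bounded_iff)
  \<comment> \<open>The support lies within radius \<open>R\<close> and the translation has length
    at most 1, so the quotients live within \<open>R + 1\<close> and the intermediate points within
    \<open>R + 2\<close>.\<close>
  obtain C where C: "\<And>x. x \<in> cball 0 (R + 2) \<Longrightarrow> \<bar>partial_deriv f b x\<bar> \<le> C"
  proof -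
    have "compact (partial_deriv f b ` cball 0 (R + 2))"
      by (intro compact_continuous_image continuous_on_subset[OF cont(2)]) auto
    then have "bounded (partial_deriv f b ` cball 0 (R + 2))" by (rule compact_imp_bounded)
    then show ?thesis using that unfolding bounded_iff by (metis imageI real_norm_def)
  qed
  have der: "((\<lambda>t. f (x + t *\<^sub>R b)) has_real_derivative partial_deriv f b (x + t *\<^sub>R b)) (at t)" for x t
  proof -
    have "(f has_derivative (\<lambda>h. h \<bullet> grad f (x + t *\<^sub>R b))) (at (x + t *\<^sub>R b))"
      using smooth_GDERIV[OF f(1)] unfolding gderiv_def .
    then have "((\<lambda>t. f (x + t *\<^sub>R b)) has_derivative (\<lambda>s. (s *\<^sub>R b) \<bullet> grad f (x + t *\<^sub>R b))) (at t)"
      by (rule has_derivative_compose[rotated]) (auto intro!: derivative_eq_intros)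
    then show ?thesis
      by (simp add: has_field_derivative_def inner_commute[of b] grad_inner[OF b] mult_commute_abs)
  qed
  have h: "?h n > 0" "?h n \<le> 1" for n by (auto simp: inverse_eq_divide)
  have int0: "integral\<^sup>L lborel (D n) = 0" for n
  proof -
    have i1: "integrable lborel f" using integrable_bounded_support[OF cont(1) f(2)] .
    have e: "distr lborel borel ((+) (?h n *\<^sub>R b)) = (lborel :: 'a measure)" by (rule lborel_distr_plus)
    have i2: "integrable lborel (\<lambda>x. f (?h n *\<^sub>R b + x))"
      using i1 by (subst (asm) e[symmetric], subst (asm) integrable_distr_eq) auto
    have "integral\<^sup>L lborel f = integral\<^sup>L lborel (\<lambda>x. f (?h n *\<^sub>R b + x))"
      by (subst e[symmetric], subst integral_distr) auto
    with i1 i2 show ?thesis unfolding D_def by (simp add: add.commute)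
  qed
  have "(\<lambda>n. integral\<^sup>L lborel (D n)) \<longlonglongrightarrow> integral\<^sup>L lborel (partial_deriv f b)"
  proof (rule integral_dominated_convergence[where w="\<lambda>x. C * indicator (cball 0 (R+1)) x"])
    show "partial_deriv f b \<in> borel_measurable lborel" by simp
    show "D n \<in> borel_measurable lborel" for n unfolding D_def by measurable
    show "integrable lborel (\<lambda>x. C * indicator (cball (0::'a) (R + 1)) x)"
      by (intro integrable_mult_right integrable_real_indicator)
         (use emeasure_bounded_finite[OF bounded_cball] in auto)
    show "AE x in lborel. (\<lambda>i. D i x) \<longlonglongrightarrow> partial_deriv f b x"
    proof (rule AE_I2)
      fix x
      have lim: "((\<lambda>t. (f (x + t *\<^sub>R b) - f x) / t) \<longlongrightarrow> partial_deriv f b x) (at 0)"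
        using der[of x 0] by (simp add: DERIV_def)
      have "filterlim ?h (at 0) sequentially"
        unfolding filterlim_at using LIMSEQ_inverse_real_of_nat by auto
      from filterlim_compose[OF lim this]
      show "(\<lambda>i. D i x) \<longlonglongrightarrow> partial_deriv f b x" unfolding D_def .
    qed
    show "AE x in lborel. norm (D n x) \<le> C * indicator (cball 0 (R + 1)) x" for n
    proof (rule AE_I2)
      fix x
      have nb: "norm (s *\<^sub>R b) \<le> s" if "0 \<le> s" for s using b that by simp
      show "norm (D n x) \<le> C * indicator (cball 0 (R + 1)) x"
      proof (cases "x \<in> cball 0 (R + 1)")
        case True
        obtain z where z: "0 < z" "z < ?h n"
            "f (x + ?h n *\<^sub>R b) - f (x + 0 *\<^sub>R b) = (?h n - 0) * partial_deriv f b (x + z *\<^sub>R b)"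
          using MVT2[OF h(1), of n "\<lambda>t. f (x + t *\<^sub>R b)" "\<lambda>t. partial_deriv f b (x + t *\<^sub>R b)"] der by auto
        have "norm (x + z *\<^sub>R b) \<le> R + 2"
          using True nb[of z] z(1) order_less_le_trans[OF z(2) h(2)[of n]] norm_triangle_ineq[of x "z *\<^sub>R b"]
          by (simp del: norm_scaleR)
        then have "\<bar>partial_deriv f b (x + z *\<^sub>R b)\<bar> \<le> C" by (intro C) simp
        then show ?thesis using z(3) True h[of n] unfolding D_def by (simp add: field_simps)
      next
        case False
        have "norm x \<le> norm (x + ?h n *\<^sub>R b) + norm (?h n *\<^sub>R b)"
          using norm_triangle_ineq4[of "x + ?h n *\<^sub>R b" "?h n *\<^sub>R b"] by simp
        then have "norm (x + ?h n *\<^sub>R b) > R" "norm x > R"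
          using False nb[of "?h n"] h[of n] by (simp_all del: norm_scaleR of_nat_Suc)
        then have "f (x + ?h n *\<^sub>R b) = 0" "f x = 0" using R by force+
        then show ?thesis using False by (simp add: D_def)
      qed
    qed
  qed
  then show ?thesis unfolding int0 by (simp add: LIMSEQ_const_iff)
qed

section \<open>Test functions, integration by parts and the Poincare inequality\<close>

lemma test_functions_iff:
  "\<phi> \<in> test_functions \<Omega> \<longleftrightarrow> smooth \<phi> \<and> bounded (supp \<phi>) \<and> supp \<phi> \<subseteq> \<Omega>"
  unfolding bounded_supp by (simp add: test_functions_def smooth_def supp_def)

lemma test_zero: "\<phi> \<in> test_functions \<Omega> \<Longrightarrow> x \<notin> \<Omega> \<Longrightarrow> \<phi> x = 0"
  unfolding test_functions_iff using supp_zero by blast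

lemma test_subset_support:
  assumes "\<phi> \<in> test_functions \<Omega>" "smooth \<psi>" "\<And>x. x \<notin> supp \<phi> \<Longrightarrow> \<psi> x = 0"
  shows "\<psi> \<in> test_functions \<Omega>"
proof -
  have "supp \<psi> \<subseteq> supp \<phi>"
    using assms(3) by (intro supp_minimal closed_supp)
  then show ?thesis using assms by (auto simp: test_functions_iff intro: bounded_subset)
qed

lemma test_partial: "\<phi> \<in> test_functions \<Omega> \<Longrightarrow> b \<in> Basis \<Longrightarrow> partial_deriv \<phi> b \<in> test_functions \<Omega>"
  by (rule test_subset_support) (auto simp: test_functions_iff partial_deriv_zero)

lemma test_mult: "\<phi> \<in> test_functions \<Omega> \<Longrightarrow> smooth f \<Longrightarrow> (\<lambda>x. f x * \<phi> x) \<in> test_functions \<Omega>"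
  by (rule test_subset_support[of \<phi>]) (auto simp: test_functions_iff supp_zero)

lemma test_add:
  assumes "\<phi> \<in> test_functions \<Omega>" "\<psi> \<in> test_functions \<Omega>"
  shows "(\<lambda>x. \<phi> x + \<psi> x) \<in> test_functions \<Omega>"
proof -
  have "supp (\<lambda>x. \<phi> x + \<psi> x) \<subseteq> supp \<phi> \<union> supp \<psi>"
    by (intro supp_minimal closed_Un closed_supp) (auto simp: supp_zero)
  then show ?thesis using assms 
    by (auto simp: test_functions_iff intro: bounded_subset[of "supp \<phi> \<union> supp \<psi>"])
qed

lemma test_cmult: "\<phi> \<in> test_functions \<Omega> \<Longrightarrow> (\<lambda>x. c * \<phi> x) \<in> test_functions \<Omega>"
  by (intro test_mult) auto

lemma test_const0: "(\<lambda>x. 0) \<in> test_functions \<Omega>"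
  by (auto simp: test_functions_iff supp_def)

lemma test_smooth: "\<phi> \<in> test_functions \<Omega> \<Longrightarrow> smooth \<phi>"
  by (simp add: test_functions_iff)

lemma continuous_grad: "smooth f \<Longrightarrow> continuous_on S (grad f)"
  unfolding grad_def by (auto intro!: continuous_intros smooth_continuous)

lemma test_grad_zero: "\<phi> \<in> test_functions \<Omega> \<Longrightarrow> x \<notin> supp \<phi> \<Longrightarrow> grad \<phi> x = 0"
  unfolding grad_def by (simp add: partial_deriv_zero)

lemma integrable_test_support:
  fixes f :: "'a::euclidean_space \<Rightarrow> 'b::euclidean_space"
  assumes "\<phi> \<in> test_functions \<Omega>" "continuous_on UNIV f"
    "\<And>x. x \<notin> supp \<phi> \<Longrightarrow> f x = 0"
  shows "integrable lborel f"
proof (rule integrable_bounded_support[OF assms(2)])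
  have "{x. f x \<noteq> 0} \<subseteq> supp \<phi>" using assms(3) by blast
  then show "bounded {x. f x \<noteq> 0}"
    using assms(1) by (auto simp: test_functions_iff intro: bounded_subset)
qed

lemma integrable_on_test_support:
  fixes f :: "'a::euclidean_space \<Rightarrow> 'b::euclidean_space"
  assumes "open \<Omega>" "\<phi> \<in> test_functions \<Omega>" "continuous_on UNIV f"
    "\<And>x. x \<notin> supp \<phi> \<Longrightarrow> f x = 0"
  shows "integrable (lebesgue_on \<Omega>) f" "integral\<^sup>L (lebesgue_on \<Omega>) f = integral\<^sup>L lborel f"
proof -
  have "\<And>x. x \<notin> \<Omega> \<Longrightarrow> f x = 0" using assms(2,4) by (auto simp: test_functions_iff)
  then show "integrable (lebesgue_on \<Omega>) f" "integral\<^sup>L (lebesgue_on \<Omega>) f = integral\<^sup>L lborel f"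
    using lebesgue_on_lborel[OF assms(3,1)] integrable_test_support[OF assms(2-4)] by auto
qed

lemma integral_by_parts:
  fixes f :: "'a::euclidean_space \<Rightarrow> real"
  assumes "open \<Omega>" "smooth f" "\<phi> \<in> test_functions \<Omega>" "b \<in> Basis"
  shows "(\<integral>x. f x * partial_deriv \<phi> b x \<partial>lebesgue_on \<Omega>) = - (\<integral>x. \<phi> x * partial_deriv f b x \<partial>lebesgue_on \<Omega>)"
proof -
  have t: "(\<lambda>x. f x * \<phi> x) \<in> test_functions \<Omega>" using assms by (intro test_mult)
  have eq: "partial_deriv (\<lambda>x. f x * \<phi> x) b = (\<lambda>x. f x * partial_deriv \<phi> b x + \<phi> x * partial_deriv f b x)"
    using assms by (intro ext partial_deriv_mult) (auto simp: test_smooth)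
  have z: "x \<notin> supp \<phi> \<Longrightarrow> \<phi> x = 0" for x by (rule supp_zero)
  have c: "continuous_on UNIV (\<lambda>x. f x * partial_deriv \<phi> b x)"
     "continuous_on UNIV (\<lambda>x. \<phi> x * partial_deriv f b x)"
    using assms test_smooth[OF assms(3)] by (auto intro!: smooth_continuous)
  have i: "integrable lborel (\<lambda>x. f x * partial_deriv \<phi> b x)" "integrable lborel (\<lambda>x. \<phi> x * partial_deriv f b x)"
    by (rule integrable_test_support[OF assms(3) c(1)] integrable_test_support[OF assms(3) c(2)];
        simp add: partial_deriv_zero z)+
  have "0 = integral\<^sup>L lborel (partial_deriv (\<lambda>x. f x * \<phi> x) b)"
    using t assms by (subst integral_partial_deriv) (auto simp: test_functions_iff bounded_supp)
  also have "\<dots> = (\<integral>x. f x * partial_deriv \<phi> b x \<partial>lborel) + (\<integral>x. \<phi> x * partial_deriv f b x \<partial>lborel)"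
    unfolding eq using i by simp
  finally show ?thesis
    using integrable_on_test_support(2)[OF assms(1,3) c(1)] integrable_on_test_support(2)[OF assms(1,3) c(2)]
    by (simp add: partial_deriv_zero z)
qed

lemma integral_grad_grad:
  fixes f :: "'a::euclidean_space \<Rightarrow> real"
  assumes "open \<Omega>" "smooth f" "\<phi> \<in> test_functions \<Omega>"
  shows "(\<integral>x. grad f x \<bullet> grad \<phi> x \<partial>lebesgue_on \<Omega>) = - (\<integral>x. \<phi> x * laplacian f x \<partial>lebesgue_on \<Omega>)"
proof -
  have z: "x \<notin> supp \<phi> \<Longrightarrow> \<phi> x = 0" for x by (rule supp_zero)
  have i: "integrable (lebesgue_on \<Omega>) (\<lambda>x. partial_deriv f b x * partial_deriv \<phi> b x)"
    "integrable (lebesgue_on \<Omega>) (\<lambda>x. \<phi> x * partial_deriv (partial_deriv f b) b x)" if "b \<in> Basis" for b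
    by (rule integrable_on_test_support(1)[OF assms(1,3)];
        use that assms test_smooth[OF assms(3)] in \<open>auto simp: z partial_deriv_zero intro!: smooth_continuous\<close>)+
  have "(\<integral>x. grad f x \<bullet> grad \<phi> x \<partial>lebesgue_on \<Omega>) 
      = (\<Sum>b\<in>Basis. \<integral>x. partial_deriv f b x * partial_deriv \<phi> b x \<partial>lebesgue_on \<Omega>)"
    unfolding grad_dot by (rule Bochner_Integration.integral_sum) (rule i)
  also have "\<dots> = (\<Sum>b\<in>Basis. - (\<integral>x. \<phi> x * partial_deriv (partial_deriv f b) b x \<partial>lebesgue_on \<Omega>))"
    using assms by (intro sum.cong refl integral_by_parts) auto
  also have "\<dots> = - (\<integral>x. \<phi> x * laplacian f x \<partial>lebesgue_on \<Omega>)"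
    unfolding laplacian_def sum_distrib_left sum_negf
    by (subst Bochner_Integration.integral_sum) (auto intro: i)
  finally show ?thesis .
qed

text \<open>Integrating \<open>\<phi>\<close> times the \<open>b\<close>-derivative of
  \<open>(x \<bullet> b) \<phi>\<close> by parts expresses the integral of \<open>\<phi>^2\<close>
  as -2 times that of \<open>(x \<bullet> b) \<phi> partial_deriv \<phi> b\<close>. Young's
  inequality absorbs half of the left side.\<close>

lemma poincare:
  fixes \<phi> :: "'a::euclidean_space \<Rightarrow> real"
  assumes "open \<Omega>" "\<phi> \<in> test_functions \<Omega>" and R: "\<And>x. x \<in> \<Omega> \<Longrightarrow> norm x \<le> R"
  shows "(\<integral>x. (\<phi> x)\<^sup>2 \<partial>lebesgue_on \<Omega>) \<le> 4 * R\<^sup>2 * (\<integral>x. (norm (grad \<phi> x))\<^sup>2 \<partial>lebesgue_on \<Omega>)"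
proof -
  obtain b :: 'a where b: "b \<in> Basis" using nonempty_Basis by blast
  let ?M = "lebesgue_on \<Omega>"
  have z: "x \<notin> supp \<phi> \<Longrightarrow> \<phi> x = 0" for x by (rule supp_zero)
  note t = assms(2) and sm = test_smooth[OF assms(2)]
  note I = integrable_on_test_support(1)[OF assms(1,2)]
  have i1: "integrable ?M (\<lambda>x. (\<phi> x)\<^sup>2)"
    by (rule I) (use sm z in \<open>auto intro!: smooth_continuous\<close>)
  have i2: "integrable ?M (\<lambda>x. (norm (grad \<phi> x))\<^sup>2)"
    by (rule I) (use sm test_grad_zero[OF t] in \<open>auto intro!: continuous_intros continuous_grad\<close>)
  have i3: "integrable ?M (\<lambda>x. (x \<bullet> b) * \<phi> x * partial_deriv \<phi> b x)"
    by (rule I) (simp_all add: z smooth_continuous smooth_mult smooth_inner smooth_partial sm b)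
  have "(\<lambda>x. (x \<bullet> b) * \<phi> x) \<in> test_functions \<Omega>" using t by (intro test_mult) auto
  from integral_by_parts[OF assms(1) sm this b]
  have "(\<integral>x. \<phi> x * partial_deriv (\<lambda>x. (x \<bullet> b) * \<phi> x) b x \<partial>?M) 
     = - (\<integral>x. (x \<bullet> b) * \<phi> x * partial_deriv \<phi> b x \<partial>?M)" .
  also have "(\<lambda>x. \<phi> x * partial_deriv (\<lambda>x. (x \<bullet> b) * \<phi> x) b x) 
      = (\<lambda>x. (\<phi> x)\<^sup>2 + (x \<bullet> b) * \<phi> x * partial_deriv \<phi> b x)"
  proof
    fix x
    have "partial_deriv (\<lambda>x. (x \<bullet> b) * \<phi> x) b x = (x \<bullet> b) * partial_deriv \<phi> b x + \<phi> x * (b \<bullet> b)"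
      using sm by (subst partial_deriv_mult) 
        (auto simp: partial_deriv_GDERIV[OF GDERIV_inner] intro: GDERIV_differentiable[OF GDERIV_inner])
    then show "\<phi> x * partial_deriv (\<lambda>x. (x \<bullet> b) * \<phi> x) b x 
      = (\<phi> x)\<^sup>2 + (x \<bullet> b) * \<phi> x * partial_deriv \<phi> b x"
      using b by (simp add: algebra_simps power2_eq_square)
  qed
  finally have "(\<integral>x. (\<phi> x)\<^sup>2 \<partial>?M) = - 2 * (\<integral>x. (x \<bullet> b) * \<phi> x * partial_deriv \<phi> b x \<partial>?M)"
    using i1 i3 by simp
  also have "\<dots> = (\<integral>x. - 2 * ((x \<bullet> b) * \<phi> x * partial_deriv \<phi> b x) \<partial>?M)" by simp
  also have "\<dots> \<le> (\<integral>x. (1/2) * (\<phi> x)\<^sup>2 + 2 * R\<^sup>2 * (norm (grad \<phi> x))\<^sup>2 \<partial>?M)"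
  proof (rule integral_mono)
    fix x assume "x \<in> space ?M"
    then have "\<bar>x \<bullet> b\<bar> \<le> R" using R[of x] Basis_le_norm[OF b, of x] by (auto simp: space_restrict_space)
    then have xb: "(x \<bullet> b)\<^sup>2 \<le> R\<^sup>2" by (rule abs_le_square_iff[THEN iffD1, OF order_trans]) simp
    have g: "(partial_deriv \<phi> b x)\<^sup>2 \<le> (norm (grad \<phi> x))\<^sup>2"
      using Basis_le_norm[OF b, of "grad \<phi> x"] by (simp add: grad_inner[OF b] power2_le_iff_abs_le)
    have "0 \<le> (\<phi> x + 2 * ((x \<bullet> b) * partial_deriv \<phi> b x))\<^sup>2" by simp
    then have "- 2 * ((x \<bullet> b) * \<phi> x * partial_deriv \<phi> b x) 
        \<le> (1/2) * (\<phi> x)\<^sup>2 + 2 * ((x \<bullet> b)\<^sup>2 * (partial_deriv \<phi> b x)\<^sup>2)"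
      by (simp add: power2_eq_square algebra_simps)
    also have "(x \<bullet> b)\<^sup>2 * (partial_deriv \<phi> b x)\<^sup>2 \<le> R\<^sup>2 * (norm (grad \<phi> x))\<^sup>2"
      using xb g by (intro mult_mono) auto
    finally show "- 2 * ((x \<bullet> b) * \<phi> x * partial_deriv \<phi> b x) 
        \<le> (1/2) * (\<phi> x)\<^sup>2 + 2 * R\<^sup>2 * (norm (grad \<phi> x))\<^sup>2" by simp
  qed (use i1 i2 i3 in \<open>auto intro: integrable_mult_right Bochner_Integration.integrable_add\<close>)
  also have "\<dots> = (1/2) * (\<integral>x. (\<phi> x)\<^sup>2 \<partial>?M) + 2 * R\<^sup>2 * (\<integral>x. (norm (grad \<phi> x))\<^sup>2 \<partial>?M)"
    using i1 i2 by simp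
  finally show ?thesis by simp
qed

section \<open>Square integrability over an arbitrary measure: Cauchy-Schwarz, completeness, limits
  of pairings\<close>

definition L2 :: "'a measure \<Rightarrow> ('a \<Rightarrow> 'b::euclidean_space) \<Rightarrow> bool" where
  "L2 M f \<longleftrightarrow> f \<in> borel_measurable M \<and> integrable M (\<lambda>x. (norm (f x))\<^sup>2)"

lemma L2D: "L2 M f \<Longrightarrow> f \<in> borel_measurable M" "L2 M f \<Longrightarrow> integrable M (\<lambda>x. (norm (f x))\<^sup>2)"
  by (auto simp: L2_def)

lemma norm_add_sq_le: "(norm (a + b))\<^sup>2 \<le> 2 * (norm a)\<^sup>2 + 2 * (norm (b::'b::real_normed_vector))\<^sup>2"
proof -
  have "(norm (a + b))\<^sup>2 \<le> (norm a + norm b)\<^sup>2" by (simp add: norm_triangle_ineq power_mono)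
  also have "\<dots> \<le> 2 * (norm a)\<^sup>2 + 2 * (norm b)\<^sup>2"
    using zero_le_power2[of "norm a - norm b"] by (simp add: power2_eq_square algebra_simps)
  finally show ?thesis .
qed

lemma L2_add: 
  assumes "L2 M f" "L2 M g" shows "L2 M (\<lambda>x. f x + g x)"
proof -
  have m [measurable]: "f \<in> borel_measurable M" "g \<in> borel_measurable M" using assms by (auto dest: L2D)
  have "integrable M (\<lambda>x. (norm (f x + g x))\<^sup>2)"
  proof (rule Bochner_Integration.integrable_bound)
    show "integrable M (\<lambda>x. 2 * (norm (f x))\<^sup>2 + 2 * (norm (g x))\<^sup>2)" using L2D(2)[OF assms(1)] L2D(2)[OF assms(2)] by simp
  qed (use norm_add_sq_le in \<open>auto\<close>)
  then show ?thesis by (simp add: L2_def)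
qed

lemma L2_scaleR: "L2 M f \<Longrightarrow> L2 M (\<lambda>x. c *\<^sub>R f x)"
  by (auto simp: L2_def power_mult_distrib)

lemma L2_diff: "L2 M f \<Longrightarrow> L2 M g \<Longrightarrow> L2 M (\<lambda>x. f x - g x)"
  using L2_add[OF _ L2_scaleR, of M f g "-1"] by simp

lemma L2_integrable_mult:
  assumes "L2 M f" "L2 M g" shows "integrable M (\<lambda>x. norm (f x) * norm (g x))"
proof (rule Bochner_Integration.integrable_bound)
  have m [measurable]: "f \<in> borel_measurable M" "g \<in> borel_measurable M" using assms by (auto dest: L2D)
  show "integrable M (\<lambda>x. (norm (f x))\<^sup>2 + (norm (g x))\<^sup>2)" using L2D(2)[OF assms(1)] L2D(2)[OF assms(2)] by simp
  have "norm (f x) * norm (g x) \<le> (norm (f x))\<^sup>2 + (norm (g x))\<^sup>2" for x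
    using sum_squares_bound[of "norm (f x)" "norm (g x)"] mult_nonneg_nonneg[of "norm (f x)" "norm (g x)"]
    by (simp only: mult.assoc) (smt (verit) norm_ge_zero)
  then show "AE x in M. norm (norm (f x) * norm (g x)) \<le> norm ((norm (f x))\<^sup>2 + (norm (g x))\<^sup>2)"
    by (auto simp: abs_mult)
  show "(\<lambda>x. norm (f x) * norm (g x)) \<in> borel_measurable M" by simp
qed

lemma L2_Cauchy_Schwarz:
  assumes "L2 M f" "L2 M g"
  shows "(\<integral>x. norm (f x) * norm (g x) \<partial>M) \<le> sqrt (\<integral>x. (norm (f x))\<^sup>2 \<partial>M) * sqrt (\<integral>x. (norm (g x))\<^sup>2 \<partial>M)"
proof -
  define a b c where "a = (\<integral>x. (norm (f x))\<^sup>2 \<partial>M)" and "b = (\<integral>x. norm (f x) * norm (g x) \<partial>M)"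
    and "c = (\<integral>x. (norm (g x))\<^sup>2 \<partial>M)"
  note i = L2D(2)[OF assms(1)] L2D(2)[OF assms(2)] L2_integrable_mult[OF assms]
  have "0 \<le> a * t\<^sup>2 + 2 * b * t + c" for t
  proof -
    have "0 \<le> (\<integral>x. (norm (f x) * t + norm (g x))\<^sup>2 \<partial>M)" by simp
    also have "(\<lambda>x. (norm (f x) * t + norm (g x))\<^sup>2)
       = (\<lambda>x. t\<^sup>2 * (norm (f x))\<^sup>2 + 2 * t * (norm (f x) * norm (g x)) + (norm (g x))\<^sup>2)"
      by (auto simp: power2_eq_square algebra_simps)
    also have "(\<integral>x. t\<^sup>2 * (norm (f x))\<^sup>2 + 2 * t * (norm (f x) * norm (g x)) + (norm (g x))\<^sup>2 \<partial>M) 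
        = a * t\<^sup>2 + 2 * b * t + c"
      unfolding a_def b_def c_def using i by simp
    finally show ?thesis .
  qed
  then have "b\<^sup>2 \<le> a * c"
  proof -
    assume *: "\<And>t. 0 \<le> a * t\<^sup>2 + 2 * b * t + c"
    have a0: "a \<ge> 0" unfolding a_def by simp
    show ?thesis
    proof (cases "a = 0")
      case True
      have "b = 0"
      proof (rule ccontr)
        assume "b \<noteq> 0"
        then show False using *[of "- (c + 1) / (2 * b)"] True by simp
      qed
      with True show ?thesis by simp
    next
      case False
      have "0 \<le> a * (a * (- b / a)\<^sup>2 + 2 * b * (- b / a) + c)" using *[of "- b / a"] a0 by simp
      also have "\<dots> = a * c - b\<^sup>2" using False by (simp add: field_simps power2_eq_square)
      finally show ?thesis by simp
    qed
  qed
  then show ?thesis unfolding a_def[symmetric] b_def[symmetric] c_def[symmetric] real_sqrt_mult[symmetric]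
    by (rule real_le_rsqrt)
qed

text \<open>Riesz-Fischer for sequences with a geometric Cauchy rate, which is what the minimising
  sequence for the torsion energy provides.\<close>

lemma L2_complete:
  fixes f :: "nat \<Rightarrow> 'a \<Rightarrow> 'b::euclidean_space"
  assumes L: "\<And>n. L2 M (f n)"
    and C: "\<And>n m. n \<le> m \<Longrightarrow> (\<integral>x. (norm (f m x - f n x))\<^sup>2 \<partial>M) \<le> c * (1/4)^n"
  shows "\<exists>g. L2 M g \<and> (\<lambda>n. \<integral>x. (norm (f n x - g x))\<^sup>2 \<partial>M) \<longlonglongrightarrow> 0"
proof -
  have m [measurable]: "f n \<in> borel_measurable M" for n using L by (auto dest: L2D)
  define g where "g x = lim (\<lambda>n. f n x)" for x
  have mg [measurable]: "g \<in> borel_measurable M" unfolding g_def by measurable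
  have int: "integrable M (\<lambda>x. (norm (f m x - f n x))\<^sup>2)" for m n by (rule L2D(2)[OF L2_diff[OF L L]])
  have c0: "c \<ge> 0" using C[of 0 0] by simp
  have AE: "AE x in M. (\<lambda>n. f n x) \<longlonglongrightarrow> g x"
  proof -
    \<comment> \<open>The weight \<open>2^n\<close> is affordable against the rate
      \<open>(1/4)^n\<close>, so the sum of the \<open>d n\<close> is finite almost everywhere.
      Since \<open>2 s \<le> 2^n s^2 + 2^-n\<close>, the increments themselves are then
      summable.\<close>
    define d where "d n x = 2 ^ n * (norm (f (Suc n) x - f n x))\<^sup>2" for n x
    have md [measurable]: "d n \<in> borel_measurable M" for n unfolding d_def by measurable
    have nn: "(\<integral>\<^sup>+x. ennreal (d n x) \<partial>M) \<le> ennreal (c * (1/2)^n)" for n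
    proof -
      have "(\<integral>\<^sup>+x. ennreal (d n x) \<partial>M) = ennreal (\<integral>x. d n x \<partial>M)"
        using int by (intro nn_integral_eq_integral) (auto simp: d_def)
      also have "(\<integral>x. d n x \<partial>M) = 2 ^ n * (\<integral>x. (norm (f (Suc n) x - f n x))\<^sup>2 \<partial>M)" by (simp add: d_def)
      also have "\<dots> \<le> 2 ^ n * (c * (1/4)^n)" by (intro mult_left_mono C) auto
      also have "\<dots> = c * (2 * (1/4))^n" by (simp only: power_mult_distrib mult_ac)
      finally show ?thesis by (simp add: ennreal_leI)
    qed
    have "(\<integral>\<^sup>+x. (\<Sum>n. ennreal (d n x)) \<partial>M) = (\<Sum>n. \<integral>\<^sup>+x. ennreal (d n x) \<partial>M)"
      by (rule nn_integral_suminf) simp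
    also have "\<dots> \<le> (\<Sum>n. ennreal (c * (1/2)^n))" by (intro suminf_le nn) auto
    also have "\<dots> = ennreal (\<Sum>n. c * (1/2)^n)"
      using c0 by (intro suminf_ennreal2) (auto intro!: summable_mult summable_geometric)
    also have "\<dots> < \<infinity>" by simp
    finally have "AE x in M. (\<Sum>n. ennreal (d n x)) \<noteq> \<infinity>"
      by (intro nn_integral_noteq_infinite) auto
    then show ?thesis
    proof eventually_elim
      case (elim x)
      have sd: "summable (\<lambda>n. d n x)"
        by (rule summable_suminf_not_top) (use elim in \<open>auto simp: d_def\<close>)
      have "summable (\<lambda>n. d n x + (1/2)^n)" by (intro summable_add sd summable_geometric) simp
      then have "summable (\<lambda>n. f (Suc n) x - f n x)"
      proof (rule summable_comparison_test')
        fix n :: nat assume "n \<ge> 0"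
        have "2 * (s::real) \<le> k * s\<^sup>2 + inverse k" if "k > 0" for k s
        proof -
          have "0 \<le> (k * s - 1)\<^sup>2 / k" using that by simp
          then show ?thesis using that by (simp add: field_simps power2_eq_square)
        qed
        from this[of "2^n" "norm (f (Suc n) x - f n x)"] norm_ge_zero[of "f (Suc n) x - f n x"]
        show "norm (f (Suc n) x - f n x) \<le> d n x + (1/2)^n"
          unfolding d_def power_one_over inverse_eq_divide by (smt (verit) zero_less_power)
      qed
      then have "convergent (\<lambda>n. \<Sum>i<n. f (Suc i) x - f i x)" by (simp add: summable_iff_convergent)
      then have "convergent (\<lambda>n. f n x - f 0 x)" by (simp add: sum_lessThan_telescope[of "\<lambda>i. f i x"])
      then have "convergent (\<lambda>n. f n x)" by (simp add: convergent_diff_const_right_iff)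
      then show ?case unfolding g_def by (simp add: convergent_LIMSEQ_iff)
    qed
  qed
  \<comment> \<open>Fatou's lemma, letting \<open>m\<close> tend to infinity with \<open>n\<close>
    fixed, turns the Cauchy rate into a rate for the limit.\<close>
  have nn: "(\<integral>\<^sup>+x. ennreal ((norm (f n x - g x))\<^sup>2) \<partial>M) \<le> ennreal (c * (1/4)^n)" for n
  proof -
    have "(\<integral>\<^sup>+x. ennreal ((norm (f n x - g x))\<^sup>2) \<partial>M) 
       = (\<integral>\<^sup>+x. liminf (\<lambda>m. ennreal ((norm (f m x - f n x))\<^sup>2)) \<partial>M)"
    proof (rule nn_integral_cong_AE)
      show "AE x in M. ennreal ((norm (f n x - g x))\<^sup>2) = liminf (\<lambda>m. ennreal ((norm (f m x - f n x))\<^sup>2))"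
        using AE
      proof eventually_elim
        case (elim x)
        have "(\<lambda>m. ennreal ((norm (f m x - f n x))\<^sup>2)) \<longlonglongrightarrow> ennreal ((norm (g x - f n x))\<^sup>2)"
          by (intro tendsto_ennrealI tendsto_intros elim)
        then have "liminf (\<lambda>m. ennreal ((norm (f m x - f n x))\<^sup>2)) = ennreal ((norm (g x - f n x))\<^sup>2)"
          by (intro lim_imp_Liminf) simp_all
        then show ?case by (simp add: norm_minus_commute)
      qed
    qed
    also have "\<dots> \<le> liminf (\<lambda>m. \<integral>\<^sup>+x. ennreal ((norm (f m x - f n x))\<^sup>2) \<partial>M)"
      by (rule nn_integral_liminf) simp
    also have "\<dots> \<le> liminf (\<lambda>m::nat. ennreal (c * (1/4)^n))"
    proof (rule Liminf_mono, rule eventually_sequentiallyI[of n])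
      fix m assume "n \<le> m"
      then show "(\<integral>\<^sup>+x. ennreal ((norm (f m x - f n x))\<^sup>2) \<partial>M) \<le> ennreal (c * (1/4)^n)"
        using C[of n m] int by (subst nn_integral_eq_integral) (auto intro: ennreal_leI)
    qed
    also have "\<dots> = ennreal (c * (1/4)^n)" by (simp add: Liminf_const)
    finally show ?thesis .
  qed
  have i: "integrable M (\<lambda>x. (norm (f n x - g x))\<^sup>2)" for n
    using nn[of n] by (intro integrableI_bounded) (auto simp: le_less_trans[OF _ ennreal_less_top])
  have L2d: "L2 M (\<lambda>x. f n x - g x)" for n using i[of n] by (simp add: L2_def)
  have "L2 M g" using L2_diff[OF L L2d, of 0 0] by simp
  moreover have "(\<lambda>n. \<integral>x. (norm (f n x - g x))\<^sup>2 \<partial>M) \<longlonglongrightarrow> 0"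
  proof (rule tendsto_sandwich[where f="\<lambda>_. 0" and h="\<lambda>n. c * (1/4)^n"])
    show "\<forall>\<^sub>F n in sequentially. (\<integral>x. (norm (f n x - g x))\<^sup>2 \<partial>M) \<le> c * (1/4)^n"
    proof (rule always_eventually, rule allI)
      fix n
      have "ennreal (\<integral>x. (norm (f n x - g x))\<^sup>2 \<partial>M) \<le> ennreal (c * (1/4)^n)"
        using nn[of n] i[of n] by (subst (asm) nn_integral_eq_integral) auto
      then show "(\<integral>x. (norm (f n x - g x))\<^sup>2 \<partial>M) \<le> c * (1/4)^n"
        using c0 by (subst (asm) ennreal_le_iff) auto
    qed
    show "(\<lambda>n. c * (1/4)^n) \<longlonglongrightarrow> 0" by (intro tendsto_mult_right_zero LIMSEQ_power_zero) simp
  qed auto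
  ultimately show ?thesis by blast
qed

text \<open>A general \<open>P\<close> covers the three pairings used below: scalar multiplication,
  its flip, and the inner product.\<close>

lemma L2_tendsto_bilinear:
  fixes P :: "'b::euclidean_space \<Rightarrow> 'c::euclidean_space \<Rightarrow> 'd::euclidean_space"
  assumes P: "bounded_bilinear P" and L: "\<And>n. L2 M (f n)" "L2 M h" "L2 M g"
    and lim: "(\<lambda>n. \<integral>x. (norm (f n x - h x))\<^sup>2 \<partial>M) \<longlonglongrightarrow> 0"
  shows "(\<lambda>n. \<integral>x. P (f n x) (g x) \<partial>M) \<longlonglongrightarrow> (\<integral>x. P (h x) (g x) \<partial>M)"
proof -
  interpret bounded_bilinear P by (rule P)
  obtain K where K: "K > 0" "\<And>a b. norm (P a b) \<le> norm a * norm b * K" using pos_bounded by blast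
  have i: "integrable M (\<lambda>x. P (k x) (g x))" if "L2 M k" for k
  proof (rule Bochner_Integration.integrable_bound)
    show "integrable M (\<lambda>x. norm (k x) * norm (g x) * K)" using L2_integrable_mult[OF that L(3)] by simp
    show "(\<lambda>x. P (k x) (g x)) \<in> borel_measurable M"
      by (rule borel_measurable_continuous_Pair[OF L2D(1)[OF that] L2D(1)[OF L(3)]])
         (intro continuous_on continuous_intros)
    show "AE x in M. norm (P (k x) (g x)) \<le> norm (norm (k x) * norm (g x) * K)"
      using K by (auto simp: abs_mult)
  qed
  have "(\<lambda>n. (\<integral>x. P (f n x) (g x) \<partial>M) - (\<integral>x. P (h x) (g x) \<partial>M)) \<longlonglongrightarrow> 0"
  proof (rule Lim_null_comparison)
    show "\<forall>\<^sub>F n in sequentially. norm ((\<integral>x. P (f n x) (g x) \<partial>M) - (\<integral>x. P (h x) (g x) \<partial>M))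
        \<le> K * (sqrt (\<integral>x. (norm (f n x - h x))\<^sup>2 \<partial>M) * sqrt (\<integral>x. (norm (g x))\<^sup>2 \<partial>M))"
    proof (rule always_eventually, rule allI)
      fix n
      have Ld: "L2 M (\<lambda>x. f n x - h x)" by (rule L2_diff[OF L(1,2)])
      have "(\<integral>x. P (f n x) (g x) \<partial>M) - (\<integral>x. P (h x) (g x) \<partial>M) = (\<integral>x. P (f n x - h x) (g x) \<partial>M)"
        using i[OF L(1)] i[OF L(2)] by (simp add: diff_left)
      also have "norm \<dots> \<le> (\<integral>x. norm (P (f n x - h x) (g x)) \<partial>M)" by (rule integral_norm_bound)
      also have "\<dots> \<le> (\<integral>x. norm (f n x - h x) * norm (g x) * K \<partial>M)"
        using i[OF Ld] L2_integrable_mult[OF Ld L(3)] K(2) by (intro integral_mono) simp_all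
      also have "\<dots> = K * (\<integral>x. norm (f n x - h x) * norm (g x) \<partial>M)" by simp
      also have "\<dots> \<le> K * (sqrt (\<integral>x. (norm (f n x - h x))\<^sup>2 \<partial>M) * sqrt (\<integral>x. (norm (g x))\<^sup>2 \<partial>M))"
        using K(1) by (intro mult_left_mono L2_Cauchy_Schwarz Ld L) auto
      finally show "norm ((\<integral>x. P (f n x) (g x) \<partial>M) - (\<integral>x. P (h x) (g x) \<partial>M))
        \<le> K * (sqrt (\<integral>x. (norm (f n x - h x))\<^sup>2 \<partial>M) * sqrt (\<integral>x. (norm (g x))\<^sup>2 \<partial>M))" .
    qed
    have "(\<lambda>n. K * (sqrt (\<integral>x. (norm (f n x - h x))\<^sup>2 \<partial>M) * sqrt (\<integral>x. (norm (g x))\<^sup>2 \<partial>M)))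
       \<longlonglongrightarrow> K * (sqrt 0 * sqrt (\<integral>x. (norm (g x))\<^sup>2 \<partial>M))"
      by (intro tendsto_intros lim)
    then show "(\<lambda>n. K * (sqrt (\<integral>x. (norm (f n x - h x))\<^sup>2 \<partial>M) * sqrt (\<integral>x. (norm (g x))\<^sup>2 \<partial>M))) \<longlonglongrightarrow> 0"
      by simp
  qed
  then show ?thesis by (simp add: LIM_zero_iff)
qed

section \<open>Existence of the torsion function and comparison\<close>

lemma grad_add: "smooth f \<Longrightarrow> smooth g \<Longrightarrow> grad (\<lambda>x. f x + g x) x = grad f x + grad g x"
  by (intro grad_GDERIV GDERIV_add smooth_GDERIV)

lemma grad_mult: "smooth f \<Longrightarrow> smooth g \<Longrightarrow> grad (\<lambda>x. f x * g x) x = f x *\<^sub>R grad g x + g x *\<^sub>R grad f x"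
  by (intro grad_GDERIV GDERIV_mult smooth_GDERIV)

lemma grad_const: "grad (\<lambda>x. c) x = 0"
  by (rule grad_GDERIV) (simp add: gderiv_def)

lemma grad_cmult: "smooth f \<Longrightarrow> grad (\<lambda>x. c * f x) x = c *\<^sub>R grad f x"
  by (subst grad_mult) (auto simp: grad_const)

lemma grad_compose:
  "smooth f \<Longrightarrow> (g has_real_derivative g') (at (f x)) \<Longrightarrow> grad (\<lambda>x. g (f x)) x = g' *\<^sub>R grad f x"
  by (intro grad_GDERIV GDERIV_DERIV_compose smooth_GDERIV)

lemma L2_on_iff: "f \<in> L2_on \<Omega> \<longleftrightarrow> L2 (lebesgue_on \<Omega>) f"
  by (simp add: L2_on_def L2_def)

lemma test_L2:
  assumes "open \<Omega>" "\<phi> \<in> test_functions \<Omega>"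
  shows "L2 (lebesgue_on \<Omega>) \<phi>" "L2 (lebesgue_on \<Omega>) (grad \<phi>)" "integrable (lebesgue_on \<Omega>) \<phi>"
proof -
  have sm: "smooth \<phi>" using assms(2) by (rule test_smooth)
  note c = smooth_continuous[OF sm] continuous_grad[OF sm]
  have m: "\<phi> \<in> borel_measurable (lebesgue_on \<Omega>)" "grad \<phi> \<in> borel_measurable (lebesgue_on \<Omega>)"
    using assms(1) by (auto intro!: continuous_imp_measurable_on_sets_lebesgue c)
  show "L2 (lebesgue_on \<Omega>) \<phi>"
    unfolding L2_def using m(1) integrable_on_test_support(1)[OF assms, of "\<lambda>x. (norm (\<phi> x))\<^sup>2"]
    by (simp add: supp_zero c continuous_intros)
  show "L2 (lebesgue_on \<Omega>) (grad \<phi>)"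
    unfolding L2_def using m(2) integrable_on_test_support(1)[OF assms, of "\<lambda>x. (norm (grad \<phi> x))\<^sup>2"]
    by (simp add: test_grad_zero[OF assms(2)] c continuous_intros)
  show "integrable (lebesgue_on \<Omega>) \<phi>"
    by (rule integrable_on_test_support(1)[OF assms]) (auto simp: supp_zero c)
qed

lemma integrable_scaleR_test:
  assumes "open \<Omega>" "\<phi> \<in> test_functions \<Omega>" "\<psi> \<in> test_functions \<Omega>"
  shows "integrable (lebesgue_on \<Omega>) (\<lambda>x. \<phi> x *\<^sub>R grad \<psi> x)"
  using assms test_smooth
  by (intro integrable_on_test_support(1)[OF assms(1,2)])
     (auto intro!: continuous_intros continuous_grad smooth_continuous simp: supp_zero)

lemma test_has_weak_gradient:
  assumes "open \<Omega>" "\<phi> \<in> test_functions \<Omega>"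
  shows "has_weak_gradient \<Omega> \<phi> (grad \<phi>)"
  unfolding has_weak_gradient_def L2_on_iff
proof (intro conjI ballI test_L2 assms)
  fix \<psi> assume \<psi>: "\<psi> \<in> test_functions \<Omega>"
  note i = integrable_scaleR_test[OF assms \<psi>] integrable_scaleR_test[OF assms(1) \<psi> assms(2)]
  show "(\<integral>x. \<phi> x *\<^sub>R grad \<psi> x \<partial>lebesgue_on \<Omega>) = - (\<integral>x. \<psi> x *\<^sub>R grad \<phi> x \<partial>lebesgue_on \<Omega>)"
  proof (rule euclidean_eqI)
    fix b :: 'a assume b: "b \<in> Basis"
    show "(\<integral>x. \<phi> x *\<^sub>R grad \<psi> x \<partial>lebesgue_on \<Omega>) \<bullet> b = - (\<integral>x. \<psi> x *\<^sub>R grad \<phi> x \<partial>lebesgue_on \<Omega>) \<bullet> b"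
      using integral_by_parts[OF assms(1) test_smooth[OF assms(2)] \<psi> b]
      by (simp add: integral_inner_left[symmetric] i grad_inner[OF b])
  qed
qed

lemma test_H01:
  assumes "open \<Omega>" "\<phi> \<in> test_functions \<Omega>"
  shows "\<phi> \<in> H01 \<Omega>"
  unfolding H01_def
  by (rule CollectI, rule exI[of _ "grad \<phi>"], intro conjI test_has_weak_gradient assms,
      rule exI[of _ "\<lambda>_. \<phi>"]) (simp add: assms)

section \<open>Existence of the torsion function by energy minimisation\<close>

definition energy :: "'a::euclidean_space set \<Rightarrow> ('a \<Rightarrow> real) \<Rightarrow> real" where
  "energy \<Omega> \<phi> = (1/2) * (\<integral>x. (norm (grad \<phi> x))\<^sup>2 \<partial>lebesgue_on \<Omega>) - (\<integral>x. \<phi> x \<partial>lebesgue_on \<Omega>)"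

lemma integrable_grad_dot_test:
  assumes "open \<Omega>" "\<phi> \<in> test_functions \<Omega>" "\<psi> \<in> test_functions \<Omega>"
  shows "integrable (lebesgue_on \<Omega>) (\<lambda>x. grad \<phi> x \<bullet> grad \<psi> x)"
  using assms test_smooth
  by (intro integrable_on_test_support(1)[OF assms(1,2)])
     (auto intro!: continuous_intros continuous_grad simp: test_grad_zero)

text \<open>The coefficient of \<open>t\<close> is the defect in the weak equation
  \<open>-\<Delta>\<phi> = 1\<close> tested with \<open>\<psi>\<close>; the other new term is the
  quadratic one.\<close>

lemma energy_expand:
  assumes "open \<Omega>" "\<phi> \<in> test_functions \<Omega>" "\<psi> \<in> test_functions \<Omega>"
  shows "energy \<Omega> (\<lambda>x. \<phi> x + t * \<psi> x) = energy \<Omega> \<phi> 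
    + t * ((\<integral>x. grad \<phi> x \<bullet> grad \<psi> x \<partial>lebesgue_on \<Omega>) - (\<integral>x. \<psi> x \<partial>lebesgue_on \<Omega>))
    + t\<^sup>2 / 2 * (\<integral>x. (norm (grad \<psi> x))\<^sup>2 \<partial>lebesgue_on \<Omega>)"
proof -
  have sm: "smooth \<phi>" "smooth \<psi>" "smooth (\<lambda>x. t * \<psi> x)" using assms by (auto simp: test_smooth)
  have "(norm (grad (\<lambda>x. \<phi> x + t * \<psi> x) x))\<^sup>2 = 
      (norm (grad \<phi> x))\<^sup>2 + 2 * t * (grad \<phi> x \<bullet> grad \<psi> x) + t\<^sup>2 * (norm (grad \<psi> x))\<^sup>2" for x
  proof -
    have "(norm (a + t *\<^sub>R b))\<^sup>2 = (norm a)\<^sup>2 + 2 * t * (a \<bullet> b) + t\<^sup>2 * (norm b)\<^sup>2" for a b :: 'a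
      unfolding power2_norm_eq_inner
      by (simp only: inner_add_left inner_add_right inner_scaleR_left inner_scaleR_right 
          inner_commute[of b a] power2_eq_square) (simp only: algebra_simps mult_2)
    then show ?thesis by (simp add: grad_add grad_cmult sm)
  qed
  then show ?thesis
    unfolding energy_def
    using L2D(2)[OF test_L2(2)[OF assms(1,2)]] L2D(2)[OF test_L2(2)[OF assms(1,3)]]
      integrable_grad_dot_test[OF assms] test_L2(3)[OF assms(1,2)] test_L2(3)[OF assms(1,3)]
    by (simp add: algebra_simps)
qed

text \<open>Quantitative first-order condition: an almost minimiser with excess \<open>e\<close> has
  first variation \<open>L\<close> of order \<open>sqrt e\<close>. The choice is
  \<open>t = - L / (D + 1)\<close>, where the added 1 covers \<open>D = 0\<close>.\<close>

lemma quadratic_nonneg_bound: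
  fixes L D e :: real
  assumes "\<And>t. t * L + t\<^sup>2 / 2 * D + e \<ge> 0" "D \<ge> 0"
  shows "L\<^sup>2 \<le> 2 * (D + 1) * e"
proof -
  define u where "u = L / (D + 1)"
  have L: "L = u * (D + 1)" using assms(2) by (simp add: u_def)
  have "0 \<le> 2 * (D + 1) * ((- u) * L + (- u)\<^sup>2 / 2 * D + e)"
    using assms(1)[of "- u"] assms(2) by (intro mult_nonneg_nonneg) auto
  also have "\<dots> = 2 * (D + 1) * e - L\<^sup>2 - u\<^sup>2 * (D + 1)"
    unfolding L by (simp add: power2_eq_square algebra_simps)
  also have "\<dots> \<le> 2 * (D + 1) * e - L\<^sup>2" using assms(2) by simp
  finally show ?thesis by simp
qed

lemma integrable_const_bounded_open:
  assumes "bounded (\<Omega> :: 'a::euclidean_space set)" "open \<Omega>"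
  shows "integrable (lebesgue_on \<Omega>) (\<lambda>x. c::real)"
proof -
  have "emeasure (lebesgue_on \<Omega>) (space (lebesgue_on \<Omega>)) < \<infinity>"
    using emeasure_bounded_finite[OF assms(1)] assms(2)
    by (simp add: emeasure_restrict_space space_restrict_space)
  then interpret finite_measure "lebesgue_on \<Omega>" by (intro finite_measureI) simp
  show ?thesis by simp
qed

lemma energy_bounded_below:
  fixes \<Omega> :: "'a::euclidean_space set"
  assumes O: "open \<Omega>" "bounded \<Omega>"
  shows "\<exists>c. \<forall>\<phi>\<in>test_functions \<Omega>. c \<le> energy \<Omega> \<phi>"
proof -
  obtain R where R: "R > 0" "\<And>x. x \<in> \<Omega> \<Longrightarrow> norm x \<le> R" using O(2) bounded_pos by blast
  define V where "V = (\<integral>x. (1::real) \<partial>lebesgue_on \<Omega>)"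
  have "- (2 * R\<^sup>2 * V) \<le> energy \<Omega> \<phi>" if t: "\<phi> \<in> test_functions \<Omega>" for \<phi>
  proof -
    \<comment> \<open>With this weight in Young's inequality, Poincare turns \<open>s / 2\<close>
      times the integral of \<open>\<phi>^2\<close> into exactly the half Dirichlet integral present
      in the energy.\<close>
    define s where "s = 1 / (4 * R\<^sup>2)"
    have s: "s > 0" using R by (simp add: s_def)
    have i: "integrable (lebesgue_on \<Omega>) (\<lambda>x. (\<phi> x)\<^sup>2)" using L2D(2)[OF test_L2(1)[OF O(1) t]] by simp
    have "(\<integral>x. \<phi> x \<partial>lebesgue_on \<Omega>) \<le> (\<integral>x. s / 2 * (\<phi> x)\<^sup>2 + 1 / (2 * s) * 1 \<partial>lebesgue_on \<Omega>)"
    proof (rule integral_mono)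
      fix x
      have "(s * y - 1)\<^sup>2 / (2 * s) = s / 2 * y\<^sup>2 + 1 / (2 * s) * 1 - y" for y
        using s by (simp add: field_simps power2_eq_square)
      from this[of "\<phi> x"] show "\<phi> x \<le> s / 2 * (\<phi> x)\<^sup>2 + 1 / (2 * s) * 1"
        using s by (smt (verit) divide_nonneg_nonneg zero_le_power2)
    qed (use i test_L2(3)[OF O(1) t] integrable_const_bounded_open[OF O(2,1)] in auto)
    also have "\<dots> = s / 2 * (\<integral>x. (\<phi> x)\<^sup>2 \<partial>lebesgue_on \<Omega>) + 1 / (2 * s) * V"
      unfolding V_def using i integrable_const_bounded_open[OF O(2,1)] by simp
    also have "\<dots> \<le> s / 2 * (4 * R\<^sup>2 * (\<integral>x. (norm (grad \<phi> x))\<^sup>2 \<partial>lebesgue_on \<Omega>)) + 1 / (2 * s) * V"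
      using poincare[OF O(1) t R(2)] s by (intro add_right_mono mult_left_mono) auto
    also have "\<dots> = 1 / 2 * (\<integral>x. (norm (grad \<phi> x))\<^sup>2 \<partial>lebesgue_on \<Omega>) + 2 * R\<^sup>2 * V"
    proof -
      have "s / 2 * (4 * R\<^sup>2 * D) + 1 / (2 * s) * V = 1 / 2 * D + 2 * R\<^sup>2 * V" for D
        using R(1) by (simp add: s_def)
      then show ?thesis .
    qed
    finally show ?thesis by (simp add: energy_def)
  qed
  then show ?thesis by blast
qed

text \<open>Direct method: a minimising sequence is Cauchy because the energy is uniformly convex,
  and its limit satisfies the Euler-Lagrange equation. Existence is what gives content to the
  \<open>SOME\<close> in \<open>torsion_function\<close>.\<close>

lemma torsion_function_exists:
  fixes \<Omega> :: "'a::euclidean_space set"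
  assumes O: "open \<Omega>" "bounded \<Omega>"
  shows "\<exists>v. is_torsion_function \<Omega> v"
proof -
  let ?M = "lebesgue_on \<Omega>" and ?T = "test_functions \<Omega>"
  let ?D = "\<lambda>\<phi>. \<integral>x. (norm (grad \<phi> x))\<^sup>2 \<partial>?M"
  obtain R where R: "R > 0" "\<And>x. x \<in> \<Omega> \<Longrightarrow> norm x \<le> R" using O(2) bounded_pos by blast
  define m where "m = Inf (energy \<Omega> ` ?T)"
  have bdd: "bdd_below (energy \<Omega> ` ?T)" using energy_bounded_below[OF O] by (auto simp: bdd_below_def)
  have ne: "energy \<Omega> ` ?T \<noteq> {}" using test_const0 by blast
  have m_le: "m \<le> energy \<Omega> \<phi>" if "\<phi> \<in> ?T" for \<phi>
    unfolding m_def using bdd that by (intro cInf_lower) auto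
  \<comment> \<open>The excess \<open>(1/4)^n\<close> is chosen to produce the rate required by
    \<open>L2_complete\<close>.\<close>
  have "\<exists>\<phi>\<in>?T. energy \<Omega> \<phi> < m + (1/4)^n" for n
  proof (rule ccontr)
    assume "\<not> ?thesis"
    then have "m + (1/4)^n \<le> m" unfolding m_def[symmetric]
      by (subst (2) m_def, intro cInf_greatest ne) (auto simp: not_less)
    then show False using zero_less_power[of "1/4::real" n] by linarith
  qed
  then obtain \<phi> where \<phi>: "\<And>n. \<phi> n \<in> ?T" "\<And>n. energy \<Omega> (\<phi> n) < m + (1/4)^n" by metis
  have sm: "smooth (\<phi> n)" for n using \<phi>(1) by (rule test_smooth)
  have diffT: "(\<lambda>x. \<phi> k x + (-1) * \<phi> n x) \<in> ?T" for k n by (intro test_add test_cmult \<phi>)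
  have D_diff: "?D (\<lambda>x. \<phi> k x + (-1) * \<phi> n x) \<le> 8 * (1/4)^n" if "n \<le> k" for n k
  proof -
    let ?c = "\<lambda>x. \<phi> k x + (-1) * \<phi> n x"
    define L where "L = (\<integral>x. grad (\<phi> n) x \<bullet> grad ?c x \<partial>?M) - (\<integral>x. ?c x \<partial>?M)"
    note ex = energy_expand[OF O(1) \<phi>(1)[of n] diffT[of k n], folded L_def]
    \<comment> \<open>\<open>L\<close> is the first variation at \<open>\<phi> n\<close> in the
      direction of \<open>\<phi> k\<close>. It is eliminated between \<open>t = 1\<close>, which
      reaches \<open>\<phi> k\<close>, and the midpoint \<open>t = 1/2\<close>, whose energy is at
      least \<open>m\<close>.\<close>
    have "energy \<Omega> (\<phi> k) = energy \<Omega> (\<phi> n) + L + ?D ?c / 2" using ex[of 1] by simp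
    moreover have "m \<le> energy \<Omega> (\<phi> n) + L / 2 + ?D ?c / 8"
    proof -
      have "m \<le> energy \<Omega> (\<lambda>x. \<phi> n x + (1/2) * ?c x)" by (intro m_le test_add test_cmult diffT \<phi>)
      then show ?thesis unfolding ex by (simp add: power2_eq_square)
    qed
    ultimately have "?D ?c \<le> 4 * energy \<Omega> (\<phi> n) + 4 * energy \<Omega> (\<phi> k) - 8 * m" by simp
    also have "\<dots> \<le> 4 * (1/4)^n + 4 * (1/4)^k" using \<phi>(2)[of n] \<phi>(2)[of k] by simp
    also have "(1/4::real)^k \<le> (1/4)^n" using that by (intro power_decreasing) auto
    finally show ?thesis by simp
  qed
  have L2: "L2 ?M (\<phi> n)" "L2 ?M (grad (\<phi> n))" for n using test_L2[OF O(1) \<phi>(1)] by auto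
  have "\<exists>v. L2 ?M v \<and> (\<lambda>n. \<integral>x. (norm (\<phi> n x - v x))\<^sup>2 \<partial>?M) \<longlonglongrightarrow> 0"
  proof (rule L2_complete[OF L2(1), where c="32 * R\<^sup>2"])
    fix n k :: nat assume "n \<le> k"
    have "(\<integral>x. (norm (\<phi> k x - \<phi> n x))\<^sup>2 \<partial>?M) \<le> 4 * R\<^sup>2 * ?D (\<lambda>x. \<phi> k x + (-1) * \<phi> n x)"
      using poincare[OF O(1) diffT R(2), of k n] by simp
    also have "\<dots> \<le> 4 * R\<^sup>2 * (8 * (1/4)^n)" by (intro mult_left_mono D_diff \<open>n \<le> k\<close>) simp
    finally show "(\<integral>x. (norm (\<phi> k x - \<phi> n x))\<^sup>2 \<partial>?M) \<le> 32 * R\<^sup>2 * (1/4)^n" by simp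
  qed
  then obtain v where v: "L2 ?M v" "(\<lambda>n. \<integral>x. (norm (\<phi> n x - v x))\<^sup>2 \<partial>?M) \<longlonglongrightarrow> 0" by blast
  have "\<exists>G. L2 ?M G \<and> (\<lambda>n. \<integral>x. (norm (grad (\<phi> n) x - G x))\<^sup>2 \<partial>?M) \<longlonglongrightarrow> 0"
  proof (rule L2_complete[OF L2(2), where c=8])
    fix n k :: nat assume "n \<le> k"
    have sm': "smooth (\<lambda>x. (-1) * \<phi> n x)" by (intro smooth_mult smooth_const sm)
    have "grad (\<lambda>x. \<phi> k x + (-1) * \<phi> n x) x = grad (\<phi> k) x - grad (\<phi> n) x" for x
    proof -
      have "(-1) *\<^sub>R a = - a" for a :: 'a by simp
      then show ?thesis
        by (metis grad_add[OF sm[of k] sm', of x] grad_cmult[OF sm[of n], of "-1" x] diff_conv_add_uminus)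
    qed
    then show "(\<integral>x. (norm (grad (\<phi> k) x - grad (\<phi> n) x))\<^sup>2 \<partial>?M) \<le> 8 * (1/4)^n"
      using D_diff[OF \<open>n \<le> k\<close>] by (simp only:)
  qed
  then obtain G where G: "L2 ?M G" "(\<lambda>n. \<integral>x. (norm (grad (\<phi> n) x - G x))\<^sup>2 \<partial>?M) \<longlonglongrightarrow> 0" by blast
  have wg: "has_weak_gradient \<Omega> v G"
    unfolding has_weak_gradient_def L2_on_iff
  proof (intro conjI ballI v G)
    fix \<psi> assume \<psi>: "\<psi> \<in> ?T"
    have 1: "(\<lambda>n. \<integral>x. \<phi> n x *\<^sub>R grad \<psi> x \<partial>?M) \<longlonglongrightarrow> (\<integral>x. v x *\<^sub>R grad \<psi> x \<partial>?M)"
      by (rule L2_tendsto_bilinear[OF bounded_bilinear_scaleR L2(1) v(1) test_L2(2)[OF O(1) \<psi>] v(2)])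
    have 2: "(\<lambda>n. \<integral>x. \<psi> x *\<^sub>R grad (\<phi> n) x \<partial>?M) \<longlonglongrightarrow> (\<integral>x. \<psi> x *\<^sub>R G x \<partial>?M)"
      by (rule L2_tendsto_bilinear[OF bounded_bilinear.flip[OF bounded_bilinear_scaleR] 
            L2(2) G(1) test_L2(1)[OF O(1) \<psi>] G(2)])
    have "(\<integral>x. \<phi> n x *\<^sub>R grad \<psi> x \<partial>?M) = - (\<integral>x. \<psi> x *\<^sub>R grad (\<phi> n) x \<partial>?M)" for n
      using test_has_weak_gradient[OF O(1) \<phi>(1)] \<psi> unfolding has_weak_gradient_def by blast
    with 1 have "(\<lambda>n. - (\<integral>x. \<psi> x *\<^sub>R grad (\<phi> n) x \<partial>?M)) \<longlonglongrightarrow> (\<integral>x. v x *\<^sub>R grad \<psi> x \<partial>?M)" by simp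
    from LIMSEQ_unique[OF this tendsto_minus[OF 2]]
    show "(\<integral>x. v x *\<^sub>R grad \<psi> x \<partial>?M) = - (\<integral>x. \<psi> x *\<^sub>R G x \<partial>?M)" .
  qed
  have "v \<in> H01 \<Omega>"
    unfolding H01_def
    by (rule CollectI, rule exI[of _ G], rule conjI[OF wg], rule exI[of _ \<phi>])
       (use \<phi>(1) tendsto_add[OF v(2) G(2)] in simp)
  moreover have "(\<integral>x. G x \<bullet> grad \<psi> x \<partial>?M) = (\<integral>x. \<psi> x \<partial>?M)" if \<psi>: "\<psi> \<in> ?T" for \<psi>
  proof -
    define L where "L n = (\<integral>x. grad (\<phi> n) x \<bullet> grad \<psi> x \<partial>?M) - (\<integral>x. \<psi> x \<partial>?M)" for n
    define c where "c = 2 * (?D \<psi> + 1)"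
    \<comment> \<open>The energy of \<open>\<phi> n + t \<psi>\<close> is at least \<open>m\<close>
      for every \<open>t\<close>, while that of \<open>\<phi> n\<close> exceeds \<open>m\<close> by
      less than \<open>(1/4)^n\<close>.\<close>
    have Lc: "(L n)\<^sup>2 \<le> c * (1/4)^n" for n
      unfolding c_def
    proof (rule quadratic_nonneg_bound)
      fix t
      have "m \<le> energy \<Omega> (\<lambda>x. \<phi> n x + t * \<psi> x)" by (intro m_le test_add test_cmult \<phi> \<psi>)
      then show "0 \<le> t * L n + t\<^sup>2 / 2 * ?D \<psi> + (1/4)^n"
        unfolding energy_expand[OF O(1) \<phi>(1) \<psi>] L_def[symmetric] using \<phi>(2)[of n] by simp
    qed simp
    have c0: "(\<lambda>n. c * (1/4)^n) \<longlonglongrightarrow> 0"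
      by (intro tendsto_mult_right_zero LIMSEQ_power_zero) simp
    have "(\<lambda>n. (L n)\<^sup>2) \<longlonglongrightarrow> 0"
      by (rule Lim_null_comparison[OF always_eventually c0]) (use Lc in simp)
    then have "(\<lambda>n. sqrt ((L n)\<^sup>2)) \<longlonglongrightarrow> sqrt 0" by (rule tendsto_real_sqrt)
    then have "L \<longlonglongrightarrow> 0" by (simp add: tendsto_rabs_zero_iff)
    moreover have "L \<longlonglongrightarrow> (\<integral>x. G x \<bullet> grad \<psi> x \<partial>?M) - (\<integral>x. \<psi> x \<partial>?M)"
      unfolding L_def[abs_def]
      by (intro tendsto_diff tendsto_const L2_tendsto_bilinear[OF bounded_bilinear_inner 
            L2(2) G(1) test_L2(2)[OF O(1) \<psi>] G(2)])
    ultimately have "0 = (\<integral>x. G x \<bullet> grad \<psi> x \<partial>?M) - (\<integral>x. \<psi> x \<partial>?M)" by (rule LIMSEQ_unique)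
    then show ?thesis by simp
  qed
  ultimately show ?thesis unfolding is_torsion_function_def using wg by blast
qed

section \<open>Comparison of the torsion function with smooth supersolutions\<close>

lemma weak_gradient_pairing_unique:
  assumes "has_weak_gradient \<Omega> u G" "has_weak_gradient \<Omega> u G'" and \<psi>: "\<psi> \<in> test_functions \<Omega>" and O: "open \<Omega>"
  shows "(\<integral>x. G x \<bullet> grad \<psi> x \<partial>lebesgue_on \<Omega>) = (\<integral>x. G' x \<bullet> grad \<psi> x \<partial>lebesgue_on \<Omega>)"
proof -
  let ?M = "lebesgue_on \<Omega>"
  have i: "integrable ?M (\<lambda>x. f x *\<^sub>R H x)" if "L2 ?M H" "L2 ?M f" for f and H :: "'a \<Rightarrow> 'a"
  proof (rule Bochner_Integration.integrable_bound[OF L2_integrable_mult[OF that]])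
    show "(\<lambda>x. f x *\<^sub>R H x) \<in> borel_measurable ?M" using that by (intro borel_measurable_scaleR L2D)
  qed (auto simp: abs_mult mult.commute)
  \<comment> \<open>Each \<open>partial_deriv \<psi> b\<close> is again a test function, so the
    definition of the weak gradient expresses the pairing through \<open>u\<close> alone.\<close>
  have eq: "(\<integral>x. H x \<bullet> grad \<psi> x \<partial>?M) = - (\<Sum>b\<in>Basis. (\<integral>x. u x *\<^sub>R grad (partial_deriv \<psi> b) x \<partial>?M) \<bullet> b)"
    if "has_weak_gradient \<Omega> u H" for H
  proof -
    have H: "L2 ?M H" using that by (simp add: has_weak_gradient_def L2_on_iff)
    have "(\<integral>x. H x \<bullet> grad \<psi> x \<partial>?M) = (\<integral>x. (\<Sum>b\<in>Basis. (partial_deriv \<psi> b x *\<^sub>R H x) \<bullet> b) \<partial>?M)"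
      by (intro Bochner_Integration.integral_cong refl, subst euclidean_inner) (simp add: grad_inner mult.commute)
    also have "\<dots> = (\<Sum>b\<in>Basis. (\<integral>x. partial_deriv \<psi> b x *\<^sub>R H x \<partial>?M) \<bullet> b)"
      using H test_L2(1)[OF O test_partial[OF \<psi>]]
      by (subst Bochner_Integration.integral_sum) 
         (auto intro!: integrable_inner_left i sum.cong integral_inner_left simp del: inner_scaleR_left)
    also have "\<dots> = (\<Sum>b\<in>Basis. - ((\<integral>x. u x *\<^sub>R grad (partial_deriv \<psi> b) x \<partial>?M) \<bullet> b))"
      using that test_partial[OF \<psi>] unfolding has_weak_gradient_def by (intro sum.cong) auto
    finally show ?thesis by (simp add: sum_negf)
  qed
  show ?thesis unfolding eq[OF assms(1)] eq[OF assms(2)] ..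
qed

text \<open>Inside \<open>\<Omega>\<close> and off the support of \<open>\<phi>\<close> the argument
  is \<open>- W x \<le> 0\<close>, where \<open>flat\<close> vanishes; hence the support is
  inherited from \<open>\<phi>\<close>. Outside \<open>\<Omega>\<close> the sign of \<open>W\<close>
  is unknown, so the function is set to zero there.\<close>

lemma cut_test:
  assumes O: "open \<Omega>" and \<phi>: "\<phi> \<in> test_functions \<Omega>" and W: "smooth W" "\<And>x. x \<in> \<Omega> \<Longrightarrow> W x \<ge> 0" and c: "c > 0"
  shows "(\<lambda>x. if x \<in> \<Omega> then flat p c (\<phi> x - W x) else 0) \<in> test_functions \<Omega>" (is "?f \<in> _")
    and "x \<in> \<Omega> \<Longrightarrow> grad (\<lambda>x. if x \<in> \<Omega> then flat p c (\<phi> x - W x) else 0) x =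
       flat ([:0,0,1:] * (smult c p - pderiv p)) c (\<phi> x - W x) *\<^sub>R (grad \<phi> x - grad W x)"
proof -
  have zero: "?f x = 0" if "x \<notin> supp \<phi>" for x
    using W(2)[of x] supp_zero[OF that] by (auto simp: flat_def)
  have sub: "supp \<phi> \<subseteq> \<Omega>" using \<phi> by (simp add: test_functions_iff)
  have sm: "smooth (\<lambda>x. \<phi> x - W x)" using test_smooth[OF \<phi>] W(1) by blast
  have "smooth ?f"
  proof (rule smooth_local)
    fix x
    show "\<exists>S h. open S \<and> x \<in> S \<and> smooth h \<and> (\<forall>y\<in>S. ?f y = h y)"
    proof (cases "x \<in> \<Omega>")
      case True
      then show ?thesis
        using O smooth_flat[OF c sm] by (intro exI[of _ \<Omega>] exI[of _ "\<lambda>x. flat p c (\<phi> x - W x)"]) auto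
    next
      case False
      then show ?thesis
        using closed_supp sub zero by (intro exI[of _ "- supp \<phi>"] exI[of _ "\<lambda>_. 0"]) auto
    qed
  qed
  then show "?f \<in> test_functions \<Omega>" using test_subset_support[OF \<phi>] zero by blast
  assume x: "x \<in> \<Omega>"
  show "grad ?f x = flat ([:0,0,1:] * (smult c p - pderiv p)) c (\<phi> x - W x) *\<^sub>R (grad \<phi> x - grad W x)"
  proof (rule grad_GDERIV)
    have "GDERIV (\<lambda>x. flat p c (\<phi> x - W x)) x :> 
        flat ([:0,0,1:] * (smult c p - pderiv p)) c (\<phi> x - W x) *\<^sub>R (grad \<phi> x - grad W x)"
      by (rule GDERIV_DERIV_compose[OF GDERIV_diff[OF smooth_GDERIV smooth_GDERIV] flat_deriv])
         (use test_smooth[OF \<phi>] W c in auto)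
    then show "GDERIV ?f x :> flat ([:0,0,1:] * (smult c p - pderiv p)) c (\<phi> x - W x) *\<^sub>R (grad \<phi> x - grad W x)"
      unfolding gderiv_def
      by (rule has_derivative_transform_within_open[where s=\<Omega>]) (use O x in auto)
  qed
qed

text \<open>This is the derivative of \<open>exp (-1/t)\<close>. With \<open>s = 1/t\<close> the
  upper bound reads \<open>s^2 \<le> exp s\<close>, which follows from
  \<open>s/2 \<le> exp (s/2 - 1)\<close> and \<open>2 \<le> exp 1\<close>.\<close>

lemma flat_sq_le_one: "0 \<le> flat [:0,0,1:] 1 t" "flat [:0,0,1:] 1 t \<le> 1"
proof -
  show "0 \<le> flat [:0,0,1:] 1 t" by (simp add: flat_def)
  show "flat [:0,0,1:] 1 t \<le> 1"
  proof (cases "t > 0")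
    case True
    define s where "s = 1 / t"
    have s: "s > 0" using True by (simp add: s_def)
    have "s / 2 \<le> exp (s / 2 - 1)" using exp_ge_add_one_self[of "s / 2 - 1"] by simp
    moreover have "2 \<le> exp (1::real)" using exp_ge_add_one_self[of 1] by simp
    ultimately have "s / 2 * 2 \<le> exp (s / 2 - 1) * exp 1" using s by (intro mult_mono) auto
    then have "s \<le> exp (s / 2)" by (simp add: exp_add[symmetric])
    then have "s * s \<le> exp (s / 2) * exp (s / 2)" using s by (intro mult_mono) auto
    then have "s * s \<le> exp s" by (simp add: exp_add[symmetric])
    then have "s * s * exp (- s) \<le> 1" by (simp add: exp_minus field_simps)
    then show ?thesis using True by (simp add: flat_def s_def)
  qed (simp add: flat_def)
qed

lemma flat_lipschitz: "\<bar>flat 1 1 a - flat 1 1 b\<bar> \<le> \<bar>a - b\<bar>"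
proof -
  have d: "(flat 1 1 has_real_derivative flat [:0,0,1:] 1 t) (at t)" for t
    using flat_deriv[of 1 1 t] by (simp add: pderiv_1)
  have "norm (flat 1 1 a - flat 1 1 b) \<le> 1 * norm (a - b)"
    by (rule field_differentiable_bound[where S=UNIV and f'="flat [:0,0,1:] 1"])
       (use d flat_sq_le_one in auto)
  then show ?thesis by simp
qed

text \<open>The function \<open>(s v - W)\<^sup>+\<close> is replaced by \<open>K(s v - W)\<close> with \<open>K(t) = exp (-1/t)\<close>.  Approximating \<open>v\<close> by test
  functions \<open>\<phi>\<^sub>n\<close> and testing with \<open>H(s \<phi>\<^sub>n - W)\<close>, where \<open>H' = (K')\<^sup>2\<close>, gives a bound for the Dirichlet
  integral of \<open>K(s \<phi>\<^sub>n - W)\<close>.  The polynomial \<open>1/4 + r/2 + r\<^sup>2/2\<close> below comes from integrating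
  \<open>(K')\<^sup>2 = t\<^sup>-\<^sup>4 exp (-2/t)\<close> in the variable \<open>r = 1/t\<close>.\<close>

lemma torsion_comparison:
  fixes \<Omega> :: "'a::euclidean_space set"
  assumes O: "open \<Omega>" "bounded \<Omega>" and v: "is_torsion_function \<Omega> v"
    and W: "smooth W" "\<And>x. x \<in> \<Omega> \<Longrightarrow> W x \<ge> 0" "\<And>x. x \<in> \<Omega> \<Longrightarrow> laplacian W x \<le> -1"
    and s: "s = 1 \<or> s = (-1::real)"
  shows "AE x in lebesgue_on \<Omega>. s * v x \<le> W x"
proof -
  let ?M = "lebesgue_on \<Omega>" and ?T = "test_functions \<Omega>"
  obtain R where R: "R > 0" "\<And>x. x \<in> \<Omega> \<Longrightarrow> norm x \<le> R" using O(2) bounded_pos by blast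
  obtain G0 where G0: "has_weak_gradient \<Omega> v G0" 
      "\<And>\<psi>. \<psi> \<in> ?T \<Longrightarrow> (\<integral>x. G0 x \<bullet> grad \<psi> x \<partial>?M) = (\<integral>x. \<psi> x \<partial>?M)"
    using v unfolding is_torsion_function_def by blast
  obtain G \<phi> where wg: "has_weak_gradient \<Omega> v G" and \<phi>: "\<And>n. \<phi> n \<in> ?T"
    and lim: "(\<lambda>n. (\<integral>x. (\<phi> n x - v x)\<^sup>2 \<partial>?M) + (\<integral>x. (norm (grad (\<phi> n) x - G x))\<^sup>2 \<partial>?M)) \<longlonglongrightarrow> 0"
    using v unfolding is_torsion_function_def H01_def by blast
  \<comment> \<open>Membership in \<open>H01\<close> and the weak equation each bring their own
    gradient; the equation is transferred to the gradient approximated by the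
    \<open>\<phi> n\<close>.\<close>
  have G: "(\<integral>x. G x \<bullet> grad \<psi> x \<partial>?M) = (\<integral>x. \<psi> x \<partial>?M)" if "\<psi> \<in> ?T" for \<psi>
    using G0(2)[OF that] weak_gradient_pairing_unique[OF wg G0(1) that O(1)] by simp
  have L2: "L2 ?M v" "L2 ?M G" "\<And>n. L2 ?M (\<phi> n)" "\<And>n. L2 ?M (grad (\<phi> n))"
    using wg test_L2[OF O(1) \<phi>] by (auto simp: has_weak_gradient_def L2_on_iff)
  define p where "p n = (\<integral>x. (\<phi> n x - v x)\<^sup>2 \<partial>?M)" for n
  define q where "q n = (\<integral>x. (norm (grad (\<phi> n) x - G x))\<^sup>2 \<partial>?M)" for n
  define k where "k n x = (if x \<in> \<Omega> then flat 1 1 (s * \<phi> n x - W x) else 0)" for n x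
  define h where "h n x = (if x \<in> \<Omega> then flat [:1/4,1/2,1/2:] 2 (s * \<phi> n x - W x) else 0)" for n x
  have s\<phi>: "(\<lambda>x. s * \<phi> n x) \<in> ?T" for n by (intro test_cmult \<phi>)
  have kT: "k n \<in> ?T" and hT: "h n \<in> ?T" for n
    unfolding k_def h_def using W by (intro cut_test O s\<phi>; simp)+
  define d where "d n x = s *\<^sub>R grad (\<phi> n) x - grad W x" for n x
  define \<kappa> where "\<kappa> n x = flat [:0,0,1:] 1 (s * \<phi> n x - W x)" for n x
  have gs: "grad (\<lambda>x. s * \<phi> n x) x = s *\<^sub>R grad (\<phi> n) x" for n x
    by (rule grad_cmult) (rule test_smooth[OF \<phi>])
  have gk: "grad (k n) x = \<kappa> n x *\<^sub>R d n x" if "x \<in> \<Omega>" for n x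
    unfolding k_def \<kappa>_def d_def
    using cut_test(2)[OF O(1) s\<phi> W(1,2), of 1 x 1 n] that by (simp add: gs pderiv_1)
  have gh: "grad (h n) x = (\<kappa> n x)\<^sup>2 *\<^sub>R d n x" if "x \<in> \<Omega>" for n x
  proof -
    have "flat ([:0,0,1:] * (smult 2 [:1/4,1/2,1/2:] - pderiv [:1/4,1/2,1/2:])) 2 t = (flat [:0,0,1:] 1 t)\<^sup>2" for t
      unfolding flat_def
      by (simp add: pderiv_pCons power2_eq_square exp_add[symmetric] algebra_simps)
    with cut_test(2)[OF O(1) s\<phi> W(1,2), of 2 x "[:1/4,1/2,1/2:]" n] that
    show ?thesis unfolding h_def \<kappa>_def d_def by (simp add: gs)
  qed
  have h0: "h n x \<ge> 0" for n x unfolding h_def flat_def by simp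
  have \<kappa>: "0 \<le> \<kappa> n x" "\<kappa> n x \<le> 1" for n x unfolding \<kappa>_def by (rule flat_sq_le_one)+
  have sp: "x \<in> space ?M \<longleftrightarrow> x \<in> \<Omega>" for x by (simp add: space_restrict_space)
  have s1: "s\<^sup>2 = 1" using s by auto
  \<comment> \<open>\<open>d n\<close> splits into \<open>s (grad (\<phi> n) - G)\<close> and
    \<open>s G - grad W\<close>. Paired with \<open>(\<kappa> n)^2\<close>, the second part
    contributes at most 0, by the weak equation and \<open>laplacian W \<le> -1\<close>; the first
    is an approximation error measured by \<open>q n\<close>.\<close>
  have D: "(\<integral>x. (norm (grad (k n) x))\<^sup>2 \<partial>?M) \<le> q n" for n
  proof -
    have i1: "integrable ?M (\<lambda>x. G x \<bullet> grad (h n) x)"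
    proof (rule Bochner_Integration.integrable_bound[OF L2_integrable_mult[OF L2(2) test_L2(2)[OF O(1) hT[of n]]]])
      show "(\<lambda>x. G x \<bullet> grad (h n) x) \<in> borel_measurable ?M"
        using L2(2) test_L2(2)[OF O(1) hT] by (intro borel_measurable_inner L2D)
    qed (auto simp: abs_mult Cauchy_Schwarz_ineq2)
    have i2: "integrable ?M (\<lambda>x. grad W x \<bullet> grad (h n) x)"
      using W(1) test_smooth[OF hT]
      by (intro integrable_on_test_support(1)[OF O(1) hT[of n]])
         (auto intro!: continuous_intros continuous_grad simp: test_grad_zero[OF hT])
    have i3: "integrable ?M (h n)" by (rule test_L2(3)[OF O(1) hT])
    have i4: "integrable ?M (\<lambda>x. (norm (grad (k n) x))\<^sup>2)" by (rule L2D(2)[OF test_L2(2)[OF O(1) kT]])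
    have i5: "integrable ?M (\<lambda>x. (norm (grad (\<phi> n) x - G x))\<^sup>2)"
      by (rule L2D(2)[OF L2_diff[OF L2(4) L2(2)]])
    have i6: "integrable ?M (\<lambda>x. h n x * laplacian W x)"
      by (intro integrable_on_test_support(1)[OF O(1) hT[of n]]
            smooth_continuous[OF smooth_mult[OF test_smooth[OF hT] smooth_laplacian[OF W(1)]]])
         (simp add: supp_zero)
    have a0: "(\<integral>x. h n x \<partial>?M) \<ge> 0" using h0 by simp
    \<comment> \<open>For \<open>s = -1\<close> the left side is nonpositive because
      \<open>h n \<ge> 0\<close>; the same supersolution thus also bounds \<open>v\<close> from
      below.\<close>
    have "s * (\<integral>x. G x \<bullet> grad (h n) x \<partial>?M) \<le> (\<integral>x. h n x \<partial>?M)"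
      unfolding G[OF hT] using s a0 by auto
    also have "\<dots> \<le> (\<integral>x. - (h n x * laplacian W x) \<partial>?M)"
    proof (rule integral_mono)
      fix x assume "x \<in> space ?M"
      then have "laplacian W x \<le> -1" using W(3) sp by blast
      then show "h n x \<le> - (h n x * laplacian W x)"
        using mult_left_mono[OF _ h0[of n x], of "laplacian W x" "-1"] by simp
    qed (use i3 i6 in auto)
    also have "\<dots> = (\<integral>x. grad W x \<bullet> grad (h n) x \<partial>?M)"
      using integral_grad_grad[OF O(1) W(1) hT] by simp
    finally have le0: "(\<integral>x. s * (G x \<bullet> grad (h n) x) - grad W x \<bullet> grad (h n) x \<partial>?M) \<le> 0"
      using i1 i2 by simp
    have "(\<integral>x. (norm (grad (k n) x))\<^sup>2 \<partial>?M) \<le>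
       (\<integral>x. (1/2) * (norm (grad (k n) x))\<^sup>2 + (1/2) * (norm (grad (\<phi> n) x - G x))\<^sup>2 
          + (s * (G x \<bullet> grad (h n) x) - grad W x \<bullet> grad (h n) x) \<partial>?M)"
    proof (rule integral_mono)
      fix x assume "x \<in> space ?M"
      then have x: "x \<in> \<Omega>" using sp by blast
      let ?e = "grad (\<phi> n) x - G x"
      have "s * (G x \<bullet> grad (h n) x) - grad W x \<bullet> grad (h n) x
          = (norm (grad (k n) x))\<^sup>2 - s * (\<kappa> n x)\<^sup>2 * (?e \<bullet> d n x)"
      proof -
        have "(norm (grad (k n) x))\<^sup>2 = (\<kappa> n x)\<^sup>2 * (d n x \<bullet> d n x)"
          unfolding gk[OF x] by (simp add: power_mult_distrib power2_norm_eq_inner)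
        moreover have "d n x \<bullet> d n x = s * (?e \<bullet> d n x) + s * (G x \<bullet> d n x) - grad W x \<bullet> d n x"
          by (subst (1) d_def) (simp add: inner_diff_left algebra_simps)
        ultimately show ?thesis unfolding gh[OF x] by (simp add: algebra_simps)
      qed
      moreover have "s * (\<kappa> n x)\<^sup>2 * (?e \<bullet> d n x) \<le> (1/2) * (norm ?e)\<^sup>2 + (1/2) * (norm (grad (k n) x))\<^sup>2"
      proof -
        have "s * (\<kappa> n x)\<^sup>2 * (?e \<bullet> d n x) = (s *\<^sub>R ?e) \<bullet> ((\<kappa> n x)\<^sup>2 *\<^sub>R d n x)" by simp
        also have "\<dots> \<le> norm (s *\<^sub>R ?e) * norm ((\<kappa> n x)\<^sup>2 *\<^sub>R d n x)" by (rule norm_cauchy_schwarz)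
        also have "\<dots> \<le> norm ?e * norm (grad (k n) x)"
        proof (rule mult_mono)
          show "norm (s *\<^sub>R ?e) \<le> norm ?e" using s by auto
          \<comment> \<open>Since \<open>0 \<le> \<kappa> \<le> 1\<close>, the factor
            \<open>\<kappa>^2\<close> in the gradient of \<open>h n\<close> may be weakened to the
            \<open>\<kappa>\<close> in the gradient of \<open>k n\<close>, and Young's inequality
            can absorb the error.\<close>
          have "(\<kappa> n x)\<^sup>2 \<le> \<kappa> n x" using \<kappa>[of n x] by (simp add: power2_eq_square mult_left_le)
          then show "norm ((\<kappa> n x)\<^sup>2 *\<^sub>R d n x) \<le> norm (grad (k n) x)"
            unfolding gk[OF x] using \<kappa>(1)[of n x] by (simp add: mult_right_mono)
        qed auto
        also have "\<dots> \<le> (1/2) * (norm ?e)\<^sup>2 + (1/2) * (norm (grad (k n) x))\<^sup>2"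
          using sum_squares_bound[of "norm ?e" "norm (grad (k n) x)"] by simp
        finally show ?thesis .
      qed
      ultimately show "(norm (grad (k n) x))\<^sup>2 \<le> (1/2) * (norm (grad (k n) x))\<^sup>2 + (1/2) * (norm ?e)\<^sup>2 
          + (s * (G x \<bullet> grad (h n) x) - grad W x \<bullet> grad (h n) x)" by linarith
    qed (use i1 i2 i4 i5 in auto)
    also have "\<dots> = (1/2) * (\<integral>x. (norm (grad (k n) x))\<^sup>2 \<partial>?M) + (1/2) * q n
       + (\<integral>x. s * (G x \<bullet> grad (h n) x) - grad W x \<bullet> grad (h n) x \<partial>?M)"
      unfolding q_def using i1 i2 i4 i5 by simp
    finally show ?thesis using le0 by simp
  qed
  define K where "K x = flat 1 1 (s * v x - W x)" for x
  have contF: "continuous_on UNIV (flat 1 1)"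
    using DERIV_isCont[OF flat_deriv[of 1 1]] by (simp add: continuous_on_eq_continuous_at)
  have Wm: "W \<in> borel_measurable ?M"
    using O(1) W(1) by (auto intro!: continuous_imp_measurable_on_sets_lebesgue smooth_continuous)
  have mK: "K \<in> borel_measurable ?M"
    unfolding K_def
    by (rule borel_measurable_continuous_on[OF contF])
       (intro borel_measurable_diff borel_measurable_times L2D(1)[OF L2(1)] Wm borel_measurable_const)
  \<comment> \<open>The Lipschitz constant 1 of \<open>exp (-1/t)\<close> carries the estimate from
    \<open>\<phi> n\<close> over to \<open>v\<close>.\<close>
  have bd: "(K x)\<^sup>2 \<le> 2 * (k n x)\<^sup>2 + 2 * (\<phi> n x - v x)\<^sup>2" if "x \<in> \<Omega>" for n x
  proof -
    have "\<bar>K x - k n x\<bar> \<le> \<bar>(s * v x - W x) - (s * \<phi> n x - W x)\<bar>"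
      unfolding K_def k_def if_P[OF that] by (rule flat_lipschitz)
    also have "\<dots> = \<bar>\<phi> n x - v x\<bar>" using s by auto
    finally have "(K x - k n x)\<^sup>2 \<le> (\<phi> n x - v x)\<^sup>2" by (simp add: abs_le_square_iff)
    with norm_add_sq_le[of "k n x" "K x - k n x"] show ?thesis by simp
  qed
  have iB: "integrable ?M (\<lambda>x. 2 * (k n x)\<^sup>2 + 2 * (\<phi> n x - v x)\<^sup>2)" for n
    using L2D(2)[OF test_L2(1)[OF O(1) kT]] L2D(2)[OF L2_diff[OF L2(3) L2(1)]] by simp
  have iK: "integrable ?M (\<lambda>x. (K x)\<^sup>2)"
  proof (rule Bochner_Integration.integrable_bound[OF iB[of 0]])
    show "(\<lambda>x. (K x)\<^sup>2) \<in> borel_measurable ?M" using mK by simp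
    show "AE x in ?M. norm ((K x)\<^sup>2) \<le> norm (2 * (k 0 x)\<^sup>2 + 2 * (\<phi> 0 x - v x)\<^sup>2)"
      using bd by (intro AE_I2) (simp add: sp)
  qed
  have Kle: "(\<integral>x. (K x)\<^sup>2 \<partial>?M) \<le> (8 * R\<^sup>2 + 2) * (p n + q n)" for n
  proof -
    have "(\<integral>x. (K x)\<^sup>2 \<partial>?M) \<le> (\<integral>x. 2 * (k n x)\<^sup>2 + 2 * (\<phi> n x - v x)\<^sup>2 \<partial>?M)"
      using iK iB bd by (intro integral_mono) (auto simp: sp)
    also have "\<dots> = 2 * (\<integral>x. (k n x)\<^sup>2 \<partial>?M) + 2 * p n"
      unfolding p_def
      using L2D(2)[OF test_L2(1)[OF O(1) kT]] L2D(2)[OF L2_diff[OF L2(3) L2(1)]] by simp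
    also have "(\<integral>x. (k n x)\<^sup>2 \<partial>?M) \<le> 4 * R\<^sup>2 * q n"
      using order_trans[OF poincare[OF O(1) kT R(2)] mult_left_mono[OF D]] by simp
    finally have "(\<integral>x. (K x)\<^sup>2 \<partial>?M) \<le> 8 * R\<^sup>2 * q n + 2 * p n" by simp
    moreover have "p n \<ge> 0" "q n \<ge> 0" unfolding p_def q_def by simp_all
    moreover have "8 * R\<^sup>2 * q n + 2 * p n \<le> (8 * R\<^sup>2 + 2) * (p n + q n)"
    proof -
      have "0 \<le> 8 * R\<^sup>2 * p n + 2 * q n" using \<open>p n \<ge> 0\<close> \<open>q n \<ge> 0\<close> by simp
      then show ?thesis by (simp add: distrib_left distrib_right)
    qed
    ultimately show ?thesis by linarith
  qed
  have "(\<integral>x. (K x)\<^sup>2 \<partial>?M) \<le> 0"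
  proof (rule LIMSEQ_le_const)
    show "(\<lambda>n. (8 * R\<^sup>2 + 2) * (p n + q n)) \<longlonglongrightarrow> 0"
      using lim unfolding p_def q_def by (intro tendsto_mult_right_zero)
  qed (use Kle in auto)
  then have "(\<integral>x. (K x)\<^sup>2 \<partial>?M) = 0" by (intro antisym) auto
  then have "AE x in ?M. (K x)\<^sup>2 = 0"
    using iK by (subst (asm) integral_nonneg_eq_0_iff_AE) auto
  \<comment> \<open>\<open>exp (-1/t)\<close> is positive for \<open>t > 0\<close>, so
    \<open>K x = 0\<close> forces \<open>s * v x - W x \<le> 0\<close>.\<close>
  then show ?thesis
    by eventually_elim (auto simp: K_def flat_def split: if_splits)
qed

text \<open>The given \<open>\<phi>\<close> makes the set of quotients non-empty and 0 bounds it
  below; both facts are required before the real \<open>Inf\<close> can be estimated.\<close>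

lemma dirichlet_bottom_bounds:
  assumes "open \<Omega>" "\<phi> \<in> test_functions \<Omega>" "(\<integral>x. (\<phi> x)\<^sup>2 \<partial>lebesgue_on \<Omega>) > 0"
  shows "0 \<le> dirichlet_bottom \<Omega>"
    and "dirichlet_bottom \<Omega> \<le> (\<integral>x. (norm (grad \<phi> x))\<^sup>2 \<partial>lebesgue_on \<Omega>) / (\<integral>x. (\<phi> x)\<^sup>2 \<partial>lebesgue_on \<Omega>)"
proof -
  let ?M = "lebesgue_on \<Omega>"
  let ?S = "{(\<integral>x. (norm (G x))\<^sup>2 \<partial>?M) / (\<integral>x. (\<phi> x)\<^sup>2 \<partial>?M) | \<phi> G.
            \<phi> \<in> H01 \<Omega> \<and> has_weak_gradient \<Omega> \<phi> G \<and> \<not> (AE x in ?M. \<phi> x = 0)}"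
  have "\<not> (AE x in ?M. \<phi> x = 0)"
  proof
    assume "AE x in ?M. \<phi> x = 0"
    then have "AE x in ?M. (\<phi> x)\<^sup>2 = 0" by eventually_elim simp
    then have "(\<integral>x. (\<phi> x)\<^sup>2 \<partial>?M) = 0" by (rule integral_eq_zero_AE)
    with assms(3) show False by simp
  qed
  then have mem: "(\<integral>x. (norm (grad \<phi> x))\<^sup>2 \<partial>?M) / (\<integral>x. (\<phi> x)\<^sup>2 \<partial>?M) \<in> ?S"
    using test_H01[OF assms(1,2)] test_has_weak_gradient[OF assms(1,2)] by blast
  have nonneg: "0 \<le> y" if "y \<in> ?S" for y using that by auto
  show "0 \<le> dirichlet_bottom \<Omega>"
    unfolding dirichlet_bottom_def using mem nonneg by (intro cInf_greatest) blast+
  show "dirichlet_bottom \<Omega> \<le> (\<integral>x. (norm (grad \<phi> x))\<^sup>2 \<partial>?M) / (\<integral>x. (\<phi> x)\<^sup>2 \<partial>?M)"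
    unfolding dirichlet_bottom_def using mem nonneg by (intro cInf_lower) (auto simp: bdd_below_def)
qed

text \<open>Comparison with both signs bounds the torsion function in absolute value by
  \<open>W \<le> A\<close>, while \<open>\<phi>\<close> bounds the spectral bottom by
  \<open>\<Lambda>\<close>. Nonnegativity of the bottom allows the two bounds to be
  multiplied.\<close>

lemma torsion_times_bottom_le:
  fixes \<Omega> :: "'a::euclidean_space set"
  assumes O: "open \<Omega>" "bounded \<Omega>"
    and W: "smooth W" "\<And>x. x \<in> \<Omega> \<Longrightarrow> W x \<ge> 0" "\<And>x. x \<in> \<Omega> \<Longrightarrow> laplacian W x \<le> -1"
    and A: "\<And>x. x \<in> \<Omega> \<Longrightarrow> W x \<le> A" "A \<ge> 0"
    and \<phi>: "\<phi> \<in> test_functions \<Omega>" "(\<integral>x. (\<phi> x)\<^sup>2 \<partial>lebesgue_on \<Omega>) > 0"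
      "(\<integral>x. (norm (grad \<phi> x))\<^sup>2 \<partial>lebesgue_on \<Omega>) \<le> \<Lambda> * (\<integral>x. (\<phi> x)\<^sup>2 \<partial>lebesgue_on \<Omega>)"
  shows "Linf_norm \<Omega> (torsion_function \<Omega>) * ereal (dirichlet_bottom \<Omega>) \<le> ereal (A * \<Lambda>)"
proof -
  let ?M = "lebesgue_on \<Omega>" and ?v = "torsion_function \<Omega>"
  have v: "is_torsion_function \<Omega> ?v"
    unfolding torsion_function_def by (rule someI_ex[OF torsion_function_exists[OF O]])
  have mv: "?v \<in> borel_measurable ?M"
    using v unfolding is_torsion_function_def has_weak_gradient_def L2_on_def by blast
  have comp: "AE x in ?M. s * ?v x \<le> W x" if "s = 1 \<or> s = -1" for s
    by (rule torsion_comparison[OF O v W that])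
  have "AE x in ?M. ereal \<bar>?v x\<bar> \<le> ereal A"
    using comp[of 1, simplified] comp[of "-1", simplified] AE_space[of ?M]
  proof eventually_elim
    case (elim x)
    then show ?case using A(1)[of x] by (auto simp: space_restrict_space)
  qed
  then have "Linf_norm \<Omega> ?v \<le> ereal A"
    unfolding Linf_norm_def using mv by (intro esssup_I) auto
  then have "Linf_norm \<Omega> ?v * ereal (dirichlet_bottom \<Omega>) \<le> ereal A * ereal (dirichlet_bottom \<Omega>)"
    using dirichlet_bottom_bounds(1)[OF O(1) \<phi>(1,2)] by (intro ereal_mult_right_mono) auto
  also have "\<dots> \<le> ereal (A * \<Lambda>)"
  proof -
    have "dirichlet_bottom \<Omega> \<le> \<Lambda>"
      using dirichlet_bottom_bounds(2)[OF O(1) \<phi>(1,2)] \<phi>(2,3)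
      by (meson order_trans pos_divide_le_eq)
    then show ?thesis using A(2) by (simp add: mult_left_mono)
  qed
  finally show ?thesis .
qed

section \<open>Rayleigh quotient of a truncated supersolution\<close>

lemma lebesgue_on_lborel_le:
  fixes h :: "'a::euclidean_space \<Rightarrow> real"
  assumes "open \<Omega>" "integrable lborel h"
  shows "integrable (lebesgue_on \<Omega>) h"
    and "(\<And>x. h x \<ge> 0) \<Longrightarrow> integral\<^sup>L (lebesgue_on \<Omega>) h \<le> integral\<^sup>L lborel h"
proof -
  have O: "\<Omega> \<inter> space lebesgue \<in> sets lebesgue" using assms(1) by simp
  have O': "\<Omega> \<in> sets lborel" using assms(1) by simp
  have i: "integrable lborel (\<lambda>x. indicator \<Omega> x *\<^sub>R h x)" by (rule integrable_mult_indicator[OF O' assms(2)])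
  have m: "(\<lambda>x. indicator \<Omega> x *\<^sub>R h x) \<in> borel_measurable lborel" using i by (rule borel_measurable_integrable)
  show "integrable (lebesgue_on \<Omega>) h"
    by (subst integrable_restrict_space[OF O], subst integrable_completion[OF m], rule i)
  assume "\<And>x. h x \<ge> 0"
  then show "integral\<^sup>L (lebesgue_on \<Omega>) h \<le> integral\<^sup>L lborel h"
    by (subst integral_restrict_space[OF O], subst integral_completion[OF m])
       (intro integral_mono i assms, auto simp: indicator_def)
qed

text \<open>The convex function \<open>F\<close> of the overview: it stays within 1 of the positive
  part of \<open>t\<close> and has slope between 0 and 1.\<close>

definition ramp :: "real \<Rightarrow> real" where "ramp t = t * flat 1 1 t"

definition ramp' :: "real \<Rightarrow> real" where "ramp' t = flat 1 1 t + t * flat [:0,0,1:] 1 t"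

lemma flat_1_deriv: "(flat 1 1 has_real_derivative flat [:0,0,1:] 1 t) (at t)"
  using flat_deriv[of 1 1 t] by (simp add: pderiv_1)

lemma ramp_deriv: "(ramp has_real_derivative ramp' t) (at t)"
  unfolding ramp_def[abs_def] ramp'_def
  by (rule DERIV_cong[OF DERIV_mult[OF DERIV_ident flat_1_deriv]]) simp

text \<open>The second derivative of \<open>ramp\<close> is \<open>t^-3 exp (-1/t)\<close> for
  \<open>t > 0\<close>. Its sign lets the gradient term in the Laplacian of a composition be dropped
  from lower bounds.\<close>

lemma ramp'_deriv: "(ramp' has_real_derivative flat [:0,0,0,1:] 1 t) (at t)"
proof -
  have d2: "(flat [:0,0,1:] 1 has_real_derivative flat [:0,0,0,-2,1:] 1 t) (at t)"
    using flat_deriv[of 1 "[:0,0,1:]" t] by (simp add: pderiv_pCons)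
  have "2 * flat [:0,0,1:] 1 t + t * flat [:0,0,0,-2,1:] 1 t = flat [:0,0,0,1:] 1 t"
    by (auto simp: flat_def field_simps)
  then show ?thesis
    unfolding ramp'_def[abs_def]
    by (intro DERIV_cong[OF DERIV_add[OF flat_1_deriv DERIV_mult[OF DERIV_ident d2]]]) (simp add: mult.commute)
qed

lemma flat_nonneg: "(\<And>s. s > 0 \<Longrightarrow> poly p s \<ge> 0) \<Longrightarrow> flat p c t \<ge> 0"
  unfolding flat_def by simp

lemma flat_1_bounds: "0 \<le> flat 1 1 t" "flat 1 1 t \<le> 1"
  by (auto simp: flat_def)

lemma ramp_bounds: "0 \<le> ramp t" "t \<le> 0 \<Longrightarrow> ramp t = 0" "t \<ge> 0 \<Longrightarrow> ramp t \<le> t" "t - 1 \<le> ramp t"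
proof -
  show "0 \<le> ramp t" "t \<le> 0 \<Longrightarrow> ramp t = 0" by (auto simp: ramp_def flat_def)
  show "ramp t \<le> t" if "t \<ge> 0"
    using that mult_left_mono[OF flat_1_bounds(2) that] by (simp add: ramp_def)
  show "t - 1 \<le> ramp t"
  proof (cases "t > 0")
    case True
    have "t * (1 + - 1 / t) \<le> t * exp (- 1 / t)" using True by (intro mult_left_mono exp_ge_add_one_self) simp
    moreover have "t * (1 + - 1 / t) = t - 1" using True by (simp add: field_simps)
    ultimately have "t - 1 \<le> t * exp (- 1 / t)" by linarith
    then show ?thesis using True by (simp add: ramp_def flat_def)
  qed (simp add: ramp_def flat_def)
qed

lemma ramp'_bounds: "0 \<le> ramp' t" "ramp' t \<le> 1"
proof -
  have *: "ramp' t = (1 + 1 / t) * exp (- 1 / t)" if "t > 0"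
    using that by (simp add: ramp'_def flat_def algebra_simps power2_eq_square)
  show "0 \<le> ramp' t" by (cases "t > 0") (simp_all add: * , simp add: ramp'_def flat_def)
  show "ramp' t \<le> 1"
  proof (cases "t > 0")
    case True
    have "(1 + 1 / t) * exp (- 1 / t) \<le> exp (1 / t) * exp (- 1 / t)"
      by (intro mult_right_mono exp_ge_add_one_self) simp
    then show ?thesis using * True by (simp add: exp_add[symmetric])
  qed (simp add: ramp'_def flat_def)
qed

lemma smooth_ramp: "smooth f \<Longrightarrow> smooth (\<lambda>x. ramp (f x))"
  unfolding ramp_def by (intro smooth_mult smooth_flat) auto

lemma smooth_norm_sq: "smooth (\<lambda>x::'a::euclidean_space. (norm x)\<^sup>2)"
proof -
  have "(\<lambda>x::'a. (norm x)\<^sup>2) = (\<lambda>x. \<Sum>b\<in>Basis. (x \<bullet> b)\<^sup>2)"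
    by (rule ext) (subst power2_norm_eq_inner, subst euclidean_inner, simp add: power2_eq_square)
  then show ?thesis by (simp only:) (intro smooth_sum smooth_power smooth_inner)
qed

lemma grad_norm_square: "grad (\<lambda>x. (norm x)\<^sup>2) x = 2 *\<^sub>R x"
  unfolding power2_norm_eq_inner
  by (rule grad_GDERIV, unfold gderiv_def) (auto intro!: derivative_eq_intros simp: inner_commute)

section \<open>Radial cutoffs: bounds, energy identity and mass\<close>

definition cutoff :: "real \<Rightarrow> 'a::euclidean_space \<Rightarrow> real" where
  "cutoff N x = flat 1 1 (1 - (norm x)\<^sup>2 / N\<^sup>2)"

lemma smooth_cutoff: "smooth (cutoff N)"
proof -
  have "smooth (\<lambda>x::'a. 1 - (norm x)\<^sup>2 * (1 / N\<^sup>2))" by (intro smooth_diff smooth_mult smooth_const smooth_norm_sq)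
  then have "smooth (\<lambda>x::'a. flat 1 1 (1 - (norm x)\<^sup>2 * (1 / N\<^sup>2)))" by (intro smooth_flat) auto
  then show ?thesis by (simp add: cutoff_def[abs_def])
qed

lemma cutoff_bounds:
  assumes "N > 0"
  shows "0 \<le> cutoff N x" "cutoff N x \<le> 1" "norm x \<ge> N \<Longrightarrow> cutoff N x = 0"
    "norm x \<le> N / 2 \<Longrightarrow> cutoff N x \<ge> 1 / 9"
proof -
  show "0 \<le> cutoff N x" "cutoff N x \<le> 1" unfolding cutoff_def by (rule flat_1_bounds)+
  show "cutoff N x = 0" if "norm x \<ge> N"
  proof -
    have "N\<^sup>2 \<le> (norm x)\<^sup>2" using that assms by (intro power_mono) auto
    then have "1 - (norm x)\<^sup>2 / N\<^sup>2 \<le> 0" using assms by simp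
    then show ?thesis by (simp add: cutoff_def flat_def)
  qed
  show "cutoff N x \<ge> 1 / 9" if "norm x \<le> N / 2"
  proof -
    have "(norm x)\<^sup>2 \<le> (N / 2)\<^sup>2" using that by (intro power_mono) auto
    then have t: "1 - (norm x)\<^sup>2 / N\<^sup>2 \<ge> 1 / 2" (is "?t \<ge> _")
    proof -
      have "(norm x)\<^sup>2 / N\<^sup>2 \<le> (N / 2)\<^sup>2 / N\<^sup>2"
        using \<open>(norm x)\<^sup>2 \<le> (N / 2)\<^sup>2\<close> by (rule divide_right_mono) simp
      also have "\<dots> = 1 / 4" using assms by (simp add: power2_eq_square)
      finally show ?thesis by linarith
    qed
    \<comment> \<open>On the half ball the argument of \<open>flat 1 1\<close> is at least 1/2, so
      the value is at least \<open>exp (-2)\<close>; with \<open>exp 2 \<le> 9\<close> this is the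
      1/9.\<close>
    have "exp (- 2) \<le> exp (- 1 / s)" if "s \<ge> 1 / 2" for s :: real
      using that by (simp add: field_simps)
    from this[OF t] have "exp (- 2) \<le> exp (- 1 / ?t)" .
    moreover have "exp (2::real) \<le> 9"
    proof -
      have "exp (1::real) * exp 1 \<le> 3 * 3" using exp_le by (intro mult_mono) auto
      then show ?thesis by (simp add: exp_add[symmetric])
    qed
    then have "1 / 9 \<le> exp (-2::real)" by (simp add: exp_minus field_simps)
    ultimately have "1 / 9 \<le> exp (- 1 / ?t)" by linarith
    moreover have "flat 1 1 s = exp (- 1 / s)" if "s \<ge> 1 / 2" for s :: real
      using that by (simp add: flat_def)
    ultimately show ?thesis using t unfolding cutoff_def by metis
  qed
qed

lemma cutoff_grad:
  assumes "N > 0"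
  shows "(norm (grad (cutoff N) x))\<^sup>2 \<le> 4 / N\<^sup>2 * indicator (ball 0 N) x"
proof -
  have sm: "smooth (\<lambda>x::'a. 1 - (norm x)\<^sup>2 / N\<^sup>2)"
  proof -
    have "smooth (\<lambda>x::'a. 1 - (norm x)\<^sup>2 * (1 / N\<^sup>2))" by (intro smooth_diff smooth_mult smooth_const smooth_norm_sq)
    then show ?thesis by simp
  qed
  have g: "grad (\<lambda>x::'a. 1 - (norm x)\<^sup>2 / N\<^sup>2) x = - (2 / N\<^sup>2) *\<^sub>R x"
  proof -
    have s1: "smooth (\<lambda>x::'a. (- (1 / N\<^sup>2)) * (norm x)\<^sup>2)"
      by (intro smooth_mult smooth_const smooth_norm_sq)
    have "(\<lambda>x::'a. 1 - (norm x)\<^sup>2 / N\<^sup>2) = (\<lambda>x. 1 + (- (1 / N\<^sup>2)) * (norm x)\<^sup>2)" by auto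
    then show ?thesis
      by (simp only: grad_add[OF smooth_const[of 1] s1] grad_cmult[OF smooth_norm_sq] grad_norm_square grad_const)
         simp
  qed
  have eq: "grad (cutoff N) x = flat [:0,0,1:] 1 (1 - (norm x)\<^sup>2 / N\<^sup>2) *\<^sub>R (- (2 / N\<^sup>2) *\<^sub>R x)"
    unfolding cutoff_def[abs_def] g[symmetric] by (rule grad_compose[OF sm flat_1_deriv])
  show ?thesis
  proof (cases "norm x < N")
    case True
    have "norm (grad (cutoff N) x) \<le> 1 * (2 / N\<^sup>2 * norm x)"
      unfolding eq norm_scaleR using flat_sq_le_one by (intro mult_mono) auto
    also have "\<dots> \<le> 2 / N\<^sup>2 * N" using True by (simp add: mult_left_mono divide_right_mono)
    also have "\<dots> = 2 / N" using assms by (simp add: power2_eq_square)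
    finally have "(norm (grad (cutoff N) x))\<^sup>2 \<le> (2 / N)\<^sup>2" by (intro power_mono) auto
    then show ?thesis using True by (simp add: power_divide)
  next
    case False
    then have "N\<^sup>2 \<le> (norm x)\<^sup>2" using assms by (intro power_mono) auto
    then have "1 - (norm x)\<^sup>2 / N\<^sup>2 \<le> 0" using assms by simp
    then show ?thesis unfolding eq by (simp add: flat_def)
  qed
qed

lemma supp_cutoff: "N > 0 \<Longrightarrow> supp (cutoff N) \<subseteq> cball 0 N"
  by (rule supp_minimal, simp, rule cutoff_bounds(3)) auto

text \<open>Pointwise, the squared gradient of \<open>\<eta> u\<close> is \<open>u^2\<close> times
  that of \<open>\<eta>\<close> plus the inner product of the gradients of \<open>u\<close> and
  \<open>\<eta>^2 u\<close>. The latter function is again a test function, so Green's formula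
  applies to \<open>u\<close>.\<close>

lemma cutoff_energy:
  fixes u :: "'a::euclidean_space \<Rightarrow> real"
  assumes O: "open \<Omega>" and N: "N > 0" and u: "smooth u" and \<phi>: "(\<lambda>x. cutoff N x * u x) \<in> test_functions \<Omega>"
  shows "(\<integral>x. (norm (grad (\<lambda>x. cutoff N x * u x) x))\<^sup>2 \<partial>lebesgue_on \<Omega>) =
      (\<integral>x. (u x)\<^sup>2 * (norm (grad (cutoff N) x))\<^sup>2 - (cutoff N x)\<^sup>2 * u x * laplacian u x \<partial>lebesgue_on \<Omega>)"
proof -
  let ?\<eta> = "cutoff N :: 'a \<Rightarrow> real" and ?M = "lebesgue_on \<Omega>"
  note sm = smooth_cutoff[of N, where 'a='a]
  have t2: "(\<lambda>x. ?\<eta> x * (?\<eta> x * u x)) \<in> test_functions \<Omega>" by (rule test_mult[OF \<phi> sm])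
  have bsupp: "integrable ?M h" if "continuous_on UNIV h" "\<And>x. x \<notin> supp ?\<eta> \<Longrightarrow> h x = 0" for h :: "'a \<Rightarrow> real"
  proof (rule lebesgue_on_lborel_le(1)[OF O integrable_bounded_support[OF that(1)]])
    have "{x. h x \<noteq> 0} \<subseteq> cball 0 N" using that(2) supp_cutoff[OF N] by blast
    then show "bounded {x. h x \<noteq> 0}" by (rule bounded_subset[OF bounded_cball])
  qed
  have g0: "x \<notin> supp ?\<eta> \<Longrightarrow> grad ?\<eta> x = 0" for x unfolding grad_def by (simp add: partial_deriv_zero)
  have i1: "integrable ?M (\<lambda>x. (u x)\<^sup>2 * (norm (grad ?\<eta> x))\<^sup>2)"
    by (rule bsupp, intro continuous_on_mult continuous_on_power continuous_on_norm continuous_grad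
        smooth_continuous u sm) (simp add: g0)
  have i2: "integrable ?M (\<lambda>x. (?\<eta> x)\<^sup>2 * u x * laplacian u x)"
    by (rule bsupp, intro smooth_continuous smooth_mult smooth_power smooth_laplacian u sm) (simp add: supp_zero)
  have i3: "integrable ?M (\<lambda>x. grad u x \<bullet> grad (\<lambda>x. ?\<eta> x * (?\<eta> x * u x)) x)"
    by (rule integrable_on_test_support(1)[OF O t2])
       (auto intro!: continuous_intros continuous_grad u test_smooth[OF t2] simp: test_grad_zero[OF t2])
  have pt: "(norm (grad (\<lambda>x. ?\<eta> x * u x) x))\<^sup>2 = (u x)\<^sup>2 * (norm (grad ?\<eta> x))\<^sup>2
        + grad u x \<bullet> grad (\<lambda>x. ?\<eta> x * (?\<eta> x * u x)) x" for x
  proof -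
    have eu: "smooth (\<lambda>x. ?\<eta> x * u x)" by (intro smooth_mult sm u)
    have 1: "grad (\<lambda>x. ?\<eta> x * u x) x = ?\<eta> x *\<^sub>R grad u x + u x *\<^sub>R grad ?\<eta> x"
      by (rule grad_mult[OF sm u])
    have 2: "grad (\<lambda>x. ?\<eta> x * (?\<eta> x * u x)) x = ?\<eta> x *\<^sub>R (?\<eta> x *\<^sub>R grad u x + u x *\<^sub>R grad ?\<eta> x) + (?\<eta> x * u x) *\<^sub>R grad ?\<eta> x"
      using grad_mult[OF sm eu, of x] unfolding 1 .
    have "(e *\<^sub>R a + w *\<^sub>R b) \<bullet> (e *\<^sub>R a + w *\<^sub>R b) = w\<^sup>2 * (b \<bullet> b) + a \<bullet> (e *\<^sub>R (e *\<^sub>R a + w *\<^sub>R b) + (e * w) *\<^sub>R b)"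
      for e w :: real and a b :: 'a
      by (simp only: inner_add_left inner_add_right inner_scaleR_left inner_scaleR_right 
          inner_commute[of b a] power2_eq_square) (simp only: algebra_simps)
    then show ?thesis unfolding power2_norm_eq_inner 1 2 .
  qed
  have "(\<integral>x. (norm (grad (\<lambda>x. ?\<eta> x * u x) x))\<^sup>2 \<partial>?M) = (\<integral>x. (u x)\<^sup>2 * (norm (grad ?\<eta> x))\<^sup>2 \<partial>?M) 
     + (\<integral>x. grad u x \<bullet> grad (\<lambda>x. ?\<eta> x * (?\<eta> x * u x)) x \<partial>?M)"
    unfolding pt using i1 i3 by simp
  also have "(\<integral>x. grad u x \<bullet> grad (\<lambda>x. ?\<eta> x * (?\<eta> x * u x)) x \<partial>?M) 
      = - (\<integral>x. (?\<eta> x * (?\<eta> x * u x)) * laplacian u x \<partial>?M)"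
    by (rule integral_grad_grad[OF O u t2])
  also have "\<dots> = - (\<integral>x. (?\<eta> x)\<^sup>2 * u x * laplacian u x \<partial>?M)"
    by (simp add: power2_eq_square mult.assoc)
  finally show ?thesis using i1 i2 by simp
qed

text \<open>A lower bound for the mean of \<open>cutoff^2\<close> over its ball: \<open>1/81\<close>
  bounds the square from below on the half ball, and \<open>2 ^ DIM\<close> is the ratio of the
  volumes.\<close>

definition cutoff_const :: "'a::euclidean_space itself \<Rightarrow> real" where
  "cutoff_const _ = 1 / (81 * 2 ^ DIM('a))"

lemma cutoff_mass:
  fixes N :: real
  assumes N: "N > 0"
  shows "integrable lborel (\<lambda>x::'a::euclidean_space. (cutoff N x)\<^sup>2)"
    and "cutoff_const TYPE('a) * measure lborel (ball (0::'a) N) \<le> (\<integral>x. (cutoff N (x::'a))\<^sup>2 \<partial>lborel)"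
proof -
  have fin: "emeasure lborel (ball (0::'a) r) < \<infinity>" for r by (rule emeasure_bounded_finite) simp
  have ip: "integrable lborel (\<lambda>x::'a. (cutoff N x)\<^sup>2)"
  proof (rule integrable_bounded_support)
    show "continuous_on UNIV (\<lambda>x::'a. (cutoff N x)\<^sup>2)" by (intro smooth_continuous smooth_power smooth_cutoff)
    have "{x::'a. (cutoff N x)\<^sup>2 \<noteq> 0} \<subseteq> supp (cutoff N)" using supp_zero by force
    also have "\<dots> \<subseteq> cball 0 N" by (rule supp_cutoff[OF N])
    finally show "bounded {x::'a. (cutoff N x)\<^sup>2 \<noteq> 0}" by (rule bounded_subset[OF bounded_cball])
  qed
  then show "integrable lborel (\<lambda>x::'a. (cutoff N x)\<^sup>2)" .
  have ball: "measure lborel (ball (0::'a) r) = unit_ball_vol DIM('a) * r ^ DIM('a)" if "r \<ge> 0" for r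
    using content_ball[OF that, of "0::'a"] by simp
  have "cutoff_const TYPE('a) * measure lborel (ball (0::'a) N) = (1/81) * measure lborel (ball (0::'a) (N / 2))"
    using N by (simp add: ball cutoff_const_def power_divide)
  also have "\<dots> = (\<integral>x. (1/81) * indicator (ball (0::'a) (N / 2)) x \<partial>lborel)" by simp
  also have "\<dots> \<le> (\<integral>x. (cutoff N (x::'a))\<^sup>2 \<partial>lborel)"
  proof (rule integral_mono)
    show "integrable lborel (\<lambda>x::'a. (1/81) * indicator (ball 0 (N / 2)) x :: real)"
      using fin by (intro integrable_mult_right integrable_real_indicator) auto
    fix x :: 'a
    show "(1/81) * indicator (ball 0 (N / 2)) x \<le> (cutoff N x)\<^sup>2"
    proof (cases "x \<in> ball 0 (N / 2)")
      case True
      then have "(1/9)\<^sup>2 \<le> (cutoff N x)\<^sup>2" using cutoff_bounds(4)[OF N, of x] by (intro power_mono) auto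
      with True show ?thesis by (simp add: power2_eq_square)
    qed simp
  qed (rule ip)
  finally show "cutoff_const TYPE('a) * measure lborel (ball (0::'a) N) \<le> (\<integral>x. (cutoff N (x::'a))\<^sup>2 \<partial>lborel)" .
qed

text \<open>\<open>W\<close> is a plateau between \<open>B\<close> and \<open>A\<close> except on
  the small set \<open>Z\<close>. The relative losses are \<open>\<gamma>\<close> from the gradient
  of the cutoff and \<open>\<beta>\<close> from discarding \<open>Z\<close>; the factor
  \<open>A / B^2\<close> comes from \<open>u\<close> in the numerator against \<open>u^2\<close> in
  the denominator.\<close>

lemma rayleigh_quotient_bound:
  fixes \<Omega> :: "'a::euclidean_space set"
  assumes O: "open \<Omega>" and W: "smooth W" "\<And>x. laplacian W x \<ge> -1" and N: "N > 0"
    and sub: "\<And>x. norm x \<le> N \<Longrightarrow> W x > 0 \<Longrightarrow> x \<in> \<Omega>"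
    and A: "\<And>x. x \<in> \<Omega> \<Longrightarrow> W x \<le> A"
    and B: "0 < B" "B \<le> A" and Z: "Z \<in> sets lborel" "emeasure lborel Z < \<infinity>"
    and good: "\<And>x. norm x < N \<Longrightarrow> x \<notin> Z \<Longrightarrow> W x \<ge> B + 2"
    and \<beta>: "measure lborel Z \<le> \<beta> * cutoff_const TYPE('a) * measure lborel (ball (0::'a) N)" "0 \<le> \<beta>" "\<beta> < 1"
    and \<gamma>: "4 * A / N\<^sup>2 \<le> \<gamma> * cutoff_const TYPE('a)"
  shows "\<exists>\<phi>\<in>test_functions \<Omega>. (\<integral>x. (\<phi> x)\<^sup>2 \<partial>lebesgue_on \<Omega>) > 0 \<and>
     (\<integral>x. (norm (grad \<phi> x))\<^sup>2 \<partial>lebesgue_on \<Omega>) \<le> A * (1 + \<gamma>) / (B\<^sup>2 * (1 - \<beta>)) * (\<integral>x. (\<phi> x)\<^sup>2 \<partial>lebesgue_on \<Omega>)"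
proof -
  let ?\<eta> = "cutoff N :: 'a \<Rightarrow> real" and ?M = "lebesgue_on \<Omega>"
  define c where "c = cutoff_const TYPE('a)"
  define V where "V = measure lborel (ball (0::'a) N)"
  define I where "I = (\<integral>x. (?\<eta> x)\<^sup>2 \<partial>lborel)"
  \<comment> \<open>The shift by 1 puts the closed support of \<open>\<phi>\<close> in
    \<open>W \<ge> 1\<close>, hence inside \<open>\<Omega>\<close>. Together with the loss of at
    most 1 in \<open>ramp\<close> it accounts for the 2 in \<open>good\<close>.\<close>
  define u where "u x = ramp (W x - 1)" for x
  define \<phi> where "\<phi> x = ?\<eta> x * u x" for x
  have c0: "c > 0" by (simp add: c_def cutoff_const_def)
  have V0: "V > 0" using content_ball[of N "0::'a"] N unfolding V_def by simp
  have cV: "c * V \<le> I" unfolding c_def V_def I_def by (rule cutoff_mass(2)[OF N])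
  have I0: "I > 0" using cV c0 V0 by (smt (verit) mult_pos_pos)
  have A0: "A > 0" using B by simp
  have usm: "smooth u" unfolding u_def[abs_def] by (intro smooth_ramp smooth_diff W smooth_const)
  have \<phi>sm: "smooth \<phi>" unfolding \<phi>_def[abs_def] by (intro smooth_mult smooth_cutoff usm)
  have supp: "supp \<phi> \<subseteq> cball 0 N \<inter> {x. 1 \<le> W x}"
  proof (rule supp_minimal)
    show "closed (cball 0 N \<inter> {x. 1 \<le> W x})"
      by (intro closed_Int closed_cball closed_Collect_le continuous_on_const smooth_continuous W)
    show "\<phi> x = 0" if "x \<notin> cball 0 N \<inter> {x. 1 \<le> W x}" for x
      using that cutoff_bounds(3)[OF N, of x] ramp_bounds(2)[of "W x - 1"] by (auto simp: \<phi>_def u_def)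
  qed
  have \<phi>T: "\<phi> \<in> test_functions \<Omega>"
    unfolding test_functions_iff
  proof (intro conjI \<phi>sm)
    show "bounded (supp \<phi>)" using supp by (intro bounded_subset[OF bounded_cball[of 0 N]]) auto
    show "supp \<phi> \<subseteq> \<Omega>"
    proof
      fix x assume "x \<in> supp \<phi>"
      then have "norm x \<le> N" "W x \<ge> 1" using supp by auto
      then show "x \<in> \<Omega>" using sub[of x] by simp
    qed
  qed
  have u0: "0 \<le> u x" for x unfolding u_def by (rule ramp_bounds(1))
  have uA: "u x \<le> A" if "norm x \<le> N" for x
  proof (cases "W x > 1")
    case True
    then have "x \<in> \<Omega>" using sub that by simp
    then show ?thesis using True A ramp_bounds(3)[of "W x - 1"] by (fastforce simp: u_def)
  next
    case False
    then show ?thesis using A0 by (simp add: u_def ramp_bounds(2))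
  qed
  \<comment> \<open>Convexity makes the gradient term nonnegative, and a slope in
    \<open>[0,1]\<close> preserves the lower bound \<open>-1\<close>.\<close>
  have lap: "laplacian u x \<ge> -1" for x
  proof -
    have sW: "smooth (\<lambda>x. W x - 1)" by (intro smooth_diff W smooth_const)
    have "laplacian (\<lambda>x. W x + (-1)) x = laplacian W x + laplacian (\<lambda>x. - 1) x"
      by (rule laplacian_add[OF W(1) smooth_const])
    then have l: "laplacian (\<lambda>x. W x - 1) x = laplacian W x" by (simp add: laplacian_const)
    have "laplacian u x = flat [:0,0,0,1:] 1 (W x - 1) * (norm (grad (\<lambda>x. W x - 1) x))\<^sup>2 + ramp' (W x - 1) * laplacian W x"
      unfolding u_def[abs_def] l[symmetric]
      by (rule laplacian_compose[OF sW, where g=ramp and g'=ramp', OF ramp_deriv ramp'_deriv])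
    moreover have "0 \<le> flat [:0,0,0,1:] 1 (W x - 1) * (norm (grad (\<lambda>x. W x - 1) x))\<^sup>2"
      by (intro mult_nonneg_nonneg flat_nonneg) auto
    moreover have "ramp' (W x - 1) * (-1) \<le> ramp' (W x - 1) * laplacian W x"
      using W(2) ramp'_bounds(1) by (intro mult_left_mono)
    ultimately show ?thesis using ramp'_bounds(2)[of "W x - 1"] by linarith
  qed
  have fin: "emeasure lborel (ball (0::'a) N) < \<infinity>" by (rule emeasure_bounded_finite) simp
  let ?h = "\<lambda>x. A\<^sup>2 * (4 / N\<^sup>2 * indicator (ball 0 N) x) + A * (?\<eta> x)\<^sup>2 :: real"
  have ib: "integrable lborel (\<lambda>x::'a. A\<^sup>2 * (4 / N\<^sup>2 * indicator (ball 0 N) x) :: real)"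
    using fin by (intro integrable_mult_right integrable_real_indicator) auto
  have ih: "integrable lborel ?h" using ib cutoff_mass(1)[OF N, where 'a='a] by simp
  have "(\<integral>x. (norm (grad \<phi> x))\<^sup>2 \<partial>?M) =
      (\<integral>x. (u x)\<^sup>2 * (norm (grad ?\<eta> x))\<^sup>2 - (?\<eta> x)\<^sup>2 * u x * laplacian u x \<partial>?M)"
    using cutoff_energy[OF O N usm] \<phi>T unfolding \<phi>_def[abs_def] by blast
  also have "\<dots> \<le> (\<integral>x. ?h x \<partial>?M)"
  proof (rule Bochner_Integration.integral_mono')
    show "integrable ?M ?h" by (rule lebesgue_on_lborel_le(1)[OF O ih])
    fix x :: 'a
    show "(u x)\<^sup>2 * (norm (grad ?\<eta> x))\<^sup>2 - (?\<eta> x)\<^sup>2 * u x * laplacian u x \<le> ?h x"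
    proof (cases "norm x < N")
      case True
      have "(u x)\<^sup>2 * (norm (grad ?\<eta> x))\<^sup>2 \<le> A\<^sup>2 * (4 / N\<^sup>2 * indicator (ball 0 N) x)"
        using u0 uA True by (intro mult_mono power_mono cutoff_grad N) auto
      moreover have "(?\<eta> x)\<^sup>2 * u x * (-1) \<le> (?\<eta> x)\<^sup>2 * u x * laplacian u x"
        using lap u0 by (intro mult_left_mono) auto
      moreover have "(?\<eta> x)\<^sup>2 * u x \<le> (?\<eta> x)\<^sup>2 * A" using uA True by (intro mult_left_mono) auto
      ultimately show ?thesis by (simp add: mult.commute)
    next
      case False
      then have "grad ?\<eta> x = 0" "?\<eta> x = 0" using cutoff_grad[OF N, of x] cutoff_bounds(3)[OF N, of x] by auto
      then show ?thesis by simp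
    qed
  qed (use A0 in auto)
  also have "\<dots> \<le> integral\<^sup>L lborel ?h" using A0 by (intro lebesgue_on_lborel_le(2)[OF O ih]) auto
  also have "\<dots> = A\<^sup>2 * (4 / N\<^sup>2) * V + A * I"
    unfolding I_def V_def using ib cutoff_mass(1)[OF N, where 'a='a] by simp
  also have "A\<^sup>2 * (4 / N\<^sup>2) * V = A * (4 * A / N\<^sup>2) * V" by (simp add: power2_eq_square)
  also have "\<dots> \<le> A * (\<gamma> * c) * V" using \<gamma> A0 V0 unfolding c_def by (intro mult_right_mono mult_left_mono) auto
  also have "\<dots> = A * \<gamma> * (c * V)" by simp
  also have "\<dots> \<le> A * \<gamma> * I"
  proof (rule mult_left_mono[OF cV])
    have "0 \<le> \<gamma> * c" using \<gamma> A0 N unfolding c_def by (intro order_trans[OF _ \<gamma>]) auto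
    then show "0 \<le> A * \<gamma>" using c0 A0 by (simp add: zero_le_mult_iff)
  qed
  finally have num: "(\<integral>x. (norm (grad \<phi> x))\<^sup>2 \<partial>?M) \<le> A * (1 + \<gamma>) * I" by (simp add: algebra_simps)
  have g0: "0 \<le> 1 + \<gamma>"
  proof -
    have "0 \<le> \<gamma> * c" using \<gamma> A0 N unfolding c_def by (intro order_trans[OF _ \<gamma>]) auto
    then show ?thesis using c0 by (simp add: zero_le_mult_iff)
  qed
  have i\<phi>: "integrable lborel (\<lambda>x. (\<phi> x)\<^sup>2)"
    by (rule integrable_test_support[OF \<phi>T smooth_continuous[OF smooth_power[OF \<phi>sm]]]) (simp add: supp_zero)
  have iZ: "integrable lborel (\<lambda>x. indicator Z x :: real)" using Z by (intro integrable_real_indicator) auto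
  \<comment> \<open>On \<open>Z\<close> the integrand below is nonpositive because
    \<open>\<eta>^2 \<le> 1\<close>; so \<open>Z\<close> costs only its measure, whatever
    \<open>\<phi>\<close> does there.\<close>
  have "B\<^sup>2 * (I - \<beta> * (c * V)) \<le> B\<^sup>2 * (I - measure lborel Z)"
    using \<beta>(1) unfolding c_def V_def by (intro mult_left_mono) auto
  also have "\<dots> = (\<integral>x. B\<^sup>2 * ((?\<eta> x)\<^sup>2 - indicator Z x) \<partial>lborel)"
    unfolding I_def using iZ cutoff_mass(1)[OF N, where 'a='a] by simp
  also have "\<dots> \<le> (\<integral>x. (\<phi> x)\<^sup>2 \<partial>lborel)"
  proof (rule integral_mono)
    show "integrable lborel (\<lambda>x. B\<^sup>2 * ((?\<eta> x)\<^sup>2 - indicator Z x))"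
      using iZ cutoff_mass(1)[OF N, where 'a='a] by simp
    fix x :: 'a
    have e1: "(?\<eta> x)\<^sup>2 \<le> 1" using cutoff_bounds(1,2)[OF N, of x] by (simp add: power_le_one)
    consider "x \<in> Z" | "x \<notin> Z" "norm x < N" | "x \<notin> Z" "norm x \<ge> N" by linarith
    then show "B\<^sup>2 * ((?\<eta> x)\<^sup>2 - indicator Z x) \<le> (\<phi> x)\<^sup>2"
    proof cases
      case 1
      then have "B\<^sup>2 * ((?\<eta> x)\<^sup>2 - indicator Z x) \<le> 0" using e1 by (intro mult_nonneg_nonpos) auto
      then show ?thesis by (smt (verit) zero_le_power2)
    next
      case 2
      have "B \<le> u x" using good[OF 2(2,1)] ramp_bounds(4)[of "W x - 1"] unfolding u_def by linarith
      then have "B\<^sup>2 \<le> (u x)\<^sup>2" using B by (intro power_mono) auto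
      then have "B\<^sup>2 * (?\<eta> x)\<^sup>2 \<le> (u x)\<^sup>2 * (?\<eta> x)\<^sup>2" by (rule mult_right_mono) simp
      then show ?thesis using 2 by (simp add: \<phi>_def power_mult_distrib mult.commute)
    next
      case 3
      then show ?thesis using cutoff_bounds(3)[OF N, of x] by simp
    qed
  qed (rule i\<phi>)
  also have "\<dots> = (\<integral>x. (\<phi> x)\<^sup>2 \<partial>?M)"
    by (rule lebesgue_on_lborel(1)[symmetric, OF smooth_continuous[OF smooth_power[OF \<phi>sm]] O])
       (simp add: test_zero[OF \<phi>T])
  finally have "B\<^sup>2 * (I - \<beta> * (c * V)) \<le> (\<integral>x. (\<phi> x)\<^sup>2 \<partial>?M)" .
  moreover have "B\<^sup>2 * (I * (1 - \<beta>)) \<le> B\<^sup>2 * (I - \<beta> * (c * V))"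
    using mult_left_mono[OF cV \<beta>(2)] by (intro mult_left_mono) (auto simp: algebra_simps)
  ultimately have den: "B\<^sup>2 * (1 - \<beta>) * I \<le> (\<integral>x. (\<phi> x)\<^sup>2 \<partial>?M)" by (simp add: mult_ac)
  have k: "B\<^sup>2 * (1 - \<beta>) > 0" using B \<beta> by simp
  have "(\<integral>x. (\<phi> x)\<^sup>2 \<partial>?M) > 0" using den mult_pos_pos[OF k I0] by linarith
  moreover have "(\<integral>x. (norm (grad \<phi> x))\<^sup>2 \<partial>?M) \<le> A * (1 + \<gamma>) / (B\<^sup>2 * (1 - \<beta>)) * (\<integral>x. (\<phi> x)\<^sup>2 \<partial>?M)"
  proof -
    have "A * (1 + \<gamma>) * I = A * (1 + \<gamma>) / (B\<^sup>2 * (1 - \<beta>)) * (B\<^sup>2 * (1 - \<beta>) * I)" using B \<beta> by simp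
    also have "\<dots> \<le> A * (1 + \<gamma>) / (B\<^sup>2 * (1 - \<beta>)) * (\<integral>x. (\<phi> x)\<^sup>2 \<partial>?M)"
      using den k g0 A0 by (intro mult_left_mono) auto
    finally show ?thesis using num by linarith
  qed
  ultimately show ?thesis using \<phi>T by blast
qed

section \<open>A periodically perforated domain\<close>

text \<open>For \<open>a = 0\<close> this is \<open>2 |sin ((\<theta> + i t) / 2)|^2\<close> with
  \<open>\<theta> = pi (x \<bullet> e1)\<close> and \<open>t = pi (x \<bullet> e2 - s)\<close>. Its
  logarithm is therefore the periodic planar Green function, up to normalisation, of one row of
  poles.\<close>

definition hole_row :: "'a::euclidean_space \<Rightarrow> 'a \<Rightarrow> real \<Rightarrow> real \<Rightarrow> 'a \<Rightarrow> real" where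
  "hole_row e1 e2 a s x = cosh (pi * (x \<bullet> e2 - s)) - cos (pi * (x \<bullet> e1)) + a"

lemma hole_row_pos: "a > 0 \<Longrightarrow> hole_row e1 e2 a s x > 0"
  unfolding hole_row_def using cosh_real_ge_1[of "pi * (x \<bullet> e2 - s)"] cos_le_one[of "pi * (x \<bullet> e1)"] by linarith

lemma smooth_hole_row: "smooth (hole_row e1 e2 a s)"
  unfolding hole_row_def[abs_def]
  by (intro smooth_add smooth_diff smooth_cosh smooth_cos smooth_mult smooth_inner smooth_const)

text \<open>The numerator is proportional to \<open>a\<close> because \<open>(cosh t + cos \<theta>)
  (cosh t - cos \<theta>) = (sinh t)^2 + (sin \<theta>)^2\<close>, the squared gradient up to
  \<open>pi^2\<close>.\<close>

lemma laplacian_ln_hole_row: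
  assumes e: "e1 \<in> Basis" "e2 \<in> Basis" "e1 \<noteq> e2" and a: "a > 0"
  shows "laplacian (\<lambda>x. ln (hole_row e1 e2 a s x)) x =
    pi\<^sup>2 * (a * (cosh (pi * (x \<bullet> e2 - s)) + cos (pi * (x \<bullet> e1))) / (hole_row e1 e2 a s x)\<^sup>2)"
proof -
  define t where "t = pi * (x \<bullet> e2 - s)"
  define \<theta> where "\<theta> = pi * (x \<bullet> e1)"
  define r where "r = hole_row e1 e2 a s x"
  have r: "r > 0" unfolding r_def using a by (rule hole_row_pos)
  have d1: "((\<lambda>y. cosh (pi * (y - s))) has_real_derivative pi * sinh (pi * (y - s))) (at y)" for y
    by (auto intro!: derivative_eq_intros)
  have d2: "((\<lambda>y. pi * sinh (pi * (y - s))) has_real_derivative pi\<^sup>2 * cosh (pi * (y - s))) (at y)" for y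
    by (auto intro!: derivative_eq_intros simp: power2_eq_square)
  have d3: "((\<lambda>y. - cos (pi * y) + a) has_real_derivative pi * sin (pi * y)) (at y)" for y
    by (auto intro!: derivative_eq_intros)
  have d4: "((\<lambda>y. pi * sin (pi * y)) has_real_derivative pi\<^sup>2 * cos (pi * y)) (at y)" for y
    by (auto intro!: derivative_eq_intros simp: power2_eq_square)
  have eq: "hole_row e1 e2 a s = (\<lambda>x. cosh (pi * (x \<bullet> e2 - s)) + (- cos (pi * (x \<bullet> e1)) + a))"
    by (simp add: hole_row_def[abs_def] algebra_simps)
  have s1: "smooth (\<lambda>x. cosh (pi * (x \<bullet> e2 - s)))" and s2: "smooth (\<lambda>x. - cos (pi * (x \<bullet> e1)) + a)"
    by (intro smooth_add smooth_diff smooth_minus smooth_cosh smooth_cos smooth_mult smooth_inner smooth_const)+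
  have gi: "grad (\<lambda>x. x \<bullet> e) y = e" for e y :: 'a by (rule grad_GDERIV[OF GDERIV_inner])
  have g1: "grad (\<lambda>x. cosh (pi * (x \<bullet> e2 - s))) x = (pi * sinh t) *\<^sub>R e2"
    using grad_compose[OF smooth_inner[of e2] d1, of x] by (simp add: gi t_def)
  have g2: "grad (\<lambda>x. - cos (pi * (x \<bullet> e1)) + a) x = (pi * sin \<theta>) *\<^sub>R e1"
    using grad_compose[OF smooth_inner[of e1] d3, of x] by (simp add: gi \<theta>_def)
  have g: "grad (hole_row e1 e2 a s) x = (pi * sinh t) *\<^sub>R e2 + (pi * sin \<theta>) *\<^sub>R e1"
    unfolding eq grad_add[OF s1 s2] g1 g2 ..
  have l1: "laplacian (\<lambda>x. cosh (pi * (x \<bullet> e2 - s))) x = pi\<^sup>2 * cosh t"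
    using laplacian_compose[OF smooth_inner[of e2] d1 d2, of x] e by (simp add: gi laplacian_inner t_def)
  have l2: "laplacian (\<lambda>x. - cos (pi * (x \<bullet> e1)) + a) x = pi\<^sup>2 * cos \<theta>"
    using laplacian_compose[OF smooth_inner[of e1] d3 d4, of x] e by (simp add: gi laplacian_inner \<theta>_def)
  have l: "laplacian (hole_row e1 e2 a s) x = pi\<^sup>2 * (cosh t + cos \<theta>)"
    unfolding eq laplacian_add[OF s1 s2] l1 l2 by (simp add: algebra_simps)
  have n: "(norm (grad (hole_row e1 e2 a s) x))\<^sup>2 = pi\<^sup>2 * ((sinh t)\<^sup>2 + (sin \<theta>)\<^sup>2)"
    unfolding g power2_norm_eq_inner using e
    by (simp add: inner_add_left inner_add_right inner_not_same_Basis inner_commute[of e2 e1] power2_eq_square algebra_simps)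
  have "laplacian (\<lambda>x. ln (hole_row e1 e2 a s x)) x 
      = - inverse (r ^ Suc (Suc 0)) * (norm (grad (hole_row e1 e2 a s) x))\<^sup>2 + inverse r * laplacian (hole_row e1 e2 a s) x"
    unfolding r_def
  proof (rule laplacian_compose[OF smooth_hole_row, where g=ln and g'=inverse])
    fix y show "(ln has_real_derivative inverse (hole_row e1 e2 a s y)) (at (hole_row e1 e2 a s y))"
      using DERIV_ln[OF hole_row_pos[OF a]] .
    show "(inverse has_real_derivative - inverse (hole_row e1 e2 a s x ^ Suc (Suc 0))) (at (hole_row e1 e2 a s x))"
      using DERIV_inverse[of "hole_row e1 e2 a s x"] hole_row_pos[OF a, of e1 e2 s x] by simp
  qed
  also have "\<dots> = pi\<^sup>2 * (((cosh t + cos \<theta>) * r - ((sinh t)\<^sup>2 + (sin \<theta>)\<^sup>2)) / r\<^sup>2)"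
    unfolding n l using r by (simp add: field_simps power2_eq_square)
  also have "(cosh t + cos \<theta>) * r - ((sinh t)\<^sup>2 + (sin \<theta>)\<^sup>2) = a * (cosh t + cos \<theta>)"
    unfolding sin_squared_eq sinh_square_eq r_def hole_row_def t_def[symmetric] \<theta>_def[symmetric]
    by (simp add: power2_eq_square algebra_simps)
  finally show ?thesis unfolding t_def \<theta>_def r_def .
qed

text \<open>The rows sit at the integers from \<open>- M\<close> to \<open>M - 1\<close>. The sum of
  \<open>pi |x \<bullet> e2 - s|\<close> over them is \<open>pi (M^2 + (x \<bullet> e2)^2)\<close>
  up to \<open>pi M\<close>; subtracting this main term leaves quantities of order \<open>M\<close>,
  the scale of the added constant.\<close>

definition ice :: "'a::euclidean_space \<Rightarrow> 'a \<Rightarrow> real \<Rightarrow> real \<Rightarrow> nat \<Rightarrow> 'a \<Rightarrow> real" where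
  "ice e1 e2 a B M x = (\<Sum>k<2 * M. ln (hole_row e1 e2 a (real k - real M) x)) - pi * (x \<bullet> e2)\<^sup>2 - pi * (real M)\<^sup>2 + B * real M"

lemma smooth_ice: "a > 0 \<Longrightarrow> smooth (ice e1 e2 a B M)"
  unfolding ice_def[abs_def]
  by (intro smooth_add smooth_diff smooth_sum smooth_ln smooth_mult smooth_power smooth_inner smooth_const smooth_hole_row hole_row_pos)

lemma laplacian_ice:
  assumes e: "e1 \<in> Basis" "e2 \<in> Basis" "e1 \<noteq> e2" and a: "a > 0"
  shows "laplacian (ice e1 e2 a B M) x = (\<Sum>k<2 * M. pi\<^sup>2 * (a * (cosh (pi * (x \<bullet> e2 - (real k - real M))) 
      + cos (pi * (x \<bullet> e1))) / (hole_row e1 e2 a (real k - real M) x)\<^sup>2)) - 2 * pi"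
proof -
  have gi: "grad (\<lambda>x. x \<bullet> e) y = e" for e y :: 'a by (rule grad_GDERIV[OF GDERIV_inner])
  have s1: "smooth (\<lambda>x. \<Sum>k<2 * M. ln (hole_row e1 e2 a (real k - real M) x))"
    by (intro smooth_sum smooth_ln smooth_hole_row hole_row_pos a)
  have s2: "smooth (\<lambda>x. - pi * (x \<bullet> e2)\<^sup>2 + (B * real M - pi * (real M)\<^sup>2))"
    by (intro smooth_add smooth_mult smooth_power smooth_inner smooth_const)
  have d1: "((\<lambda>y. - pi * y\<^sup>2 + (B * real M - pi * (real M)\<^sup>2)) has_real_derivative - 2 * pi * y) (at y)" for y
    by (auto intro!: derivative_eq_intros)
  have d2: "((\<lambda>y. - 2 * pi * y) has_real_derivative - 2 * pi) (at y)" for y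
    by (auto intro!: derivative_eq_intros)
  have l: "laplacian (\<lambda>x. - pi * (x \<bullet> e2)\<^sup>2 + (B * real M - pi * (real M)\<^sup>2)) x = - 2 * pi"
    using laplacian_compose[OF smooth_inner[of e2] d1 d2, of x] e by (simp add: gi laplacian_inner)
  have eq: "ice e1 e2 a B M = (\<lambda>x. (\<Sum>k<2 * M. ln (hole_row e1 e2 a (real k - real M) x)) 
      + (- pi * (x \<bullet> e2)\<^sup>2 + (B * real M - pi * (real M)\<^sup>2)))"
    by (rule ext) (simp add: ice_def)
  show ?thesis
    unfolding eq laplacian_add[OF s1 s2] l
    by (subst laplacian_sum) (auto intro!: smooth_ln smooth_hole_row hole_row_pos a simp: laplacian_ln_hole_row[OF e a])
qed

text \<open>The sum of distances is compared with \<open>\<integral> \<bar>y - s\<bar> ds\<close>, whose primitive is \<open>(s - y) \<bar>s - y\<bar> / 2\<close>.\<close>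

lemma sum_dist_rows:
  assumes "\<bar>y\<bar> \<le> real M"
  shows "\<bar>(\<Sum>k<2 * M. \<bar>y - (real k - real M)\<bar>) - ((real M)\<^sup>2 + y\<^sup>2)\<bar> \<le> real M"
proof -
  define q :: "real \<Rightarrow> real" where "q r = r * \<bar>r\<bar> / 2" for r
  \<comment> \<open>\<open>q (r + 1) - q r\<close> is the integral of the absolute value over a unit
    interval; since that function is 1-Lipschitz, its left endpoint value errs by at most
    1/2.\<close>
  have step: "\<bar>q (r + 1) - q r - \<bar>r\<bar>\<bar> \<le> 1 / 2" for r
  proof -
    consider "r \<ge> 0" | "r \<le> -1" | "-1 < r" "r < 0" by linarith
    then show ?thesis
    proof cases
      case 3
      have eq: "q (r + 1) - q r - \<bar>r\<bar> = r\<^sup>2 + 2 * r + 1 / 2"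
        using 3 by (simp add: q_def power2_eq_square field_simps)
      have "r\<^sup>2 + 2 * r + 1 / 2 = (r + 1)\<^sup>2 - 1 / 2" by (simp add: power2_eq_square algebra_simps)
      moreover have "(r + 1)\<^sup>2 \<le> 1" using 3 by (intro power_le_one) auto
      ultimately show ?thesis unfolding eq using zero_le_power2[of "r + 1"] by linarith
    qed (simp_all add: q_def field_simps)
  qed
  have "\<bar>(\<Sum>k<n. \<bar>y - (real k - real M)\<bar>) - (q (real n - real M - y) - q (- real M - y))\<bar> \<le> real n / 2" for n
  proof (induction n)
    case (Suc n)
    have "real (Suc n) - real M - y = (real n - real M - y) + 1" by simp
    moreover have "\<bar>y - (real n - real M)\<bar> = \<bar>real n - real M - y\<bar>" by simp
    ultimately have "\<bar>q (real (Suc n) - real M - y) - q (real n - real M - y) - \<bar>y - (real n - real M)\<bar>\<bar> \<le> 1 / 2"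
      by (simp only: step)
    moreover have "real (Suc n) / 2 = real n / 2 + 1 / 2" by simp
    ultimately show ?case using Suc unfolding sum.lessThan_Suc by linarith
  qed simp
  from this[of "2 * M"] have "\<bar>(\<Sum>k<2 * M. \<bar>y - (real k - real M)\<bar>) - (q (real M - y) - q (- real M - y))\<bar> \<le> real M"
    by simp
  moreover have "q (real M - y) - q (- real M - y) = (real M)\<^sup>2 + y\<^sup>2"
    using assms by (simp add: q_def power2_eq_square field_simps)
  ultimately show ?thesis by simp
qed

lemma cosh_le_exp_abs: "cosh t \<le> exp \<bar>t::real\<bar>"
proof -
  have "exp t \<le> exp \<bar>t\<bar>" "exp (- t) \<le> exp \<bar>t\<bar>" by auto
  then show ?thesis unfolding cosh_def by (simp del: exp_le_cancel_iff)
qed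

lemma cosh_ge_exp_abs: "exp \<bar>t::real\<bar> / 2 \<le> cosh t"
  by (cases "t \<ge> 0") (auto simp: cosh_def)

lemma ln_hole_row_le:
  assumes "0 < a" "a \<le> 1"
  shows "ln (hole_row e1 e2 a s x) \<le> pi * \<bar>x \<bullet> e2 - s\<bar> + 2"
proof -
  define t where "t = pi * (x \<bullet> e2 - s)"
  have "hole_row e1 e2 a s x \<le> cosh t + 2"
    unfolding hole_row_def t_def using cos_ge_minus_one[of "pi * (x \<bullet> e1)"] assms by linarith
  also have "\<dots> \<le> 3 * cosh t" using cosh_real_ge_1[of t] by simp
  also have "\<dots> \<le> exp 2 * exp \<bar>t\<bar>"
  proof (rule mult_mono)
    show "3 \<le> exp (2::real)" using exp_ge_add_one_self[of 2] by simp
  qed (auto intro: cosh_le_exp_abs)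
  finally have "hole_row e1 e2 a s x \<le> exp (\<bar>t\<bar> + 2)" by (simp add: exp_add mult.commute)
  then have "ln (hole_row e1 e2 a s x) \<le> ln (exp (\<bar>t\<bar> + 2))"
    by (subst ln_le_cancel_iff) (auto intro: hole_row_pos assms)
  then show ?thesis by (simp add: t_def abs_mult)
qed

text \<open>The 8 is 4 + 4: a slack of 2 in each of \<open>2 M\<close> rows, and
  \<open>pi \<le> 4\<close> times the error \<open>M\<close> of
  \<open>sum_dist_rows\<close>.\<close>

lemma ice_le:
  assumes "0 < a" "a \<le> 1" "\<bar>x \<bullet> e2\<bar> \<le> real M"
  shows "ice e1 e2 a B M x \<le> (B + 8) * real M"
proof -
  have "(\<Sum>k<2 * M. ln (hole_row e1 e2 a (real k - real M) x)) \<le> (\<Sum>k<2 * M. pi * \<bar>x \<bullet> e2 - (real k - real M)\<bar> + 2)"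
    by (intro sum_mono ln_hole_row_le assms)
  also have "\<dots> = pi * (\<Sum>k<2 * M. \<bar>x \<bullet> e2 - (real k - real M)\<bar>) + 4 * real M"
    by (simp add: sum.distrib sum_distrib_left)
  also have "\<dots> \<le> pi * ((real M)\<^sup>2 + (x \<bullet> e2)\<^sup>2 + real M) + 4 * real M"
    using sum_dist_rows[OF assms(3)] by (intro add_right_mono mult_left_mono) auto
  finally have "ice e1 e2 a B M x \<le> pi * real M + 4 * real M + B * real M"
    unfolding ice_def by (simp add: algebra_simps)
  also have "pi * real M \<le> 4 * real M" using pi_less_4 by (intro mult_right_mono) auto
  finally show ?thesis by (simp add: algebra_simps)
qed

text \<open>Each row loses at most \<open>- ln (\<delta> / 2)\<close> against
  \<open>pi |x \<bullet> e2 - s|\<close>, and the 4 again bounds \<open>pi\<close>. The total loss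
  per unit of \<open>M\<close> depends on \<open>\<delta>\<close> only, so \<open>B\<close> can be
  taken large compared with it.\<close>

lemma ice_ge:
  assumes a: "0 < a" and \<delta>: "0 < \<delta>" and x: "\<bar>x \<bullet> e2\<bar> \<le> real M"
    and good: "\<And>k. k < 2 * M \<Longrightarrow> \<delta> * cosh (pi * (x \<bullet> e2 - (real k - real M))) \<le> hole_row e1 e2 a (real k - real M) x"
  shows "(B - (4 - 2 * ln (\<delta> / 2))) * real M \<le> ice e1 e2 a B M x"
proof -
  have ge: "pi * \<bar>x \<bullet> e2 - (real k - real M)\<bar> + ln (\<delta> / 2) \<le> ln (hole_row e1 e2 a (real k - real M) x)" if k: "k < 2 * M" for k
  proof -
    define t where "t = pi * (x \<bullet> e2 - (real k - real M))"
    have "\<delta> / 2 * exp \<bar>t\<bar> \<le> \<delta> * cosh t" using cosh_ge_exp_abs[of t] \<delta> by simp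
    also have "\<dots> \<le> hole_row e1 e2 a (real k - real M) x" using good[OF k] by (simp add: t_def)
    finally have "ln (\<delta> / 2 * exp \<bar>t\<bar>) \<le> ln (hole_row e1 e2 a (real k - real M) x)"
      using \<delta> hole_row_pos[OF a] by (subst ln_le_cancel_iff) auto
    moreover have "ln (\<delta> / 2 * exp \<bar>t\<bar>) = ln (\<delta> / 2) + \<bar>t\<bar>" using \<delta> by (subst ln_mult) auto
    ultimately show ?thesis by (simp add: t_def abs_mult)
  qed
  have "pi * ((real M)\<^sup>2 + (x \<bullet> e2)\<^sup>2 - real M) + 2 * real M * ln (\<delta> / 2)
      \<le> pi * (\<Sum>k<2 * M. \<bar>x \<bullet> e2 - (real k - real M)\<bar>) + 2 * real M * ln (\<delta> / 2)"
    using sum_dist_rows[OF x] by (intro add_right_mono mult_left_mono) auto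
  also have "\<dots> = (\<Sum>k<2 * M. pi * \<bar>x \<bullet> e2 - (real k - real M)\<bar> + ln (\<delta> / 2))"
    by (simp add: sum.distrib sum_distrib_left)
  also have "\<dots> \<le> (\<Sum>k<2 * M. ln (hole_row e1 e2 a (real k - real M) x))" by (intro sum_mono ge) auto
  finally have "- (pi * real M) + 2 * real M * ln (\<delta> / 2) + B * real M \<le> ice e1 e2 a B M x"
    unfolding ice_def by (simp add: algebra_simps)
  moreover have "pi * real M \<le> 4 * real M" using pi_less_4 by (intro mult_right_mono) auto
  ultimately show ?thesis by (simp add: algebra_simps)
qed

lemma hole_row_ge_of_cos_le:
  assumes "0 < a" "0 < \<delta>" "\<delta> \<le> 1" "cos (pi * (x \<bullet> e1)) \<le> 1 - \<delta>"
  shows "\<delta> * cosh (pi * (x \<bullet> e2 - s)) \<le> hole_row e1 e2 a s x"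
proof -
  define c where "c = cosh (pi * (x \<bullet> e2 - s))"
  have "\<delta> * (c - 1) \<le> 1 * (c - 1)" using assms cosh_real_ge_1 unfolding c_def by (intro mult_right_mono) auto
  then show ?thesis using assms unfolding hole_row_def c_def[symmetric] by (simp add: algebra_simps)
qed

text \<open>The regularisation only adds nonnegative terms, so this side, used for the test
  function, holds on the whole space. Smallness of \<open>a\<close> enters through
  \<open>laplacian_ice_le\<close>.\<close>

lemma laplacian_ice_ge: 
  assumes e: "e1 \<in> Basis" "e2 \<in> Basis" "e1 \<noteq> e2" and a: "a > 0"
  shows "laplacian (ice e1 e2 a B M) x \<ge> - 2 * pi"
proof -
  have "0 \<le> cosh t + cos \<theta>" for t \<theta> :: real
    using cosh_real_ge_1[of t] cos_ge_minus_one[of \<theta>] by linarith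
  then have "0 \<le> (\<Sum>k<2 * M. pi\<^sup>2 * (a * (cosh (pi * (x \<bullet> e2 - (real k - real M))) 
      + cos (pi * (x \<bullet> e1))) / (hole_row e1 e2 a (real k - real M) x)\<^sup>2))"
    using a by (intro sum_nonneg mult_nonneg_nonneg divide_nonneg_nonneg) auto
  then show ?thesis unfolding laplacian_ice[OF e a] by simp
qed

text \<open>If one row were tiny at \<open>x\<close>, its logarithm would outweigh the upper bounds
  for all other rows and make \<open>ice\<close> negative. Hence every row is at least
  \<open>exp (- Q)\<close> on the domain, with \<open>Q\<close> independent of \<open>a\<close>, and
  the excess of the Laplacian is at most a constant times \<open>a\<close>.\<close>

lemma laplacian_ice_le:
  assumes e: "e1 \<in> Basis" "e2 \<in> Basis" "e1 \<noteq> e2" and a: "0 < a" "a \<le> 1"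
    and x: "\<bar>x \<bullet> e2\<bar> \<le> real M" "ice e1 e2 a B M x > 0" and B: "B \<ge> 0"
    and Q: "Q = 2 * real M * (pi * (2 * real M) + 2) + B * real M"
  shows "laplacian (ice e1 e2 a B M) x \<le> 2 * real M * (pi\<^sup>2 * (a * (3 * exp (2 * Q)))) - 2 * pi"
proof -
  let ?r = "\<lambda>k. hole_row e1 e2 a (real k - real M) x"
  let ?b = "pi * (2 * real M) + 2"
  have Q0: "Q \<ge> 0" unfolding Q using B by simp
  have up: "ln (?r k) \<le> ?b" if "k < 2 * M" for k
  proof -
    have "\<bar>x \<bullet> e2 - (real k - real M)\<bar> \<le> 2 * real M" using x(1) that by auto
    then have "pi * \<bar>x \<bullet> e2 - (real k - real M)\<bar> \<le> pi * (2 * real M)" by (intro mult_left_mono) auto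
    then show ?thesis using ln_hole_row_le[OF a, of e1 e2 "real k - real M" x] by linarith
  qed
  have summand: "a * (cosh (pi * (x \<bullet> e2 - (real k - real M))) + cos (pi * (x \<bullet> e1))) / (?r k)\<^sup>2 \<le> a * (3 * exp (2 * Q))"
    if k: "k < 2 * M" for k
  proof -
    have r: "?r k > 0" by (rule hole_row_pos[OF a(1)])
    have "(\<Sum>j<2 * M. ln (?r j)) = ln (?r k) + (\<Sum>j\<in>{..<2 * M} - {k}. ln (?r j))"
      using k by (intro sum.remove) auto
    moreover have "(\<Sum>j\<in>{..<2 * M} - {k}. ln (?r j)) \<le> (\<Sum>j\<in>{..<2 * M} - {k}. ?b)"
      by (intro sum_mono up) auto
    moreover have "(\<Sum>j\<in>{..<2 * M} - {k}. ?b) \<le> (\<Sum>j<2 * M. ?b)" by (intro sum_mono2) auto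
    moreover have "(\<Sum>j<2 * M. ?b) = 2 * real M * ?b" by simp
    moreover have "0 \<le> pi * (x \<bullet> e2)\<^sup>2" "0 \<le> pi * (real M)\<^sup>2" by auto
    ultimately have "ln (?r k) \<ge> - Q" using x(2) unfolding ice_def Q by linarith
    then have "exp (- Q) \<le> ?r k" using r by (metis exp_le_cancel_iff exp_ln)
    then have i: "1 / ?r k \<le> exp Q" using r by (simp add: exp_minus field_simps)
    have "cosh (pi * (x \<bullet> e2 - (real k - real M))) + cos (pi * (x \<bullet> e1)) \<le> ?r k + 2"
      unfolding hole_row_def using cos_le_one[of "pi * (x \<bullet> e1)"] a by linarith
    then have "(cosh (pi * (x \<bullet> e2 - (real k - real M))) + cos (pi * (x \<bullet> e1))) / (?r k)\<^sup>2 \<le> (?r k + 2) / (?r k)\<^sup>2"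
      by (intro divide_right_mono) auto
    also have "\<dots> = 1 / ?r k + 2 * (1 / ?r k)\<^sup>2" using r by (simp add: field_simps power2_eq_square)
    also have "\<dots> \<le> exp Q + 2 * (exp Q)\<^sup>2" using i r by (intro add_mono mult_left_mono power_mono) auto
    also have "(exp Q)\<^sup>2 = exp (2 * Q)" by (simp add: exp_double)
    also have "exp Q + 2 * exp (2 * Q) \<le> 3 * exp (2 * Q)" using Q0 by simp
    finally show ?thesis using a(1) mult_left_mono by fastforce
  qed
  have "(\<Sum>k<2 * M. pi\<^sup>2 * (a * (cosh (pi * (x \<bullet> e2 - (real k - real M))) 
      + cos (pi * (x \<bullet> e1))) / (hole_row e1 e2 a (real k - real M) x)\<^sup>2)) \<le> (\<Sum>k<2 * M. pi\<^sup>2 * (a * (3 * exp (2 * Q))))"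
    by (intro sum_mono mult_left_mono summand) auto
  then show ?thesis unfolding laplacian_ice[OF e a(1)] by simp
qed

section \<open>The perforated cube and its connectedness\<close>

definition ice_domain :: "'a::euclidean_space \<Rightarrow> 'a \<Rightarrow> real \<Rightarrow> real \<Rightarrow> nat \<Rightarrow> 'a set" where
  "ice_domain e1 e2 a B M = {x. (\<forall>b\<in>Basis. \<bar>x \<bullet> b\<bar> < real M) \<and> ice e1 e2 a B M x > 0}"

lemma cube_eq_box: "{x::'a::euclidean_space. \<forall>b\<in>Basis. \<bar>x \<bullet> b\<bar> < r} = box (- r *\<^sub>R One) (r *\<^sub>R One)"
  by (auto simp: box_def abs_less_iff)

lemma ice_domain_open_bounded:
  assumes "a > 0" 
  shows "open (ice_domain e1 e2 a B M)" "bounded (ice_domain e1 e2 a B M)"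
proof -
  have eq: "ice_domain e1 e2 a B M = box (- real M *\<^sub>R One) (real M *\<^sub>R One) \<inter> {x. 0 < ice e1 e2 a B M x}"
    unfolding ice_domain_def cube_eq_box[symmetric] by auto
  show "open (ice_domain e1 e2 a B M)"
    unfolding eq
    by (intro open_Int open_box open_Collect_less continuous_on_const smooth_continuous smooth_ice assms)
  show "bounded (ice_domain e1 e2 a B M)"
    unfolding eq by (rule bounded_subset[OF bounded_box]) auto
qed

lemma ice_mono:
  assumes "a > 0" "x \<bullet> e2 = y \<bullet> e2" "cos (pi * (y \<bullet> e1)) \<le> cos (pi * (x \<bullet> e1))"
  shows "ice e1 e2 a B M x \<le> ice e1 e2 a B M y"
proof -
  have "ln (hole_row e1 e2 a s x) \<le> ln (hole_row e1 e2 a s y)" for s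
    using hole_row_pos[OF assms(1)] assms by (subst ln_le_cancel_iff[OF hole_row_pos[OF assms(1)] hole_row_pos[OF assms(1)]]) (simp add: hole_row_def)
  then show ?thesis unfolding ice_def assms(2) by (auto intro!: sum_mono)
qed

lemma cosh_ge_three_halves: "cosh (pi * ((1/2::real) - of_int n)) \<ge> 3 / 2"
proof -
  define t where "t = pi * ((1/2::real) - of_int n)"
  have "\<bar>(1/2::real) - of_int n\<bar> \<ge> 1 / 2"
  proof (cases "n \<le> 0")
    case True
    then have "real_of_int n \<le> 0" by simp
    then show ?thesis by linarith
  next
    case False
    then have "real_of_int n \<ge> 1" by simp
    then show ?thesis by linarith
  qed
  then have "pi * \<bar>(1/2::real) - of_int n\<bar> \<ge> 3 * (1 / 2)" using pi_gt3 by (intro mult_mono) auto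
  then have t: "\<bar>t\<bar> \<ge> 3 / 2" by (simp add: t_def abs_mult)
  have "3 \<le> exp (3 / 2 :: real)"
    using exp_lower_Taylor_quadratic[of "3 / 2"] by (simp add: power2_eq_square)
  also have "\<dots> \<le> exp \<bar>t\<bar>" using t by simp
  finally show ?thesis using cosh_ge_exp_abs[of t] unfolding t_def by linarith
qed

lemma cos_le_toward_odd:
  fixes z w :: real
  assumes "\<bar>z - (2 * of_int j + 1)\<bar> \<le> \<bar>w - (2 * of_int j + 1)\<bar>" "\<bar>w - (2 * of_int j + 1)\<bar> \<le> 1"
  shows "cos (pi * z) \<le> cos (pi * w)"
proof -
  have eq: "cos (pi * r) = - cos (pi * \<bar>r - (2 * of_int j + 1)\<bar>)" for r
  proof -
    have "cos (pi * r) = cos (pi * (r - (2 * of_int j + 1)) + pi + 2 * pi * of_int j)"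
      by (simp add: algebra_simps)
    also have "\<dots> = cos (pi * (r - (2 * of_int j + 1)) + pi)"
      by (simp add: cos_add[of _ "2 * pi * of_int j"] cos_int_2pin sin_int_2pin)
    also have "\<dots> = - cos (pi * (r - (2 * of_int j + 1)))" by simp
    also have "cos (pi * (r - (2 * of_int j + 1))) = cos (pi * \<bar>r - (2 * of_int j + 1)\<bar>)"
      by (cases "r - (2 * of_int j + 1) \<ge> 0") (simp_all add: abs_if right_diff_distrib cos_minus[symmetric, of "pi * r - _"])
    finally show ?thesis .
  qed
  have "cos (pi * \<bar>w - (2 * of_int j + 1)\<bar>) \<le> cos (pi * \<bar>z - (2 * of_int j + 1)\<bar>)"
    using assms mult_left_mono[OF assms(2), of pi] by (intro cos_monotone_0_pi_le) auto
  then show ?thesis unfolding eq[of z] eq[of w] by simp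
qed

text \<open>Decreasing \<open>cos (\<pi> x\<^sub>1)\<close> with the other coordinates fixed increases the level function.  Hence
  each point is joined inside the domain to a hyperplane \<open>x\<^sub>1\<close> = odd integer, and these
  hyperplanes are joined by \<open>x\<^sub>2 = 1/2\<close>, which stays away from all rows of holes.\<close>

lemma ice_domain_connected:
  fixes e1 e2 :: "'a::euclidean_space"
  assumes e: "e1 \<in> Basis" "e2 \<in> Basis" "e1 \<noteq> e2" and a: "0 < a" and B: "B > 14" and N: "N > 0"
  shows "connected (ice_domain e1 e2 a B (2 * N))" "ice_domain e1 e2 a B (2 * N) \<noteq> {}"
proof -
  let ?M = "2 * N" and ?O = "ice_domain e1 e2 a B (2 * N)"
  let ?C = "{x::'a. \<forall>b\<in>Basis. \<bar>x \<bullet> b\<bar> < real ?M}"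
  have convC: "convex ?C" unfolding cube_eq_box by (rule convex_box)
  \<comment> \<open>The factor 1/3 gives the threshold on \<open>B\<close>:
    \<open>4 - 2 ln (1/6) \<le> 14\<close>. It suits both families of hyperplanes:
    \<open>cosh \<ge> 3/2\<close> implies \<open>cosh - 1 \<ge> cosh / 3\<close>, and on the other
    family \<open>cos \<le> 0\<close>.\<close>
  have pos: "ice e1 e2 a B ?M x > 0" if x: "x \<in> ?C"
    and g: "\<And>k. k < 2 * ?M \<Longrightarrow> (1/3) * cosh (pi * (x \<bullet> e2 - (real k - real ?M))) \<le> hole_row e1 e2 a (real k - real ?M) x" for x
  proof -
    have "ln (6::real) \<le> 5" using ln_le_minus_one[of "6::real"] by simp
    then have l: "- ln ((1/3) / 2 :: real) \<le> 5" by (simp add: ln_div)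
    have "0 < (B - (4 - 2 * ln ((1/3) / 2))) * real ?M" using B N l by (intro mult_pos_pos) auto
    also have "\<dots> \<le> ice e1 e2 a B ?M x"
      using x e by (intro ice_ge a g) (auto intro: less_imp_le)
    finally show ?thesis .
  qed
  define P where "P = ?C \<inter> {x. e2 \<bullet> x = 1/2}"
  define T where "T j = ?C \<inter> {x. e1 \<bullet> x = 2 * of_int j + 1}" for j :: int
  have convP: "convex P" unfolding P_def by (intro convex_Int convC convex_hyperplane)
  have convT: "convex (T j)" for j unfolding T_def by (intro convex_Int convC convex_hyperplane)
  have PO: "P \<subseteq> ?O"
  proof
    fix x assume "x \<in> P"
    then have x: "x \<in> ?C" "x \<bullet> e2 = 1/2" by (auto simp: P_def inner_commute)
    have "ice e1 e2 a B ?M x > 0"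
    proof (rule pos[OF x(1)])
      fix k
      have "x \<bullet> e2 - (real k - real ?M) = 1/2 - of_int (int k - int ?M)" using x(2) by simp
      then have "cosh (pi * (x \<bullet> e2 - (real k - real ?M))) \<ge> 3 / 2" by (simp only: cosh_ge_three_halves)
      then show "(1/3) * cosh (pi * (x \<bullet> e2 - (real k - real ?M))) \<le> hole_row e1 e2 a (real k - real ?M) x"
        unfolding hole_row_def using cos_le_one[of "pi * (x \<bullet> e1)"] a by linarith
    qed
    then show "x \<in> ?O" using x(1) by (simp add: ice_domain_def)
  qed
  have TO: "T j \<subseteq> ?O" for j
  proof
    fix x assume "x \<in> T j"
    then have x: "x \<in> ?C" "x \<bullet> e1 = 2 * of_int j + 1" by (auto simp: T_def inner_commute)
    have "cos (pi * (x \<bullet> e1)) \<le> cos (pi * (2 * of_int j + 1 + 1/2))"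
      unfolding x(2) by (rule cos_le_toward_odd[where j=j]) auto
    also have "pi * (2 * real_of_int j + 1 + 1/2) = (pi + pi / 2) + 2 * pi * of_int j" by (simp add: algebra_simps)
    also have "cos \<dots> = cos (pi + pi / 2)" by (simp only: cos_add[of _ "2 * pi * of_int j"] cos_int_2pin sin_int_2pin)
    also have "\<dots> = 0" by (simp only: cos_add) simp
    finally have c: "cos (pi * (x \<bullet> e1)) \<le> 1 - 1/3" by simp
    have "ice e1 e2 a B ?M x > 0"
      by (rule pos[OF x(1)]) (rule hole_row_ge_of_cos_le, use a c in auto)
    then show "x \<in> ?O" using x(1) by (simp add: ice_domain_def)
  qed
  define p where "p j = (2 * of_int j + 1) *\<^sub>R e1 + (1/2) *\<^sub>R e2" for j :: int
  have p: "p j \<in> P \<inter> T j" if "\<bar>2 * of_int j + 1\<bar> < real ?M" for j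
    using that e N unfolding p_def P_def T_def
    by (auto simp: inner_add_left inner_add_right inner_Basis)
  have "p 0 \<in> P" using p[of 0] N by auto
  then show "?O \<noteq> {}" using PO by auto
  \<comment> \<open>\<open>x \<bullet> e1\<close> lies between \<open>2 j\<close> and
    \<open>2 j + 2\<close>, so the segment moves it monotonically to the midpoint, where
    \<open>cos\<close> is minimal.\<close>
  define j where "j x = \<lfloor>(x \<bullet> e1) / 2\<rfloor>" for x
  define S where "S x = closed_segment x (x + (2 * of_int (j x) + 1 - x \<bullet> e1) *\<^sub>R e1)" for x
  have near: "\<bar>x \<bullet> e1 - (2 * of_int (j x) + 1)\<bar> \<le> 1" for x
    unfolding j_def using floor_correct[of "(x \<bullet> e1) / 2"] by (simp add: abs_le_iff) linarith
  \<comment> \<open>The half-side \<open>2 N\<close> is an even integer, so the target odd integer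
    lies between \<open>- 2 N + 1\<close> and \<open>2 N - 1\<close> and the segment stays inside
    the cube.\<close>
  have jM: "\<bar>2 * of_int (j x) + 1\<bar> < real ?M" if "x \<in> ?O" for x
  proof -
    have "\<bar>x \<bullet> e1\<bar> < 2 * real N" using that e by (auto simp: ice_domain_def)
    then have "(x \<bullet> e1) / 2 < of_int (int N)" "of_int (- int N) \<le> (x \<bullet> e1) / 2" by (auto simp: abs_less_iff)
    then have "j x < int N" "- int N \<le> j x" unfolding j_def by (simp_all only: floor_less_iff le_floor_iff)
    then have "2 * j x + 1 < 2 * int N" "- (2 * int N) < 2 * j x + 1" by auto
    then have "real_of_int (2 * j x + 1) < real_of_int (2 * int N)" "real_of_int (- (2 * int N)) < real_of_int (2 * j x + 1)"
      by (simp_all only: of_int_less_iff)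
    then show ?thesis by (simp add: abs_less_iff)
  qed
  have SO: "S x \<subseteq> ?O" and ST: "S x \<inter> T (j x) \<noteq> {}" if x: "x \<in> ?O" for x
  proof -
    let ?c = "2 * real_of_int (j x) + 1"
    let ?y = "x + (?c - x \<bullet> e1) *\<^sub>R e1"
    have xC: "x \<in> ?C" using x by (simp add: ice_domain_def)
    have yb: "?y \<bullet> b = (if b = e1 then ?c else x \<bullet> b)" if "b \<in> Basis" for b
      using that e by (auto simp: inner_add_left inner_Basis)
    have yC: "?y \<in> ?C" using xC jM[OF x] yb by auto
    then have "?y \<in> T (j x)" unfolding T_def using yb[OF e(1)] by (simp add: inner_commute)
    then show "S x \<inter> T (j x) \<noteq> {}" unfolding S_def by auto
    show "S x \<subseteq> ?O"
    proof
      fix z assume z: "z \<in> S x"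
      then have zC: "z \<in> ?C" using convC xC yC unfolding S_def by (meson closed_segment_subset subsetD)
      obtain u where u: "0 \<le> u" "u \<le> 1" "z = (1 - u) *\<^sub>R x + u *\<^sub>R ?y"
        using z unfolding S_def closed_segment_def by auto
      have z2: "x \<bullet> e2 = z \<bullet> e2"
        unfolding u(3) inner_add_left[of "(1 - u) *\<^sub>R x"] inner_scaleR_left yb[OF e(2)] using e by (simp add: algebra_simps)
      have z1: "z \<bullet> e1 - ?c = (1 - u) * (x \<bullet> e1 - ?c)"
        unfolding u(3) inner_add_left[of "(1 - u) *\<^sub>R x"] inner_scaleR_left yb[OF e(1)] by (simp add: algebra_simps)
      have "\<bar>z \<bullet> e1 - ?c\<bar> \<le> \<bar>x \<bullet> e1 - ?c\<bar>"
        unfolding z1 abs_mult using u by (intro mult_left_le_one_le) auto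
      then have "cos (pi * (z \<bullet> e1)) \<le> cos (pi * (x \<bullet> e1))" by (rule cos_le_toward_odd) (rule near)
      from ice_mono[OF a z2 this, of B ?M] show "z \<in> ?O" using x zC by (simp add: ice_domain_def)
    qed
  qed
  have conn: "connected (S x \<union> (T (j x) \<union> P))" if x: "x \<in> ?O" for x
  proof (intro connected_Un convex_connected[OF convT] convex_connected[OF convP])
    show "connected (S x)" unfolding S_def by (rule connected_segment)
    show "T (j x) \<inter> P \<noteq> {}" using p[OF jM[OF x]] by auto
    show "S x \<inter> (T (j x) \<union> P) \<noteq> {}" using ST[OF x] by auto
  qed
  have "?O = \<Union> ((\<lambda>x. S x \<union> (T (j x) \<union> P)) ` ?O)"
  proof
    show "?O \<subseteq> \<Union> ((\<lambda>x. S x \<union> (T (j x) \<union> P)) ` ?O)" by (auto simp: S_def)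
    show "\<Union> ((\<lambda>x. S x \<union> (T (j x) \<union> P)) ` ?O) \<subseteq> ?O" using SO TO PO by blast
  qed
  moreover have "connected (\<Union> ((\<lambda>x. S x \<union> (T (j x) \<union> P)) ` ?O))"
  proof (rule connected_Union)
    show "\<Inter> ((\<lambda>x. S x \<union> (T (j x) \<union> P)) ` ?O) \<noteq> {}" using \<open>p 0 \<in> P\<close> by blast
  qed (use conn in auto)
  ultimately show "connected ?O" by simp
qed

text \<open>Neighbourhoods of the hyperplanes where \<open>cos (pi (x \<bullet> e)) = 1\<close>,
  written as finitely many boxes so that measurability and volume are immediate. They contain whole
  sheets between the holes, which is affordable since their total volume is proportional to
  \<open>\<theta>\<close>.\<close>

definition slabs :: "'a::euclidean_space \<Rightarrow> real \<Rightarrow> nat \<Rightarrow> 'a set" where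
  "slabs e \<theta> N = (\<Union>k\<in>{- int N..int N}. cbox (\<Sum>b\<in>Basis. (if b = e then 2 * of_int k - \<theta> else - real N) *\<^sub>R b)
      (\<Sum>b\<in>Basis. (if b = e then 2 * of_int k + \<theta> else real N) *\<^sub>R b))"

lemma slabs_measure:
  fixes e :: "'a::euclidean_space"
  assumes e: "e \<in> Basis" and \<theta>: "\<theta> > 0" and N: "N > 0"
  shows "slabs e \<theta> N \<in> sets lborel" "emeasure lborel (slabs e \<theta> N) < \<infinity>"
    "measure lborel (slabs e \<theta> N) \<le> 3 * \<theta> * (2 * real N) ^ DIM('a)"
proof -
  let ?l = "\<lambda>k::int. \<Sum>b\<in>Basis. (if b = e then 2 * of_int k - \<theta> else - real N) *\<^sub>R b"
  let ?u = "\<lambda>k::int. \<Sum>b\<in>Basis. (if b = e then 2 * of_int k + \<theta> else real N) *\<^sub>R b"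
  have lu: "?l k \<bullet> b = (if b = e then 2 * of_int k - \<theta> else - real N)"
     "?u k \<bullet> b = (if b = e then 2 * of_int k + \<theta> else real N)" if "b \<in> Basis" for k b
    using that by simp_all
  have m: "measure lborel (cbox (?l k) (?u k)) = 2 * \<theta> * (2 * real N) ^ (DIM('a) - 1)" for k
  proof -
    have "\<And>b. b \<in> Basis \<Longrightarrow> ?l k \<bullet> b \<le> ?u k \<bullet> b" using \<theta> by (simp add: lu)
    then have "measure lborel (cbox (?l k) (?u k)) = (\<Prod>b\<in>Basis. (?u k - ?l k) \<bullet> b)"
      by (subst measure_lborel_cbox_eq) auto
    also have "\<dots> = (\<Prod>b\<in>Basis. if b = e then 2 * \<theta> else 2 * real N)"
      by (intro prod.cong refl) (simp add: inner_diff_left lu)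
    also have "\<dots> = 2 * \<theta> * (\<Prod>b\<in>Basis - {e}. if b = e then 2 * \<theta> else 2 * real N)"
      using e by (subst prod.remove[of _ e]) auto
    also have "(\<Prod>b\<in>Basis - {e}. if b = e then 2 * \<theta> else 2 * real N) = (\<Prod>b\<in>Basis - {e}. 2 * real N)"
      by (intro prod.cong) auto
    also have "\<dots> = (2 * real N) ^ (DIM('a) - 1)" using e by (simp add: card_Diff_singleton)
    finally show ?thesis .
  qed
  show "slabs e \<theta> N \<in> sets lborel" unfolding slabs_def by (intro sets.finite_UN) auto
  show "emeasure lborel (slabs e \<theta> N) < \<infinity>"
    unfolding slabs_def by (intro emeasure_bounded_finite) auto
  have "measure lborel (slabs e \<theta> N) \<le> (\<Sum>k\<in>{- int N..int N}. measure lborel (cbox (?l k) (?u k)))"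
    unfolding slabs_def by (intro measure_UNION_le) auto
  also have "\<dots> = (2 * real N + 1) * (2 * \<theta> * (2 * real N) ^ (DIM('a) - 1))" unfolding m by simp
  also have "\<dots> \<le> (3 * real N) * (2 * \<theta> * (2 * real N) ^ (DIM('a) - 1))"
    using N \<theta> by (intro mult_right_mono) auto
  also have "\<dots> = 3 * \<theta> * (2 * real N * (2 * real N) ^ (DIM('a) - 1))" by simp
  also have "2 * real N * (2 * real N) ^ (DIM('a) - 1) = (2 * real N) ^ DIM('a)"
    using DIM_positive[where 'a='a] by (subst power_Suc[symmetric]) simp
  finally show "measure lborel (slabs e \<theta> N) \<le> 3 * \<theta> * (2 * real N) ^ DIM('a)" .
qed

lemma cos_le_off_slabs:
  fixes x :: "'a::euclidean_space"
  assumes e: "e \<in> Basis" and \<theta>: "0 < \<theta>" "\<theta> \<le> 1/2" and x: "norm x < real N" "x \<notin> slabs e \<theta> N"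
  shows "cos (pi * (x \<bullet> e)) \<le> cos (pi * \<theta>)"
proof -
  have N: "N > 0" using x(1) by (cases N) auto
  have xb: "\<bar>x \<bullet> b\<bar> < real N" if "b \<in> Basis" for b using Basis_le_norm[OF that, of x] x(1) by linarith
  have xb': "- real N \<le> x \<bullet> b" "x \<bullet> b \<le> real N" if "b \<in> Basis" for b using xb[OF that] by linarith+
  define k where "k = round ((x \<bullet> e) / 2)"
  define r where "r = x \<bullet> e - 2 * of_int k"
  have r1: "\<bar>r\<bar> \<le> 1" using of_int_round_abs_le[of "(x \<bullet> e) / 2"] unfolding r_def k_def by (auto simp: abs_le_iff field_simps)
  have "\<bar>2 * real_of_int k\<bar> < real N + 1" using r1 xb[OF e] unfolding r_def by linarith
  then have "\<bar>2 * k\<bar> < int N + 1" by linarith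
  then have kN: "k \<in> {- int N..int N}" using N by auto
  have "\<bar>r\<bar> > \<theta>"
  proof (rule ccontr)
    assume "\<not> \<bar>r\<bar> > \<theta>"
    then have "x \<in> cbox (\<Sum>b\<in>Basis. (if b = e then 2 * of_int k - \<theta> else - real N) *\<^sub>R b)
      (\<Sum>b\<in>Basis. (if b = e then 2 * of_int k + \<theta> else real N) *\<^sub>R b)"
      using xb' unfolding mem_box r_def by auto
    then show False using x(2) kN unfolding slabs_def by blast
  qed
  moreover have "cos (pi * (x \<bullet> e)) = cos (pi * \<bar>r\<bar>)"
  proof -
    have "cos (pi * (x \<bullet> e)) = cos (pi * r + 2 * pi * of_int k)" by (simp add: r_def algebra_simps)
    also have "\<dots> = cos (pi * r)" by (simp add: cos_add cos_int_2pin sin_int_2pin)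
    also have "\<dots> = cos (pi * \<bar>r\<bar>)" by (cases "r \<ge> 0") (simp_all add: abs_if)
    finally show ?thesis .
  qed
  moreover have "cos (pi * \<bar>r\<bar>) \<le> cos (pi * \<theta>)"
    using \<open>\<bar>r\<bar> > \<theta>\<close> r1 \<theta> mult_left_mono[OF r1, of pi] by (intro cos_monotone_0_pi_le) auto
  ultimately show ?thesis by simp
qed

section \<open>Choice of the parameters\<close>

text \<open>The expression collects all losses: \<open>(1 + \<kappa>)^2\<close> from the squared
  ratio of upper and lower plateau bounds, \<open>1 + \<kappa>\<close> from the cutoff, one
  \<open>1 / (1 - \<kappa>)\<close> from the slabs and one from rescaling the supersolution.\<close>

lemma obtain_tolerance:
  assumes "\<epsilon> > (0::real)"
  obtains \<kappa> where "0 < \<kappa>" "\<kappa> < 1" "(1 + \<kappa>)^3 / (1 - \<kappa>)\<^sup>2 < 1 + \<epsilon>"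
proof -
  have "((\<lambda>\<kappa>. (1 + \<kappa>)^3 / (1 - \<kappa>)\<^sup>2) \<longlongrightarrow> (1 + 0)^3 / (1 - 0)\<^sup>2) (at_right (0::real))"
    by (intro tendsto_intros) auto
  then have "\<forall>\<^sub>F \<kappa> in at_right 0. (1 + \<kappa>)^3 / (1 - \<kappa>)\<^sup>2 < 1 + \<epsilon>"
    using assms by (intro order_tendstoD(2)) auto
  moreover have "\<forall>\<^sub>F \<kappa> in at_right (0::real). \<kappa> < 1"
    by (rule order_tendstoD(2)[OF tendsto_ident_at]) simp
  moreover have "\<forall>\<^sub>F \<kappa> in at_right (0::real). 0 < \<kappa>" by (rule eventually_at_right_less)
  ultimately have "\<forall>\<^sub>F \<kappa> in at_right (0::real). 0 < \<kappa> \<and> \<kappa> < 1 \<and> (1 + \<kappa>)^3 / (1 - \<kappa>)\<^sup>2 < 1 + \<epsilon>"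
    by eventually_elim auto
  then show ?thesis using that eventually_happens'[OF trivial_limit_at_right_real] by blast
qed

text \<open>The order of choice avoids circularity: \<open>\<kappa>\<close> determines the slab
  width \<open>\<theta>\<close>, this determines \<open>\<delta>\<close> and \<open>C\<close>, then
  come \<open>B\<close>, the size \<open>N\<close> and finally \<open>a\<close>.\<close>

lemma efficient_domain_exists:
  fixes \<epsilon> :: real
  assumes dim: "DIM('a::euclidean_space) \<ge> 2" and \<epsilon>: "\<epsilon> > 0"
  shows "\<exists>\<Omega> :: 'a set. \<Omega> \<noteq> {} \<and> open \<Omega> \<and> bounded \<Omega> \<and> connected \<Omega> \<and>
           Linf_norm \<Omega> (torsion_function \<Omega>) * ereal (dirichlet_bottom \<Omega>) < ereal (1 + \<epsilon>)"
proof -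
  obtain \<kappa> where \<kappa>: "0 < \<kappa>" "\<kappa> < 1" "(1 + \<kappa>)^3 / (1 - \<kappa>)\<^sup>2 < 1 + \<epsilon>"
    using obtain_tolerance[OF \<epsilon>] .
  obtain e1 e2 :: 'a where e: "e1 \<in> Basis" "e2 \<in> Basis" "e1 \<noteq> e2"
    using dim by (metis card_le_Suc0_iff_eq finite_Basis not_less_eq_eq numeral_2_eq_2)
  define c where "c = cutoff_const TYPE('a)"
  define v1 where "v1 = unit_ball_vol (real DIM('a))"
  have c0: "c > 0" by (simp add: c_def cutoff_const_def)
  have v0: "v1 > 0" by (simp add: v1_def)
  \<comment> \<open>The second entry makes the slabs occupy at most the fraction
    \<open>\<kappa> c\<close> of the ball; the bound 1/2 keeps \<open>cos (pi \<theta>)\<close>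
    nonnegative, so that \<open>\<delta> \<le> 1\<close>.\<close>
  define \<theta> where "\<theta> = min (1/2) (\<kappa> * c * v1 / (3 * 2 ^ DIM('a)))"
  have \<theta>: "0 < \<theta>" "\<theta> \<le> 1/2" "3 * \<theta> * 2 ^ DIM('a) \<le> \<kappa> * c * v1"
  proof -
    show "0 < \<theta>" "\<theta> \<le> 1/2" using \<kappa> c0 v0 by (auto simp: \<theta>_def)
    have "\<theta> \<le> \<kappa> * c * v1 / (3 * 2 ^ DIM('a))" unfolding \<theta>_def by (rule min.cobounded2)
    then show "3 * \<theta> * 2 ^ DIM('a) \<le> \<kappa> * c * v1" by (simp add: pos_le_divide_eq mult_ac)
  qed
  define \<delta> where "\<delta> = 1 - cos (pi * \<theta>)"
  have \<delta>: "0 < \<delta>" "\<delta> \<le> 1"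
  proof -
    have "pi * \<theta> \<le> pi * (1/2)" using \<theta> by (intro mult_left_mono) auto
    then have t: "0 < pi * \<theta>" "pi * \<theta> \<le> pi / 2" using \<theta> by auto
    have "cos (pi * \<theta>) < cos 0" using t pi_gt_zero by (intro cos_monotone_0_pi) linarith+
    then show "0 < \<delta>" by (simp add: \<delta>_def)
    have "0 \<le> cos (pi * \<theta>)" using t by (intro cos_ge_zero) linarith+
    then show "\<delta> \<le> 1" by (simp add: \<delta>_def)
  qed
  define C where "C = 4 - 2 * ln (\<delta> / 2)"
  have C0: "C \<ge> 0" using \<delta> ln_le_minus_one[of "\<delta> / 2"] by (simp add: C_def)
  \<comment> \<open>The gap between \<open>B + 8\<close> and \<open>B - C - 13\<close> is
    \<open>C + 21\<close>, and the last summand makes it at most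
    \<open>\<kappa> (B - C - 13)\<close>. The 28 secures \<open>B > 14\<close> for connectedness;
    the 13 leaves room for the \<open>- 2\<close> in \<open>b\<close>.\<close>
  define B where "B = C + 28 + (C + 21) / \<kappa>"
  have B: "B > 14" "B \<ge> 0" using C0 \<kappa> by (simp_all add: B_def add_pos_nonneg add_nonneg_nonneg)
  have B8: "B + 8 \<le> (1 + \<kappa>) * (B - C - 13)"
  proof -
    have "\<kappa> * (B - C - 13) = 15 * \<kappa> + (C + 21)" using \<kappa> by (simp add: B_def field_simps)
    then show ?thesis using \<kappa> by (simp add: distrib_right)
  qed
  \<comment> \<open>\<open>A\<close> grows linearly in \<open>N\<close>, so \<open>4 A / N^2\<close>
    is of order \<open>1 / N\<close>; this choice brings it below \<open>\<kappa> c\<close>.\<close>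
  obtain n :: nat where n: "4 * (B + 8) / (\<kappa> * c) < real n" using reals_Archimedean2 by blast
  define N where "N = Suc n"
  have N: "N > 0" "4 * (B + 8) \<le> \<kappa> * c * real N"
  proof -
    show "N > 0" by (simp add: N_def)
    have "4 * (B + 8) / (\<kappa> * c) \<le> real N" using n by (simp add: N_def)
    then show "4 * (B + 8) \<le> \<kappa> * c * real N" using \<kappa> c0 by (simp add: pos_divide_le_eq mult_ac)
  qed
  define M where "M = 2 * N"
  define Q where "Q = 2 * real M * (pi * (2 * real M) + 2) + B * real M"
  define K where "K = 2 * real M * (pi\<^sup>2 * (3 * exp (2 * Q)))"
  have M0: "real M \<ge> 2" using N by (simp add: M_def)
  have K0: "K > 0" using M0 by (simp add: K_def)
  \<comment> \<open>\<open>K a\<close> will bound the Laplacian added by the regularisation; it is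
    kept below the fraction \<open>\<kappa>\<close> of the main term \<open>2 pi\<close>.\<close>
  define a where "a = min 1 (2 * pi * \<kappa> / K)"
  have a: "0 < a" "a \<le> 1" "K * a \<le> 2 * pi * \<kappa>"
  proof -
    show "0 < a" "a \<le> 1" using \<kappa> K0 by (auto simp: a_def)
    have "a \<le> 2 * pi * \<kappa> / K" by (simp add: a_def)
    then show "K * a \<le> 2 * pi * \<kappa>" using K0 by (simp add: pos_le_divide_eq mult.commute)
  qed
  let ?u = "ice e1 e2 a B M"
  define \<Omega> where "\<Omega> = ice_domain e1 e2 a B M"
  define A where "A = (B + 8) * real M / (2 * pi)"
  \<comment> \<open>The \<open>- 2\<close> pays for the margin \<open>B + 2\<close> required in
    \<open>rayleigh_quotient_bound\<close>.\<close>
  define b where "b = (B - C) * real M / (2 * pi) - 2"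
  have O: "open \<Omega>" "bounded \<Omega>" unfolding \<Omega>_def by (rule ice_domain_open_bounded[OF a(1)])+
  have conn: "connected \<Omega>" "\<Omega> \<noteq> {}"
    unfolding \<Omega>_def M_def by (rule ice_domain_connected[OF e a(1) B(1) N(1)])+
  have usm: "smooth ?u" by (rule smooth_ice[OF a(1)])
  have \<Omega>D: "\<bar>x \<bullet> e2\<bar> \<le> real M" "?u x > 0" if "x \<in> \<Omega>" for x
    using that e(2) by (auto simp: \<Omega>_def ice_domain_def intro: less_imp_le)
  have uA: "?u x / (2 * pi) \<le> A" if "x \<in> \<Omega>" for x
    unfolding A_def using ice_le[OF a(1,2) \<Omega>D(1)[OF that]] by (intro divide_right_mono) auto
  have A0: "A > 0" unfolding A_def using B M0 by simp
  have Ab: "A \<le> (1 + \<kappa>) * b"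
  proof -
    have "2 * pi * A = (B + 8) * real M" by (simp add: A_def)
    also have "\<dots> \<le> ((1 + \<kappa>) * (B - C - 13)) * real M" by (intro mult_right_mono B8) simp
    also have "\<dots> = (1 + \<kappa>) * ((B - C) * real M - 13 * real M)" by (simp add: algebra_simps)
    also have "\<dots> \<le> (1 + \<kappa>) * ((B - C) * real M - 4 * pi)"
    proof -
      have "4 * pi \<le> 13 * real M" using pi_less_4 M0 by linarith
      then show ?thesis using \<kappa> by (intro mult_left_mono) auto
    qed
    also have "\<dots> = 2 * pi * ((1 + \<kappa>) * b)" by (simp add: b_def field_simps)
    finally show ?thesis by (rule mult_left_le_imp_le) simp
  qed
  have b0: "b > 0" using Ab A0 \<kappa> by (smt (verit) mult_nonneg_nonpos)
  have bA: "b \<le> A"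
  proof -
    have "(B - C) * real M / (2 * pi) \<le> A"
      unfolding A_def using C0 by (intro divide_right_mono mult_right_mono) auto
    then show ?thesis by (simp add: b_def)
  qed
  define W where "W x = (1 / (2 * pi)) * ?u x" for x
  have Wsm: "smooth W" unfolding W_def[abs_def] by (intro smooth_mult smooth_const usm)
  have lapW: "laplacian W x = (1 / (2 * pi)) * laplacian ?u x" for x
    unfolding W_def[abs_def] by (rule laplacian_cmult[OF usm])
  have "\<exists>\<phi>\<in>test_functions \<Omega>. (\<integral>x. (\<phi> x)\<^sup>2 \<partial>lebesgue_on \<Omega>) > 0 \<and>
     (\<integral>x. (norm (grad \<phi> x))\<^sup>2 \<partial>lebesgue_on \<Omega>) \<le> A * (1 + \<kappa>) / (b\<^sup>2 * (1 - \<kappa>)) * (\<integral>x. (\<phi> x)\<^sup>2 \<partial>lebesgue_on \<Omega>)"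
  proof (rule rayleigh_quotient_bound[OF O(1) Wsm, where N="real N" and Z="slabs e1 \<theta> N"])
    show "- 1 \<le> laplacian W x" for x
    proof -
      have "(1 / (2 * pi)) * (- 2 * pi) \<le> laplacian W x"
        unfolding lapW by (intro mult_left_mono laplacian_ice_ge e a) auto
      then show ?thesis by simp
    qed
    show "real N > 0" using N by simp
    \<comment> \<open>The ball has half the half-side \<open>M = 2 N\<close> of the cube, so within
      it the domain is described by positivity of \<open>W\<close> alone.\<close>
    show "x \<in> \<Omega>" if "norm x \<le> real N" "W x > 0" for x
    proof -
      have "\<bar>x \<bullet> i\<bar> < real M" if "i \<in> Basis" for i
        using Basis_le_norm[OF that, of x] \<open>norm x \<le> real N\<close> N by (simp add: M_def)
      then show ?thesis using that(2) by (simp add: \<Omega>_def ice_domain_def W_def zero_less_divide_iff)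
    qed
    show "W x \<le> A" if "x \<in> \<Omega>" for x using uA[OF that] by (simp add: W_def)
    show "slabs e1 \<theta> N \<in> sets lborel" "emeasure lborel (slabs e1 \<theta> N) < \<infinity>"
      by (rule slabs_measure[OF e(1) \<theta>(1) N(1)])+
    show "W x \<ge> b + 2" if x: "norm x < real N" "x \<notin> slabs e1 \<theta> N" for x
    proof -
      have "cos (pi * (x \<bullet> e1)) \<le> 1 - \<delta>"
        using cos_le_off_slabs[OF e(1) \<theta>(1,2) x] by (simp add: \<delta>_def)
      then have "(B - (4 - 2 * ln (\<delta> / 2))) * real M \<le> ?u x"
        using Basis_le_norm[OF e(2), of x] x(1)
        by (intro ice_ge hole_row_ge_of_cos_le a \<delta>) (auto simp: M_def)
      then have "(1 / (2 * pi)) * ((B - C) * real M) \<le> W x"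
        unfolding W_def C_def by (intro mult_left_mono) auto
      then show ?thesis by (simp add: b_def)
    qed
    show "measure lborel (slabs e1 \<theta> N) \<le> \<kappa> * cutoff_const TYPE('a) * measure lborel (ball (0::'a) (real N))"
    proof -
      have "measure lborel (slabs e1 \<theta> N) \<le> 3 * \<theta> * (2 * real N) ^ DIM('a)"
        by (rule slabs_measure[OF e(1) \<theta>(1) N(1)])
      also have "\<dots> = (3 * \<theta> * 2 ^ DIM('a)) * real N ^ DIM('a)" by (simp add: power_mult_distrib)
      also have "\<dots> \<le> (\<kappa> * c * v1) * real N ^ DIM('a)" by (intro mult_right_mono \<theta>) simp
      also have "\<dots> = \<kappa> * c * measure lborel (ball (0::'a) (real N))"
        using content_ball[of "real N" "0::'a"] by (simp add: v1_def)
      finally show ?thesis by (simp add: c_def)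
    qed
    show "4 * A / (real N)\<^sup>2 \<le> \<kappa> * cutoff_const TYPE('a)"
    proof -
      have "A = (B + 8) * real N / pi" by (simp add: A_def M_def)
      also have "\<dots> \<le> (B + 8) * real N / 1" using B pi_gt3 by (intro divide_left_mono) auto
      finally have "4 * A \<le> 4 * (B + 8) * real N" by (simp only: mult.assoc)
      also have "\<dots> \<le> (\<kappa> * c * real N) * real N" by (intro mult_right_mono N) simp
      finally show ?thesis using N by (simp add: pos_divide_le_eq power2_eq_square c_def mult_ac)
    qed
  qed (use b0 bA \<kappa> in auto)
  then obtain \<phi> where \<phi>: "\<phi> \<in> test_functions \<Omega>" "(\<integral>x. (\<phi> x)\<^sup>2 \<partial>lebesgue_on \<Omega>) > 0"
     "(\<integral>x. (norm (grad \<phi> x))\<^sup>2 \<partial>lebesgue_on \<Omega>) \<le> A * (1 + \<kappa>) / (b\<^sup>2 * (1 - \<kappa>)) * (\<integral>x. (\<phi> x)\<^sup>2 \<partial>lebesgue_on \<Omega>)"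
    by blast
  \<comment> \<open>\<open>W\<close> satisfies \<open>laplacian W \<ge> -1\<close>, as the test
    function requires, but on the domain only \<open>laplacian W \<le> - (1 - \<kappa>)\<close>.
    Rescaling yields a genuine supersolution at the cost of a factor
    \<open>1 / (1 - \<kappa>)\<close>.\<close>
  define V where "V x = (1 / (1 - \<kappa>)) * W x" for x
  have Vsm: "smooth V" unfolding V_def[abs_def] by (intro smooth_mult smooth_const Wsm)
  have lapV: "laplacian V x \<le> -1" if x: "x \<in> \<Omega>" for x
  proof -
    have "laplacian ?u x \<le> 2 * real M * (pi\<^sup>2 * (a * (3 * exp (2 * Q)))) - 2 * pi"
      by (rule laplacian_ice_le[OF e a(1,2) \<Omega>D[OF x] B(2) Q_def])
    also have "2 * real M * (pi\<^sup>2 * (a * (3 * exp (2 * Q)))) = K * a" by (simp add: K_def)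
    finally have "laplacian ?u x \<le> 2 * pi * (\<kappa> - 1)" using a(3) by (simp add: algebra_simps)
    then have "laplacian W x \<le> (1 / (2 * pi)) * (2 * pi * (\<kappa> - 1))"
      unfolding lapW by (intro mult_left_mono) auto
    then have "laplacian W x \<le> - (1 - \<kappa>)" by simp
    then have "(1 / (1 - \<kappa>)) * laplacian W x \<le> (1 / (1 - \<kappa>)) * (- (1 - \<kappa>))"
      using \<kappa> by (intro mult_left_mono) auto
    also have "\<dots> = -1" using \<kappa> by (simp add: divide_simps)
    finally show ?thesis unfolding V_def[abs_def] laplacian_cmult[OF Wsm] .
  qed
  have V0: "V x \<ge> 0" if "x \<in> \<Omega>" for x
    using \<Omega>D(2)[OF that] \<kappa> by (simp add: V_def W_def)
  have VA: "V x \<le> A / (1 - \<kappa>)" if "x \<in> \<Omega>" for x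
    using divide_right_mono[OF uA[OF that], of "1 - \<kappa>"] \<kappa> by (simp add: V_def W_def mult_ac)
  have "Linf_norm \<Omega> (torsion_function \<Omega>) * ereal (dirichlet_bottom \<Omega>) 
      \<le> ereal (A / (1 - \<kappa>) * (A * (1 + \<kappa>) / (b\<^sup>2 * (1 - \<kappa>))))"
    using A0 \<kappa> by (intro torsion_times_bottom_le[OF O Vsm V0 lapV VA _ \<phi>]) auto
  also have "A / (1 - \<kappa>) * (A * (1 + \<kappa>) / (b\<^sup>2 * (1 - \<kappa>))) = (A / b)\<^sup>2 * ((1 + \<kappa>) / (1 - \<kappa>)\<^sup>2)"
    by (simp add: power2_eq_square mult_ac)
  also have "\<dots> \<le> (1 + \<kappa>)\<^sup>2 * ((1 + \<kappa>) / (1 - \<kappa>)\<^sup>2)"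
    using Ab A0 b0 \<kappa> by (intro mult_right_mono power_mono) (auto simp: pos_divide_le_eq)
  also have "\<dots> = (1 + \<kappa>)^3 / (1 - \<kappa>)\<^sup>2" by (simp add: power2_eq_square power3_eq_cube)
  also have "\<dots> < 1 + \<epsilon>" by (rule \<kappa>(3))
  finally have "Linf_norm \<Omega> (torsion_function \<Omega>) * ereal (dirichlet_bottom \<Omega>) < ereal (1 + \<epsilon>)" by simp
  then show ?thesis using O conn by blast
qed

theorem theorem1:
  fixes \<epsilon> :: real
  assumes "CARD('m::finite) \<ge> 2" and "\<epsilon> > 0"
  shows "\<exists>\<Omega> :: (real ^ 'm) set.
           \<Omega> \<noteq> {} \<and> open \<Omega> \<and> bounded \<Omega> \<and> connected \<Omega> \<and>
           Linf_norm \<Omega> (torsion_function \<Omega>) * ereal (dirichlet_bottom \<Omega>) < ereal (1 + \<epsilon>)"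
  using assms by (intro efficient_domain_exists) auto

end
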